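(* Assume that $\log\min_{|e|=1}\omega(0,e)\in L^d(\mathbb{P})$, that $\int_0^\infty s\,\sigma_0(ds)\in L^d(\mathbf{P})$, and that the origin lies in the convex hull of the support of the law under $\mathbb{P}$ of $\sum_{|e|=1}\omega(0,e)e$. Then the following holds $\mathbb{P}\otimes\mathbf{P}$-a.s. and in $L^1(\mathbb{P}\otimes\mathbf{P})$: for all $\lambda\ge0$ and all sequences $(x_n)_{n=1}^\infty$ of $\mathbb{R}^d$ with $|x_n|\to\infty$, $$\lim_{n\to\infty}\frac{a_\lambda(0,[x_n],\omega,\sigma)-\alpha_\lambda(x_n)}{|x_n|}=0.$$
   Context: Fix $d\ge1$; $|x|=|x_1|+\dots+|x_d|$ is the $l^1$-norm on $\mathbb{R}^d$, and $[x]$ denotes a point of $\mathbb{Z}^d$ closest to $x$ in $l^1$-distance (chosen by a deterministic rule). Let $\mathcal{P}_1$ be the space of probability measures on $\{e\in\mathbb{Z}^d:|e|=1\}$ and $\Omega=\mathcal{P}_1^{\mathbb{Z}^d}$ with the product $\sigma$-field and an i.i.d. (product) probability measure $\mathbb{P}$. For an environment $\omega=(\omega(x,\cdot))_{x\in\mathbb{Z}^d}\in\Omega$, $P_\omega^x$ is the law of the Markov chain $X=(X_n)_{n\ge0}$ on $\mathbb{Z}^d$ with $P_\omega^x(X_0=x)=1$ and $P_\omega^x(X_{n+1}=y+e\mid X_n=y)=\omega(y,e)$. Let $\mathcal{P}_2$ be the space of Borel probability measures on $(0,\infty)$ and $\Sigma=\mathcal{P}_2^{\mathbb{Z}^d}$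 with the canonical $\sigma$-field and an i.i.d. (product) probability measure $\mathbf{P}$. For $\sigma=(\sigma_x)_{x\in\mathbb{Z}^d}\in\Sigma$, under $P^{\mathrm{HT}}_\sigma$ the holding times $\tau=(\tau_n(x))_{n\ge0,x\in\mathbb{Z}^d}$ are independent and $\tau_n(x)$ has law $\sigma_x$ for all $n$. The continuous-time process $(Z_t)_{t\ge0}$ is $Z_t=X_n$ if $\sum_{m=0}^{n-1}\tau_m(X_m)\le t<\sum_{m=0}^{n}\tau_m(X_m)$ (empty sum $=0$), and $Z_t=\Delta$ (a graveyard state) if $t\ge\sum_{m=0}^\infty\tau_m(X_m)$. Put $\tilde P^x_{\omega,\sigma}=P^x_\omega\otimes P^{\mathrm{HT}}_\sigma$. Expectations with respect to $\mathbb{P},\mathbf{P},\tilde P^x_{\omega,\sigma}$ are $\mathbb{E},\mathbf{E},\tilde E^x_{\omega,\sigma}$. With $H^Z(y)=\inf\{t\ge0:Z_t=y\}$, set $e_\lambda(x,y,\omega,\sigma)=\tilde E^x_{\omega,\sigma}[\exp\{-\lambda H^Z(y)\}\mathbf{1}_{\{H^Z(y)<\infty\}}]$ and $a_\lambda(x,y,\omega,\sigma)=-\log e_\lambda(x,y,\omega,\sigma)$ for $\lambda\ge0$, $x,y\in\mathbb{Z}^d$. The Lyapunov exponent $\alpha_\lambda:\mathbb{R}^d\to[0,\infty)$ is the nonrandom function given for $x\in\mathbb{Z}^d$ by $\alpha_\lambda(x)=\lim_{n\to\infty}\frac1n a_\lambda(0,nx,\omega,\sigma)$ ($\mathbb{P}\otimes\mathbf{P}$-a.s.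 and in $L^1$; also $=\inf_{n\ge1}\frac1n\mathbb{E}\otimes\mathbf{E}[a_\lambda(0,nx,\omega,\sigma)]$), extended to $\mathbb{Q}^d$ by $\alpha_\lambda(x/q)=\alpha_\lambda(x)/q$ for $q\in\mathbb{N}$, and to $\mathbb{R}^d$ by continuity. *)

theory Defs
  imports "HOL-Probability.Probability"
begin

section \<open>Lattice and \<open>l\<^sup>1\<close>-norm\<close>

type_synonym 'd site = "(int, 'd) vec"

definition l1norm :: "real ^ 'd \<Rightarrow> real" where
  "l1norm x = (\<Sum>i\<in>UNIV. \<bar>x $ i\<bar>)"

definition of_site :: "'d site \<Rightarrow> real ^ 'd" where
  "of_site z = (\<chi> i. of_int (z $ i))"

definition unit_steps :: "('d::finite) site set" where
  "unit_steps = {e. l1norm (of_site e) = 1}"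

text \<open>A deterministic rule \<open>x \<mapsto> [x]\<close> choosing an \<open>l\<^sup>1\<close>-closest lattice point.\<close>

definition nearest_site_rule :: "(real ^ 'd \<Rightarrow> ('d::finite) site) \<Rightarrow> bool" where
  "nearest_site_rule br \<longleftrightarrow>
     (\<forall>x z. l1norm (x - of_site (br x)) \<le> l1norm (x - of_site z))"

section \<open>Environments\<close>

text \<open>\<open>jump_laws\<close> and \<open>holding_laws\<close> are the measurable spaces \<open>\<P>\<^sub>1\<close> and \<open>\<P>\<^sub>2\<close>, with the
  \<open>\<sigma>\<close>-field generated by the evaluations.\<close>

definition jump_laws :: "('d::finite) site measure measure" where
  "jump_laws = prob_algebra (count_space unit_steps)"

definition holding_laws :: "real measure measure" where
  "holding_laws = prob_algebra (restrict_space borel {0<..})"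

type_synonym 'd jump_env = "'d site \<Rightarrow> 'd site measure"
type_synonym 'd holding_env = "'d site \<Rightarrow> real measure"

definition iid_field :: "'a measure \<Rightarrow> (('d::finite) site \<Rightarrow> 'a) measure" where
  "iid_field \<mu> = (\<Pi>\<^sub>M x\<in>UNIV. \<mu>)"

definition jump_prob :: "('d::finite) jump_env \<Rightarrow> 'd site \<Rightarrow> 'd site \<Rightarrow> real" where
  "jump_prob \<omega> x e = measure (\<omega> x) {e}"

definition min_jump :: "('d::finite) jump_env \<Rightarrow> real" where
  "min_jump \<omega> = Min (jump_prob \<omega> 0 ` unit_steps)"

definition drift :: "('d::finite) jump_env \<Rightarrow> real ^ 'd" where
  "drift \<omega> = (\<Sum>e\<in>unit_steps. jump_prob \<omega> 0 e *\<^sub>R of_site e)"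

definition mean_holding :: "('d::finite) holding_env \<Rightarrow> ennreal" where
  "mean_holding \<sigma> = (\<integral>\<^sup>+ s. ennreal s \<partial>\<sigma> 0)"

definition measure_support :: "'a::topological_space measure \<Rightarrow> 'a set" where
  "measure_support M = {x. \<forall>U. open U \<longrightarrow> x \<in> U \<longrightarrow> 0 < emeasure M U}"

section \<open>The quenched walk and its holding times\<close>

text \<open>Conditional law of \<open>X\<^sub>n\<close> given the history \<open>h = (X\<^sub>0, \<dots>, X\<^bsub>n-1\<^esub>)\<close>.\<close>

definition walk_kernel ::
  "('d::finite) jump_env \<Rightarrow> 'd site \<Rightarrow> nat \<Rightarrow> (nat \<Rightarrow> 'd site) \<Rightarrow> 'd site measure" where
  "walk_kernel \<omega> x n h =
     (case n of 0 \<Rightarrow> return (count_space UNIV) x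
      | Suc m \<Rightarrow> distr (\<omega> (h m)) (count_space UNIV) (\<lambda>e. h m + e))"

text \<open>\<open>P\<^sub>\<omega>\<^sup>x\<close>, obtained by the Ionescu-Tulcea theorem; \<open>emeasure_walk_law\<close> below confirms
  the finite-dimensional distributions.\<close>

definition walk_law :: "('d::finite) jump_env \<Rightarrow> 'd site \<Rightarrow> (nat \<Rightarrow> 'd site) measure" where
  "walk_law \<omega> x =
     projective_family.lim UNIV
       (Ionescu_Tulcea.CI (walk_kernel \<omega> x) (\<lambda>_. count_space UNIV)) (\<lambda>_. count_space UNIV)"

definition holding_law :: "('d::finite) holding_env \<Rightarrow> (nat \<times> 'd site \<Rightarrow> real) measure" where
  "holding_law \<sigma> = (\<Pi>\<^sub>M (n, x)\<in>UNIV. \<sigma> x)"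

definition quenched_law ::
  "('d::finite) jump_env \<Rightarrow> 'd holding_env \<Rightarrow> 'd site
    \<Rightarrow> ((nat \<Rightarrow> 'd site) \<times> (nat \<times> 'd site \<Rightarrow> real)) measure" where
  "quenched_law \<omega> \<sigma> x = walk_law \<omega> x \<Otimes>\<^sub>M holding_law \<sigma>"

text \<open>\<open>None\<close> is the graveyard state \<open>\<Delta>\<close>. Holding times are positive, so before the explosion
  time the index \<open>n\<close> exists and is unique.\<close>

definition Zproc ::
  "(nat \<Rightarrow> ('d::finite) site) \<Rightarrow> (nat \<times> 'd site \<Rightarrow> real) \<Rightarrow> real \<Rightarrow> 'd site option" where
  "Zproc X \<tau> t =
     (if (\<Sum>m. ennreal (\<tau> (m, X m))) \<le> ennreal t then None
      else Some (X (THE n. (\<Sum>m<n. \<tau> (m, X m)) \<le> t \<and> t < (\<Sum>m<Suc n. \<tau> (m, X m)))))"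

definition hitting_time ::
  "('d::finite) site \<Rightarrow> (nat \<Rightarrow> 'd site) \<Rightarrow> (nat \<times> 'd site \<Rightarrow> real) \<Rightarrow> ennreal" where
  "hitting_time y X \<tau> = (INF t\<in>{t. 0 \<le> t \<and> Zproc X \<tau> t = Some y}. ennreal t)"

definition e_fun ::
  "real \<Rightarrow> ('d::finite) site \<Rightarrow> 'd site \<Rightarrow> 'd jump_env \<Rightarrow> 'd holding_env \<Rightarrow> real" where
  "e_fun lam x y \<omega> \<sigma> =
     integral\<^sup>L (quenched_law \<omega> \<sigma> x)
       (\<lambda>(X, \<tau>). exp (- lam * enn2real (hitting_time y X \<tau>)) *
                 of_bool (hitting_time y X \<tau> < \<infinity>))"

text \<open>Where \<open>e_fun\<close> vanishes the cost is \<open>\<infinity>\<close>, while \<open>ln 0 = 0\<close> here. This only concerns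
  environments in which some jump probability is \<open>0\<close>, a null set whenever \<open>min_jump > 0\<close> a.s.\<close>

definition a_fun ::
  "real \<Rightarrow> ('d::finite) site \<Rightarrow> 'd site \<Rightarrow> 'd jump_env \<Rightarrow> 'd holding_env \<Rightarrow> real" where
  "a_fun lam x y \<omega> \<sigma> = - ln (e_fun lam x y \<omega> \<sigma>)"

section \<open>Lyapunov exponents\<close>

definition L1_limit :: "'a measure \<Rightarrow> (nat \<Rightarrow> 'a \<Rightarrow> real) \<Rightarrow> real \<Rightarrow> bool" where
  "L1_limit M f c \<longleftrightarrow>
     (\<forall>n. integrable M (f n)) \<and> (\<lambda>n. \<integral>\<xi>. \<bar>f n \<xi> - c\<bar> \<partial>M) \<longlonglongrightarrow> 0"

text \<open>In the following \<open>\<mu>\<close> and \<open>\<nu>\<close> are the one-site marginals of \<open>\<bbbP>\<close> and \<open>\<^bold>P\<close>.\<close>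

definition env_law ::
  "('d::finite) site measure measure \<Rightarrow> real measure measure
    \<Rightarrow> ('d jump_env \<times> 'd holding_env) measure" where
  "env_law \<mu> \<nu> = iid_field \<mu> \<Otimes>\<^sub>M iid_field \<nu>"

definition lyapunov_site ::
  "('d::finite) site measure measure \<Rightarrow> real measure measure \<Rightarrow> real \<Rightarrow> 'd site \<Rightarrow> real" where
  "lyapunov_site \<mu> \<nu> lam x = (THE c.
     (AE (\<omega>, \<sigma>) in env_law \<mu> \<nu>. (\<lambda>n. a_fun lam 0 (of_nat n *s x) \<omega> \<sigma> / n) \<longlonglongrightarrow> c) \<and>
     L1_limit (env_law \<mu> \<nu>) (\<lambda>n (\<omega>, \<sigma>). a_fun lam 0 (of_nat n *s x) \<omega> \<sigma> / n) c)"

definition lyapunov ::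
  "('d::finite) site measure measure \<Rightarrow> real measure measure \<Rightarrow> real \<Rightarrow> real ^ 'd \<Rightarrow> real" where
  "lyapunov \<mu> \<nu> lam = (THE \<alpha>.
     continuous_on UNIV \<alpha> \<and>
     (\<forall>x. \<forall>q::nat. 0 < q \<longrightarrow> \<alpha> (of_site x /\<^sub>R q) = lyapunov_site \<mu> \<nu> lam x / q))"

section \<open>Finite-dimensional distributions of the walk\<close>

lemma Ionescu_Tulcea_walk:
  fixes \<omega> :: "('d::finite) jump_env"
  assumes "\<And>y. \<omega> y \<in> space jump_laws"
  shows "Ionescu_Tulcea (walk_kernel \<omega> x) (\<lambda>_. count_space UNIV)"
proof (rule Ionescu_Tulcea.intro)
  have ps: "prob_space (\<omega> y)" and st: "sets (\<omega> y) = sets (count_space unit_steps)" for y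
    using assms[of y] by (auto simp: jump_laws_def space_prob_algebra)
  have shift: "(\<lambda>e. y + e) \<in> \<omega> y \<rightarrow>\<^sub>M count_space UNIV" for y
    by (simp add: measurable_cong_sets[OF st refl])
  have step: "prob_space (distr (\<omega> y) (count_space UNIV) (\<lambda>e. y + e))" for y
    by (rule prob_space.prob_space_distr[OF ps shift])
  show "prob_space (walk_kernel \<omega> x n h)" if "h \<in> space (PiM {0..<n} (\<lambda>_. count_space UNIV))" for n h
    by (cases n) (auto simp: walk_kernel_def step intro!: prob_space_return)
  show "walk_kernel \<omega> x n \<in> PiM {0..<n} (\<lambda>_. count_space UNIV) \<rightarrow>\<^sub>M subprob_algebra (count_space UNIV)" for n
  proof (cases n)
    case 0
    have "walk_kernel \<omega> x 0 = (\<lambda>_. return (count_space UNIV) x)"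
      by (simp add: walk_kernel_def fun_eq_iff)
    then show ?thesis
      by (auto simp: 0 space_subprob_algebra
            intro!: measurable_const prob_space_imp_subprob_space prob_space_return)
  next
    case (Suc m)
    have "(\<lambda>y. distr (\<omega> y) (count_space UNIV) (\<lambda>e. y + e))
            \<in> count_space UNIV \<rightarrow>\<^sub>M subprob_algebra (count_space UNIV)"
      by (auto simp: space_subprob_algebra intro!: prob_space_imp_subprob_space step)
    then have "(\<lambda>h. distr (\<omega> (h m)) (count_space UNIV) (\<lambda>e. h m + e))
            \<in> PiM {0..<n} (\<lambda>_. count_space UNIV) \<rightarrow>\<^sub>M subprob_algebra (count_space UNIV)"
      by (rule measurable_compose[rotated]) (simp add: Suc measurable_component_singleton)
    moreover have "walk_kernel \<omega> x n = (\<lambda>h. distr (\<omega> (h m)) (count_space UNIV) (\<lambda>e. h m + e))"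
      by (simp add: walk_kernel_def fun_eq_iff Suc)
    ultimately show ?thesis by simp
  qed
qed

lemma emeasure_walk_law:
  fixes \<omega> :: "('d::finite) jump_env"
  assumes "\<And>y. \<omega> y \<in> space jump_laws"
  shows "emeasure (walk_law \<omega> x) {X. \<forall>i\<le>n. X i = p i} =
           of_bool (p 0 = x) * ennreal (\<Prod>i<n. jump_prob \<omega> (p i) (p (Suc i) - p i))"
proof -
  interpret IT: Ionescu_Tulcea "walk_kernel \<omega> x" "\<lambda>_. count_space UNIV"
    by (rule Ionescu_Tulcea_walk) fact
  have ps: "prob_space (\<omega> y)" and st: "sets (\<omega> y) = sets (count_space unit_steps)" for y
    using assms[of y] by (auto simp: jump_laws_def space_prob_algebra)
  define A where "A n = (PiE {0..<n} (\<lambda>i. {p i}))" for n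
  have A_sets [measurable]: "A n \<in> sets (PiM {0..<n} (\<lambda>_. count_space UNIV))" for n
    unfolding A_def by (rule sets_PiM_I_finite) auto
  have kern: "emeasure (walk_kernel \<omega> x (Suc m) h) {p (Suc m)} =
      ennreal (jump_prob \<omega> (h m) (p (Suc m) - h m))" for h m
  proof -
    interpret prob_space "\<omega> (h m)" by (rule ps)
    have sp: "space (\<omega> (h m)) = unit_steps"
      using sets_eq_imp_space_eq[OF st] by simp
    let ?e = "p (Suc m) - h m"
    have "emeasure (walk_kernel \<omega> x (Suc m) h) {p (Suc m)} =
        emeasure (\<omega> (h m)) ((\<lambda>e. h m + e) -` {p (Suc m)} \<inter> space (\<omega> (h m)))"
      unfolding walk_kernel_def by (simp add: emeasure_distr measurable_cong_sets[OF st refl])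
    also have "(\<lambda>e. h m + e) -` {p (Suc m)} \<inter> space (\<omega> (h m)) = {?e} \<inter> unit_steps"
      by (auto simp: sp algebra_simps)
    also have "emeasure (\<omega> (h m)) \<dots> = emeasure (\<omega> (h m)) {?e}"
      by (cases "?e \<in> unit_steps") (auto simp: emeasure_notin_sets st)
    finally show ?thesis by (simp add: jump_prob_def emeasure_eq_measure)
  qed
  have C: "emeasure (IT.C 0 (Suc n) (\<lambda>_. undefined)) (A (Suc n)) =
      of_bool (p 0 = x) * ennreal (\<Prod>i<n. jump_prob \<omega> (p i) (p (Suc i) - p i))" for n
  proof -
    have bindC: "emeasure (IT.C 0 (Suc k) (\<lambda>_. undefined)) (A (Suc k)) =
      (\<integral>\<^sup>+h. emeasure (walk_kernel \<omega> x k h) {p k} * indicator (A k) h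
         \<partial>IT.C 0 k (\<lambda>_. undefined))" for k
    proof -
      have u: "(\<lambda>_. undefined) \<in> space (PiM {0..<0::nat} (\<lambda>_. count_space (UNIV :: 'd site set)))"
        by simp
      have "emeasure (IT.C 0 (Suc k) (\<lambda>_. undefined)) (A (Suc k)) =
          (\<integral>\<^sup>+h. emeasure (IT.eP k h) (A (Suc k)) \<partial>IT.C 0 k (\<lambda>_. undefined))"
        using emeasure_bind[of "IT.C 0 k (\<lambda>_. undefined)" "IT.eP k"
           "PiM {0..<Suc k} (\<lambda>_. count_space UNIV)" "A (Suc k)"]
          IT.prob_space_C[OF u, THEN prob_space.not_empty] IT.measurable_eP[of k]
        by (simp add: IT.space_C[OF u] measurable_cong_sets[OF IT.sets_C[OF u] refl])
      also have "\<dots> = (\<integral>\<^sup>+h. emeasure (walk_kernel \<omega> x k h) {p k} * indicator (A k) h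
         \<partial>IT.C 0 k (\<lambda>_. undefined))"
      proof (rule nn_integral_cong)
        fix h assume "h \<in> space (IT.C 0 k (\<lambda>_. undefined))"
        then have h: "h \<in> space (PiM {0..<k} (\<lambda>_. count_space UNIV))"
          by (simp add: IT.space_C[OF u])
        then have ext: "h \<in> extensional {0..<k}" by (simp add: space_PiM PiE_def)
        have "(\<lambda>y. h(k := y)) -` A (Suc k) = (if h \<in> A k then {p k} else {})"
          using ext by (auto simp: A_def PiE_iff less_Suc_eq extensional_def split: if_splits)
        then show "emeasure (IT.eP k h) (A (Suc k)) =
            emeasure (walk_kernel \<omega> x k h) {p k} * indicator (A k) h"
          by (simp add: IT.emeasure_eP[OF h] indicator_def)
      qed
      finally show ?thesis .
    qed
    show ?thesis
    proof (induction n)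
      case 0
      show ?case
        unfolding bindC
        by (auto simp: nn_integral_return PiM_empty A_def walk_kernel_def indicator_def)
    next
      case (Suc n)
      have "emeasure (IT.C 0 (Suc (Suc n)) (\<lambda>_. undefined)) (A (Suc (Suc n))) =
          (\<integral>\<^sup>+h. ennreal (jump_prob \<omega> (p n) (p (Suc n) - p n)) * indicator (A (Suc n)) h
            \<partial>IT.C 0 (Suc n) (\<lambda>_. undefined))"
        unfolding bindC[of "Suc n"] kern
        by (intro nn_integral_cong) (auto simp: indicator_def A_def PiE_iff)
      also have "\<dots> = ennreal (jump_prob \<omega> (p n) (p (Suc n) - p n)) *
          emeasure (IT.C 0 (Suc n) (\<lambda>_. undefined)) (A (Suc n))"
        by (rule nn_integral_cmult_indicator) (simp add: IT.sets_C space_PiM del: IT.C.simps)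
      finally show ?case
        by (simp add: Suc.IH jump_prob_def ennreal_mult' prod_nonneg mult_ac del: IT.C.simps)
    qed
  qed
  have "{X. \<forall>i\<le>n. X i = p i} = IT.PF.emb UNIV {0..<Suc n} (A (Suc n))"
    by (auto simp: prod_emb_def A_def PiE_iff less_Suc_eq_le)
  moreover have "emeasure (walk_law \<omega> x) \<dots> = emeasure (IT.CI {0..<Suc n}) (A (Suc n))"
    unfolding walk_law_def by (rule IT.lim) auto
  moreover have "\<dots> = emeasure (IT.C 0 (Suc n) (\<lambda>_. undefined)) (A (Suc n))"
    using IT.emeasure_CI[of "{0..<Suc n}" "Suc n" "A (Suc n)"]
    by (simp add: prod_emb_id A_def del: IT.C.simps)
  ultimately show ?thesis by (simp add: C del: IT.C.simps)
qed

end

theory Submission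
  imports Defs
begin

text \<open>
  Integrating out the independent holding times turns \<open>e_\<lambda>(x, y)\<close> into the discounted hitting
  probability of a killed walk, the limit of a finite recursion over the number of steps. From the
  recursion, \<open>a_\<lambda>\<close> is subadditive along intermediate points, is bounded by the sum of the costs
  \<open>|ln min \<omega>(x, \<cdot>)| + \<lambda> E\<sigma>\<^sub>x\<close> along any lattice path, increases in \<open>\<lambda>\<close>, and satisfies
  \<open>a_{r\<lambda>} \<le> r a_\<lambda>\<close> for \<open>r \<ge> 1\<close>. Kingman's theorem under the mixing shift of the environment gives
  the limits along all lattice directions.

  The moment of order \<open>d\<close> makes every site cost in a box of radius \<open>n\<close> negligible against \<open>n\<close>, and after
  truncation at a small multiple of \<open>n\<close> an exponential Markov inequality with parameter of order \<open>ln n / n\<close>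
  shows that all segments of length \<open>\<epsilon>n\<close> in the box have total cost at most \<open>\<eta>n\<close> (for \<open>d \<ge> 2\<close>; for
  \<open>d = 1\<close> this is Birkhoff's theorem). Hence \<open>a_\<lambda>(0, \<cdot>)\<close> is almost Lipschitz at large scales, a point \<open>z\<close>
  may be replaced by a multiple \<open>mv\<close> of one of finitely many \<open>v\<close>, and the convergence is uniform in the
  direction. Rational \<open>\<lambda>\<close> suffice because \<open>a_{\<lambda>'} \<le> (\<lambda>'/\<lambda>) a_\<lambda>\<close> for \<open>\<lambda> \<le> \<lambda>'\<close>.
\<close>

section \<open>Mixing and the subadditive ergodic theorem\<close>

text \<open>The value \<open>ln 0 = 0\<close> breaks subadditivity where a jump probability
  vanishes. Inequalities for \<open>a_fun\<close> are therefore proved on the set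
  \<open>good\<close>, and stationarity is applied to \<open>a0\<close>, which is \<open>0\<close>
  elsewhere. Mixing is the form of ergodicity used because it passes to the product of the two
  environments and holds for every shift by a nonzero vector, hence for all powers of one shift; the
  block argument for the upper bound in Kingman's theorem needs these powers. The scaling in
  \<lambda> and the bound by mean holding times are both Jensen's inequality. Nearby points are
  joined by changing one coordinate at a time, so only segments parallel to the axes matter. Of
  order \<open>n^d\<close> of them start in the box, and the exponential inequality gives each a
  failure probability \<open>n^{-(d+2)}\<close>, which leaves a summable \<open>n^{-2}\<close>. In
  dimension one no second moment is assumed, but two half-lines cover all segments, and their
  Birkhoff sums control every segment at once. L1 convergence follows from almost sure convergence
  because the cost per unit length is uniformly integrable: it is at most an average of stationary
  site costs along a path fixed in advance.\<close>

definition preserves :: "'a measure \<Rightarrow> ('a \<Rightarrow> 'a) \<Rightarrow> bool" where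
  "preserves M T \<longleftrightarrow> T \<in> M \<rightarrow>\<^sub>M M \<and> distr M M T = M"

text \<open>The maps \<open>T n\<close> need not be powers of one map. Shifts by
  \<open>of_nat n *s z\<close> and products of maps are thus covered as they stand; powers enter in
  \<open>mixing_zero_one\<close>.\<close>

definition mixing :: "'a measure \<Rightarrow> (nat \<Rightarrow> 'a \<Rightarrow> 'a) \<Rightarrow> bool" where
  "mixing M T \<longleftrightarrow> (\<forall>n. preserves M (T n)) \<and>
     (\<forall>A\<in>sets M. \<forall>B\<in>sets M. (\<lambda>n. measure M (A \<inter> T n -` B)) \<longlonglongrightarrow> measure M A * measure M B)"

text \<open>Formulated for sets containing their preimage rather than for invariant sets, since this
  is the property that subadditivity gives directly for the event in
  \<open>kingman_lower\<close>.\<close>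

definition zero_one :: "'a measure \<Rightarrow> ('a \<Rightarrow> 'a) \<Rightarrow> bool" where
  "zero_one M T \<longleftrightarrow>
     (\<forall>A\<in>sets M. T -` A \<inter> space M \<subseteq> A \<longrightarrow> measure M A = 0 \<or> measure M A = 1)"

lemma preserves_measurable: "preserves M T \<Longrightarrow> T \<in> M \<rightarrow>\<^sub>M M"
  and preserves_distr: "preserves M T \<Longrightarrow> distr M M T = M"
  by (auto simp: preserves_def)

lemma preserves_space: "preserves M T \<Longrightarrow> x \<in> space M \<Longrightarrow> T x \<in> space M"
  by (auto simp: preserves_def measurable_def)

lemma preserves_measure:
  assumes "preserves M T" "A \<in> sets M"
  shows "measure M (T -` A \<inter> space M) = measure M A"
  using measure_distr[of T M M A] assms by (auto simp: preserves_def)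

lemma preserves_integral:
  fixes f :: "'a \<Rightarrow> real"
  assumes "preserves M T" "f \<in> borel_measurable M"
  shows "(\<integral>x. f (T x) \<partial>M) = integral\<^sup>L M f"
  using integral_distr[of T M M f] assms by (auto simp: preserves_def)

lemma preserves_integrable:
  fixes f :: "'a \<Rightarrow> real"
  assumes "preserves M T" "integrable M f"
  shows "integrable M (\<lambda>x. f (T x))"
  using integrable_distr[of T M M f] assms by (auto simp: preserves_def)

lemma preserves_AE:
  assumes "preserves M T" "AE x in M. P x"
  shows "AE x in M. P (T x)"
proof -
  have "AE x in distr M M T. P x"
    unfolding preserves_distr[OF assms(1)] by (rule assms(2))
  then show ?thesis by (rule AE_distrD[OF preserves_measurable[OF assms(1)]])
qed

lemma preserves_compose:
  assumes "preserves M S" "preserves M T"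
  shows "preserves M (S \<circ> T)"
  using assms distr_distr[of S M M T M] by (auto simp: preserves_def intro: measurable_comp)

lemma preserves_funpow:
  assumes "preserves M T"
  shows "preserves M (T ^^ n)"
proof (induction n)
  case 0
  show ?case by (simp add: preserves_def id_def distr_id)
next
  case (Suc n)
  then show ?case using preserves_compose[OF assms Suc] by (simp add: o_def)
qed

text \<open>Dynkin's argument for limits. Complements pass because \<open>m n\<close> subtracts from
  its value on the whole space. Disjoint unions pass by Tannery's theorem: the domination by
  \<open>measure M\<close> is a summable bound uniform in \<open>n\<close>. The lemma serves each of
  the two sets in the mixing property in turn.\<close>

lemma (in prob_space) limit_from_generator:
  fixes m :: "nat \<Rightarrow> 'a set \<Rightarrow> real"
  assumes G: "Int_stable G" "G \<subseteq> Pow (space M)" "sets M = sigma_sets (space M) G"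
    and gen: "\<And>A. A \<in> G \<Longrightarrow> (\<lambda>n. m n A) \<longlonglongrightarrow> c * measure M A"
    and whole: "(\<lambda>n. m n (space M)) \<longlonglongrightarrow> c"
    and compl: "\<And>n A. A \<in> sets M \<Longrightarrow> m n (space M - A) = m n (space M) - m n A"
    and add: "\<And>n A. range A \<subseteq> sets M \<Longrightarrow> disjoint_family A \<Longrightarrow> (\<lambda>i. m n (A i)) sums m n (\<Union>i. A i)"
    and dom: "\<And>n A. A \<in> sets M \<Longrightarrow> 0 \<le> m n A \<and> m n A \<le> measure M A"
    and A: "A \<in> sets M"
  shows "(\<lambda>n. m n A) \<longlonglongrightarrow> c * measure M A"
proof -
  have "A \<in> sigma_sets (space M) G" using A G by simp
  from G(1,2) this show ?thesis
  proof (induction rule: sigma_sets_induct_disjoint)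
    case (basic A) then show ?case by (rule gen)
  next
    case empty
    have "m n {} = 0" for n using dom[of "{}" n] by simp
    then show ?case by simp
  next
    case (compl A)
    have A: "A \<in> sets M" using compl G by simp
    have "(\<lambda>n. m n (space M) - m n A) \<longlonglongrightarrow> c - c * measure M A"
      by (intro tendsto_diff whole compl)
    moreover have "c * measure M (space M - A) = c - c * measure M A"
      unfolding prob_compl[OF A] by (simp add: algebra_simps)
    ultimately show ?case using assms(6)[OF A] by simp
  next
    case (union A)
    have A: "range A \<subseteq> sets M" using union G by auto
    have sm: "(\<lambda>i. measure M (A i)) sums measure M (\<Union>i. A i)"
      by (rule finite_measure_UNION[OF A union(1)])
    have "(\<lambda>n. \<Sum>i. m n (A i)) \<longlonglongrightarrow> (\<Sum>i. c * measure M (A i))"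
    proof (rule tannerys_theorem[where M="\<lambda>i. measure M (A i)" and F=sequentially, THEN conjunct2, THEN conjunct2])
      show "((\<lambda>n. m n (A i)) \<longlongrightarrow> c * measure M (A i)) sequentially" for i by (rule union)
      have "norm (m n (A i)) \<le> measure M (A i)" for i n using dom[of "A i" n] A by auto
      then show "\<forall>\<^sub>F (i, n) in at_top \<times>\<^sub>F sequentially. norm (m n (A i)) \<le> measure M (A i)"
        by (intro always_eventually) simp
      show "summable (\<lambda>i. measure M (A i))" using sm by (simp add: sums_iff)
    qed simp
    also have "(\<Sum>i. c * measure M (A i)) = c * measure M (\<Union>i. A i)"
      by (rule sums_unique[OF sums_mult[OF sm], symmetric])
    finally show ?case by (simp only: sums_unique[OF add[OF A union(1)]])
  qed
qed

lemma (in prob_space) mixing_generator: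
  assumes G: "Int_stable G" "G \<subseteq> Pow (space M)" "sets M = sigma_sets (space M) G"
    and T: "\<And>n. preserves M (T n)"
    and gen: "\<And>A B. A \<in> G \<Longrightarrow> B \<in> G \<Longrightarrow>
      (\<lambda>n. measure M (A \<inter> T n -` B)) \<longlonglongrightarrow> measure M A * measure M B"
  shows "mixing M T"
proof -
  define P where "P n B = T n -` B \<inter> space M" for n B
  have P: "P n B \<in> sets M" "measure M (P n B) = measure M B" if "B \<in> sets M" for B n
    using measurable_sets[OF preserves_measurable[OF T] that] preserves_measure[OF T that] by (auto simp: P_def)
  have int: "A \<inter> P n B = A \<inter> T n -` B" if "A \<in> sets M" for A B n
    using sets.sets_into_space[OF that] by (auto simp: P_def)
  have Ps: "P n (space M) = space M" for n using preserves_space[OF T] by (auto simp: P_def)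
  have PD: "P n (space M - B) = space M - P n B" for n B using preserves_space[OF T] by (auto simp: P_def)
  have PU: "P n (\<Union>i. B i) = (\<Union>i. P n (B i))" for n and B :: "nat \<Rightarrow> 'a set" by (auto simp: P_def)
  have Pd: "disjoint_family (\<lambda>i. P n (B i))" if "disjoint_family B" for n and B :: "nat \<Rightarrow> 'a set"
    unfolding disjoint_family_on_def
  proof (intro ballI impI)
    fix i j :: nat assume "i \<noteq> j"
    then have "B i \<inter> B j = {}" using that by (simp add: disjoint_family_on_def)
    then show "P n (B i) \<inter> P n (B j) = {}" by (auto simp: P_def)
  qed
  have diff: "measure M ((space M - A) \<inter> C) = measure M (space M \<inter> C) - measure M (A \<inter> C)"
    if "A \<in> sets M" "C \<in> sets M" for A C
  proof -
    have "(space M - A) \<inter> C = C - A \<inter> C" "space M \<inter> C = C" using sets.sets_into_space[OF that(2)] by auto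
    then show ?thesis using finite_measure_Diff[of C "A \<inter> C"] that by simp
  qed
  have union: "(\<lambda>i. measure M (A i \<inter> C)) sums measure M ((\<Union>i. A i) \<inter> C)"
    if A: "range A \<subseteq> sets M" "disjoint_family A" and C: "C \<in> sets M" for A C
  proof -
    have "disjoint_family (\<lambda>i. A i \<inter> C)" by (rule disjoint_family_subset[OF A(2)]) auto
    then have "(\<lambda>i. measure M (A i \<inter> C)) sums measure M (\<Union>i. A i \<inter> C)"
      using A C by (intro finite_measure_UNION) blast+
    moreover have eq: "(\<Union>i. A i) \<inter> C = (\<Union>i. A i \<inter> C)" by auto
    ultimately show ?thesis by (simp only: eq)
  qed
  have one: "(\<lambda>n. measure M (A \<inter> P n B)) \<longlonglongrightarrow> measure M B * measure M A"
    if A: "A \<in> sets M" and B: "B \<in> G" for A B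
  proof -
    have B': "B \<in> sets M" using B G by auto
    show ?thesis
    proof (rule limit_from_generator[where m="\<lambda>n A. measure M (A \<inter> P n B)", OF G])
      show "(\<lambda>n. measure M (A \<inter> P n B)) \<longlonglongrightarrow> measure M B * measure M A" if "A \<in> G" for A
      proof -
        have "A \<in> sets M" using that G by auto
        then show ?thesis using gen[OF that B] by (simp add: int mult.commute)
      qed
      have "space M \<inter> P n B = P n B" for n by (auto simp: P_def)
      then show "(\<lambda>n. measure M (space M \<inter> P n B)) \<longlonglongrightarrow> measure M B" by (simp add: P(2)[OF B'])
      show "0 \<le> measure M (A \<inter> P n B) \<and> measure M (A \<inter> P n B) \<le> measure M A" if "A \<in> sets M" for n A
        using finite_measure_mono[OF Int_lower1 that] by simp
    qed (rule diff union A; (assumption | rule P(1)[OF B']))+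
  qed
  \<comment> \<open>The second extension varies \<open>B\<close> for arbitrary \<open>A\<close>,
    with \<open>one\<close> as its generator case. The domination now comes from invariance:
    \<open>P n B\<close> has the measure of \<open>B\<close>.\<close>
  have two: "(\<lambda>n. measure M (A \<inter> P n B)) \<longlonglongrightarrow> measure M A * measure M B"
    if A: "A \<in> sets M" and B: "B \<in> sets M" for A B
  proof (rule limit_from_generator[where m="\<lambda>n B. measure M (A \<inter> P n B)", OF G])
    show "(\<lambda>n. measure M (A \<inter> P n B)) \<longlonglongrightarrow> measure M A * measure M B" if "B \<in> G" for B
      using one[OF A that] by (simp add: mult.commute)
    show "(\<lambda>n. measure M (A \<inter> P n (space M))) \<longlonglongrightarrow> measure M A"
      using sets.sets_into_space[OF A] by (simp add: Ps Int_absorb2)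
    show "measure M (A \<inter> P n (space M - B)) = measure M (A \<inter> P n (space M)) - measure M (A \<inter> P n B)" if "B \<in> sets M" for n B
      using diff[OF P(1)[OF that] A] by (simp add: Ps PD Int_commute)
    show "(\<lambda>i. measure M (A \<inter> P n (B i))) sums measure M (A \<inter> P n (\<Union>i. B i))"
      if B: "range B \<subseteq> sets M" "disjoint_family B" for n B
    proof -
      have "range (\<lambda>i. P n (B i)) \<subseteq> sets M" using P(1) B(1) by blast
      from union[OF this Pd[OF B(2)] A] show ?thesis by (simp only: PU Int_commute)
    qed
    show "0 \<le> measure M (A \<inter> P n B) \<and> measure M (A \<inter> P n B) \<le> measure M B" if "B \<in> sets M" for n B
      using finite_measure_mono[OF Int_lower2 P(1)[OF that], of A n] P(2)[OF that] by simp
  qed (rule B)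
  show ?thesis using T two int by (simp add: mixing_def)
qed

text \<open>If \<open>A\<close> contains its preimage, its intersection with the preimage under
  \<open>T ^^ n\<close> is that preimage, of measure \<open>measure M A\<close> for every
  \<open>n\<close>. Mixing forces this number to equal its square.\<close>

lemma (in prob_space) mixing_zero_one:
  assumes mix: "mixing M (\<lambda>n. T ^^ n)"
  shows "zero_one M T"
  unfolding zero_one_def
proof (intro ballI impI)
  fix A assume A: "A \<in> sets M" and inv: "T -` A \<inter> space M \<subseteq> A"
  have T: "preserves M (T ^^ n)" for n using mix by (simp add: mixing_def)
  have incl: "(T ^^ n) -` A \<inter> space M \<subseteq> A" for n
  proof (induction n)
    case (Suc n)
    show ?case
    proof safe
      fix x assume "x \<in> space M" "(T ^^ Suc n) x \<in> A"
      then have "(T ^^ n) x \<in> A" using inv preserves_space[OF T, of x n] by auto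
      then show "x \<in> A" using Suc \<open>x \<in> space M\<close> by auto
    qed
  qed auto
  have "measure M (A \<inter> (T ^^ n) -` A) = measure M A" for n
  proof -
    have "A \<inter> (T ^^ n) -` A = (T ^^ n) -` A \<inter> space M"
      using incl[of n] sets.sets_into_space[OF A] by auto
    then show ?thesis using preserves_measure[OF T A] by simp
  qed
  then have "(\<lambda>n::nat. measure M A) \<longlonglongrightarrow> measure M A * measure M A"
    using mix[unfolded mixing_def, THEN conjunct2, rule_format, OF A A] by simp
  then have "measure M A = measure M A * measure M A"
    by (simp add: LIMSEQ_const_iff)
  then show "measure M A = 0 \<or> measure M A = 1" by (simp)
qed

text \<open>Steele's greedy covering of \<open>{0..<L}\<close>: a point that is not bad jumps ahead by some \<open>n \<le> N\<close> with
  \<open>g\<^sub>n < cn\<close>, a bad point advances by one.\<close>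

lemma subadditive_covering:
  fixes g :: "nat \<Rightarrow> 'a \<Rightarrow> real" and c :: real and N :: nat
  assumes sub: "\<And>m n x. x \<in> S \<Longrightarrow> g (m + n) x \<le> g m x + g n ((T ^^ m) x)"
    and T: "\<And>x. x \<in> S \<Longrightarrow> T x \<in> S" and g0: "\<And>x. x \<in> S \<Longrightarrow> g 0 x \<le> 0"
    and x: "x \<in> S"
  defines "bad \<equiv> \<lambda>x. \<forall>n\<in>{1..N}. c * n \<le> g n x"
  defines "u \<equiv> \<lambda>x. \<bar>g 1 x\<bar> + \<bar>c\<bar>"
  shows "g L x \<le> c * L + (\<Sum>j<L. of_bool (bad ((T ^^ j) x)) * u ((T ^^ j) x))
            + (\<Sum>j\<in>{L-N..<L}. u ((T ^^ j) x))"
  using x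
proof (induction L arbitrary: x rule: less_induct)
  case (less L x)
  have u: "0 \<le> u z" for z by (simp add: u_def)
  have TS: "(T ^^ j) x \<in> S" for j by (induction j) (auto intro: T less.prems)
  \<comment> \<open>The claimed bound splits along a jump of length \<open>n\<close>: the sums over
    bad points concatenate, and the terminal window of the remaining orbit lies inside the terminal
    window for \<open>L\<close>.\<close>
  have cl: "c * real L + (\<Sum>j<L. of_bool (bad ((T ^^ j) x)) * u ((T ^^ j) x))
            + (\<Sum>j\<in>{L-N..<L}. u ((T ^^ j) x)) \<ge>
     c * real n + c * real k + (\<Sum>j<n. of_bool (bad ((T ^^ j) x)) * u ((T ^^ j) x))
      + (\<Sum>j<k. of_bool (bad ((T ^^ j) ((T ^^ n) x))) * u ((T ^^ j) ((T ^^ n) x)))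
      + (\<Sum>j\<in>{k-N..<k}. u ((T ^^ j) ((T ^^ n) x)))"
    if L: "L = n + k" and nN: "n \<le> N \<or> N \<le> k" for n k
  proof -
    have "(\<Sum>j<n. of_bool (bad ((T ^^ j) x)) * u ((T ^^ j) x))
      + (\<Sum>j<k. of_bool (bad ((T ^^ j) ((T ^^ n) x))) * u ((T ^^ j) ((T ^^ n) x)))
       = (\<Sum>j<L. of_bool (bad ((T ^^ j) x)) * u ((T ^^ j) x))"
    proof -
      define F where "F j = of_bool (bad ((T ^^ j) x)) * u ((T ^^ j) x)" for j
      have "(\<Sum>j<k. F (j + n)) = sum F {n..<k + n}"
        using sum.shift_bounds_nat_ivl[of F 0 n k] by (simp add: lessThan_atLeast0)
      moreover have "sum F {..<n} + sum F {n..<k + n} = sum F {..<L}"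
        using sum.atLeastLessThan_concat[of 0 n "k + n" F] by (simp add: lessThan_atLeast0 L add.commute)
      ultimately show ?thesis unfolding F_def[abs_def] by (simp only: funpow_add o_apply)
    qed
    moreover have "(\<Sum>j\<in>{k-N..<k}. u ((T ^^ j) ((T ^^ n) x))) \<le> (\<Sum>j\<in>{L-N..<L}. u ((T ^^ j) x))"
    proof -
      have "(\<Sum>j\<in>{k-N..<k}. u ((T ^^ j) ((T ^^ n) x))) = (\<Sum>j\<in>{(k-N)+n..<k+n}. u ((T ^^ j) x))"
        by (simp only: sum.shift_bounds_nat_ivl funpow_add o_apply)
      also have "\<dots> \<le> (\<Sum>j\<in>{L-N..<L}. u ((T ^^ j) x))"
        using L nN by (intro sum_mono2) (auto simp: u)
      finally show ?thesis .
    qed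
    moreover have "c * real L = c * real n + c * real k" by (simp add: L distrib_left)
    ultimately show ?thesis by linarith
  qed
  have b0: "0 \<le> of_bool (bad z) * u z" for z by (simp add: u)
  consider "L = 0" | "L > 0" "bad x" | "L > 0" "\<not> bad x" by blast
  then show ?case
  proof cases
    case 1 then show ?thesis using g0[OF less.prems] by simp
  next
    case 2
    then obtain k where L: "L = 1 + k" by (metis Suc_pred plus_1_eq_Suc)
    have "g L x \<le> g 1 x + g k ((T ^^ 1) x)" unfolding L by (rule sub[OF less.prems])
    also have "g k ((T ^^ 1) x) \<le> c * real k + (\<Sum>j<k. of_bool (bad ((T ^^ j) ((T ^^ 1) x))) * u ((T ^^ j) ((T ^^ 1) x)))
            + (\<Sum>j\<in>{k-N..<k}. u ((T ^^ j) ((T ^^ 1) x)))"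
      by (rule less.IH) (use L TS[of 1] in auto)
    finally have 1: "g L x \<le> g 1 x + c * real k + (\<Sum>j<k. of_bool (bad ((T ^^ j) ((T ^^ 1) x))) * u ((T ^^ j) ((T ^^ 1) x)))
            + (\<Sum>j\<in>{k-N..<k}. u ((T ^^ j) ((T ^^ 1) x)))" by simp
    have "g 1 x \<le> c + u x" by (simp add: u_def)
    moreover have "1 \<le> N \<or> N \<le> k" by linarith
    note cl[OF L this]
    moreover have "(\<Sum>j<1. of_bool (bad ((T ^^ j) x)) * u ((T ^^ j) x)) = u x" using 2 by simp
    ultimately show ?thesis using 1 by (simp only: of_nat_1 mult_1_right)
  next
    case 3
    then obtain n where n: "1 \<le> n" "n \<le> N" "g n x < c * n" by (auto simp: bad_def not_le)
    show ?thesis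
    proof (cases "n \<le> L")
      case True
      then obtain k where L: "L = n + k" using le_Suc_ex by blast
      have "g L x \<le> g n x + g k ((T ^^ n) x)" unfolding L by (rule sub[OF less.prems])
      also have "g k ((T ^^ n) x) \<le> c * real k + (\<Sum>j<k. of_bool (bad ((T ^^ j) ((T ^^ n) x))) * u ((T ^^ j) ((T ^^ n) x)))
            + (\<Sum>j\<in>{k-N..<k}. u ((T ^^ j) ((T ^^ n) x)))"
        by (rule less.IH) (use L TS n in auto)
      finally have 1: "g L x \<le> g n x + c * real k + (\<Sum>j<k. of_bool (bad ((T ^^ j) ((T ^^ n) x))) * u ((T ^^ j) ((T ^^ n) x)))
            + (\<Sum>j\<in>{k-N..<k}. u ((T ^^ j) ((T ^^ n) x)))" by simp
      have "0 \<le> (\<Sum>j<n. of_bool (bad ((T ^^ j) x)) * u ((T ^^ j) x))"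
        by (intro sum_nonneg b0)
      then show ?thesis using 1 n cl[OF L disjI1[OF n(2)]] by linarith
    next
      case False
      \<comment> \<open>The jump overshoots, so \<open>L < n \<le> N\<close>: the terminal window is
        the whole of \<open>{0..<L}\<close> and pays for every point through
        \<open>u\<close>.\<close>
      then have LN: "L - N = 0" using n by simp
      have "g l x \<le> (\<Sum>j<l. \<bar>g 1 ((T ^^ j) x)\<bar>)" for l
      proof (induction l)
        case 0 show ?case using g0[OF less.prems] by simp
      next
        case (Suc l)
        have "g (l + 1) x \<le> g l x + g 1 ((T ^^ l) x)" by (rule sub[OF less.prems])
        with Suc show ?case by simp
      qed
      from this[of L] have "g L x \<le> (\<Sum>j<L. u ((T ^^ j) x)) - \<bar>c\<bar> * L"
        by (simp add: u_def sum.distrib mult.commute)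
      also have "\<dots> \<le> (\<Sum>j<L. u ((T ^^ j) x)) + c * L"
      proof -
        have "- (\<bar>c\<bar> * L) \<le> c * L" using mult_right_mono[of "-\<bar>c\<bar>" "c" "real L"] by simp
        then show ?thesis by simp
      qed
      also have "\<dots> \<le> c * L + (\<Sum>j<L. of_bool (bad ((T ^^ j) x)) * u ((T ^^ j) x))
            + (\<Sum>j\<in>{L-N..<L}. u ((T ^^ j) x))"
        using sum_nonneg[of "{..<L}" "\<lambda>j. of_bool (bad ((T ^^ j) x)) * u ((T ^^ j) x)"]
        by (simp add: LN u lessThan_atLeast0)
      finally show ?thesis .
    qed
  qed
qed

section \<open>Kingman's theorem: lower bound, Birkhoff's theorem, upper bound\<close>

lemma (in prob_space) kingman_lower:
  fixes g :: "nat \<Rightarrow> 'a \<Rightarrow> real" and c \<gamma> :: real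
  assumes T: "preserves M T" and erg: "zero_one M T"
    and int: "\<And>n. integrable M (g n)"
    and sub: "\<And>m n x. x \<in> space M \<Longrightarrow> g (m + n) x \<le> g m x + g n ((T ^^ m) x)"
    and g0: "\<And>x. x \<in> space M \<Longrightarrow> g 0 x \<le> 0"
    and \<gamma>: "\<And>n. \<gamma> * n \<le> (\<integral>x. g n x \<partial>M)" and c: "c < \<gamma>"
  shows "AE x in M. \<forall>\<^sub>F n in sequentially. c * n \<le> g n x"
proof -
  have [measurable]: "g n \<in> borel_measurable M" for n using int by auto
  have [measurable]: "T \<in> M \<rightarrow>\<^sub>M M" using T by (rule preserves_measurable)
  \<comment> \<open>The event that the lower limit of \<open>g n x / n\<close> is below
    \<open>b\<close>, with an explicit margin. It is shown to contain its preimage, so its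
    probability is \<open>0\<close> or \<open>1\<close>, and to miss a set of positive
    probability.\<close>
  define D where "D b = {x\<in>space M. \<exists>k. \<exists>\<^sub>F n in sequentially. g n x < (b - 1 / Suc k) * n}" for b :: real
  have [measurable]: "D b \<in> sets M" for b
    unfolding D_def frequently_sequentially by measurable
  \<comment> \<open>With positive probability \<open>g n x\<close> never falls below
    \<open>b * n\<close>. Otherwise the sets \<open>bad N\<close> decrease to a null set, and the
    integrated covering bound yields \<open>\<gamma> \<le> b\<close>.\<close>
  have low: "measure M (\<Inter>N. {x\<in>space M. \<forall>n\<in>{1..N}. b * n \<le> g n x}) > 0" if b: "b < \<gamma>" for b
  proof (rule ccontr)
    define bad where "bad N = {x\<in>space M. \<forall>n\<in>{1..N}. b * real n \<le> g n x}" for N :: nat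
    have bad[measurable]: "bad N \<in> sets M" for N unfolding bad_def by measurable
    define u where "u x = \<bar>g 1 x\<bar> + \<bar>b\<bar>" for x
    have iu: "integrable M u" unfolding u_def using int by auto
    have u0: "0 \<le> u x" for x by (simp add: u_def)
    assume "\<not> ?thesis"
    then have "measure M (\<Inter>N. bad N) = 0"
      using measure_nonneg[of M "\<Inter>N. bad N"] unfolding bad_def by linarith
    then have null: "AE x in M. x \<notin> (\<Inter>N. bad N)"
      by (subst (asm) prob_eq_0) auto
    have ib: "integrable M (\<lambda>x. indicator (bad N) x * u x)" for N
      using integrable_mult_indicator[OF bad[of N] iu] by simp
    \<comment> \<open>The covering bound integrated. By invariance each of the \<open>L\<close>
      positions contributes the same integral over \<open>bad N\<close>, and the terminal window
      contributes at most \<open>N\<close> times the mean of \<open>u\<close>.\<close>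
    have bound: "\<gamma> * L \<le> b * L + L * (\<integral>x. indicator (bad N) x * u x \<partial>M) + N * (\<integral>x. u x \<partial>M)" for L N :: nat
    proof -
      have pf: "preserves M (T ^^ j)" for j by (rule preserves_funpow[OF T])
      have "\<gamma> * L \<le> (\<integral>x. g L x \<partial>M)" by (rule \<gamma>)
      also have "\<dots> \<le> (\<integral>x. b * L + (\<Sum>j<L. indicator (bad N) ((T ^^ j) x) * u ((T ^^ j) x))
            + (\<Sum>j\<in>{L-N..<L}. u ((T ^^ j) x)) \<partial>M)"
      proof (rule integral_mono)
        fix x assume x: "x \<in> space M"
        have TS: "(T ^^ j) x \<in> space M" for j by (rule preserves_space[OF pf x])
        have "of_bool (\<forall>n\<in>{1..N}. b * real n \<le> g n ((T ^^ j) x)) = (indicator (bad N) ((T ^^ j) x) :: real)" for j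
          using TS[of j] by (simp add: bad_def indicator_def)
        then show "g L x \<le> b * L + (\<Sum>j<L. indicator (bad N) ((T ^^ j) x) * u ((T ^^ j) x))
            + (\<Sum>j\<in>{L-N..<L}. u ((T ^^ j) x))"
          using subadditive_covering[of "space M" g T x L b N, OF sub preserves_space[OF T] g0 x]
          by (simp only: u_def)
      qed (intro Bochner_Integration.integrable_add Bochner_Integration.integrable_sum
             preserves_integrable[OF pf iu] preserves_integrable[OF pf ib] int integrable_const)+
      also have "\<dots> = b * L + (\<Sum>j<L. (\<integral>x. indicator (bad N) x * u x \<partial>M)) + (\<Sum>j\<in>{L-N..<L}. integral\<^sup>L M u)"
      proof -
        have 1: "integrable M (\<lambda>x. u ((T ^^ j) x))" "(\<integral>x. u ((T ^^ j) x) \<partial>M) = integral\<^sup>L M u" for j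
          using preserves_integrable[OF pf iu] preserves_integral[OF pf, of u] borel_measurable_integrable[OF iu] by auto
        have 2: "integrable M (\<lambda>x. indicator (bad N) ((T ^^ j) x) * u ((T ^^ j) x))"
          "(\<integral>x. indicator (bad N) ((T ^^ j) x) * u ((T ^^ j) x) \<partial>M) = (\<integral>x. indicator (bad N) x * u x \<partial>M)" for j
          using preserves_integrable[OF pf ib[of N]] preserves_integral[OF pf, of "\<lambda>x. indicator (bad N) x * u x"]
            borel_measurable_integrable[OF ib[of N]] by auto
        define A where "A x = (\<Sum>j<L. indicator (bad N) ((T ^^ j) x) * u ((T ^^ j) x))" for x
        define B where "B x = (\<Sum>j\<in>{L-N..<L}. u ((T ^^ j) x))" for x
        have "integrable M A" "integral\<^sup>L M A = (\<Sum>j<L. (\<integral>x. indicator (bad N) x * u x \<partial>M))"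
          unfolding A_def by (intro Bochner_Integration.integrable_sum 2(1))
            (subst Bochner_Integration.integral_sum, rule 2(1), subst 2(2), rule refl)
        moreover have "integrable M B" "integral\<^sup>L M B = (\<Sum>j\<in>{L-N..<L}. integral\<^sup>L M u)"
          unfolding B_def by (intro Bochner_Integration.integrable_sum 1(1))
            (subst Bochner_Integration.integral_sum, rule 1(1), subst 1(2), rule refl)
        ultimately show ?thesis
          unfolding A_def[symmetric] B_def[symmetric] by (simp add: prob_space)
      qed
      also have "(\<Sum>j\<in>{L-N..<L}. integral\<^sup>L M u) \<le> N * integral\<^sup>L M u"
        using Bochner_Integration.integral_nonneg[of M u] u0 by (auto intro!: mult_right_mono)
      finally show ?thesis by simp
    qed
    \<comment> \<open>Division by \<open>L\<close> with \<open>N\<close> fixed makes the terminal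
      window disappear in the limit; only afterwards does \<open>N\<close> grow.\<close>
    have "\<gamma> \<le> b + (\<integral>x. indicator (bad N) x * u x \<partial>M)" for N
    proof -
      have "(\<lambda>L. b + (\<integral>x. indicator (bad N) x * u x \<partial>M) + N * (\<integral>x. u x \<partial>M) / real L)
          \<longlonglongrightarrow> b + (\<integral>x. indicator (bad N) x * u x \<partial>M) + 0"
        by (intro tendsto_intros lim_const_over_n)
      moreover have "\<forall>\<^sub>F L in sequentially. \<gamma> \<le> b + (\<integral>x. indicator (bad N) x * u x \<partial>M) + N * (\<integral>x. u x \<partial>M) / real L"
        using eventually_gt_at_top[of 0]
      proof eventually_elim
        case (elim L) then show ?case using bound[of L N] by (simp add: field_simps)
      qed
      ultimately show ?thesis using tendsto_lowerbound[of _ _ sequentially \<gamma>] by force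
    qed
    moreover have "(\<lambda>N. b + (\<integral>x. indicator (bad N) x * u x \<partial>M)) \<longlonglongrightarrow> b + (\<integral>x. 0 \<partial>M)"
    proof (intro tendsto_add tendsto_const integral_dominated_convergence[where w=u])
      show "AE x in M. (\<lambda>N. indicator (bad N) x * u x) \<longlonglongrightarrow> 0"
        using null
      proof eventually_elim
        case (elim x)
        then obtain N where N: "x \<notin> bad N" by auto
        have "\<forall>\<^sub>F n in sequentially. indicator (bad n) x * u x = 0"
          using eventually_ge_at_top[of N]
          by eventually_elim (use N in \<open>auto simp: bad_def indicator_def\<close>)
        then show ?case by (rule tendsto_eventually)
      qed
      show "AE x in M. norm (indicator (bad N) x * u x) \<le> u x" for N
        using u0 by (auto simp: indicator_def)
    qed (use iu ib in auto)
    ultimately have "\<gamma> \<le> b + 0"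
      by (intro tendsto_lowerbound) auto
    with b show False by simp
  qed
  have D01: "measure M (D b) = 0 \<or> measure M (D b) = 1" for b
  proof -
    have "T -` D b \<inter> space M \<subseteq> D b"
    proof safe
      fix x assume x: "x \<in> space M" and "T x \<in> D b"
      then obtain k where k: "\<exists>\<^sub>F n in sequentially. g n (T x) < (b - 1 / Suc k) * n"
        by (auto simp: D_def)
      \<comment> \<open>Going back from \<open>T x\<close> to \<open>x\<close> costs
        \<open>g 1 x\<close> and moves the index by one. Replacing the margin
        \<open>1 / Suc k\<close> by the next smaller one frees \<open>\<delta> * n\<close>, which
        beats this bounded error once \<open>n\<close> exceeds \<open>K\<close>.\<close>
      define \<delta> where "\<delta> = 1 / Suc k - 1 / Suc (Suc k)"
      have "1 / real (Suc (Suc k)) < 1 / real (Suc k)" by (rule divide_strict_left_mono) auto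
      then have \<delta>: "\<delta> > 0" by (simp add: \<delta>_def)
      define K where "K = nat \<lceil>(g 1 x + \<bar>b - 1 / Suc (Suc k)\<bar>) / \<delta>\<rceil>"
      have "\<exists>n\<ge>N. g n x < (b - 1 / Suc (Suc k)) * n" for N
      proof -
        obtain n where n: "n \<ge> max N K + 1" "g n (T x) < (b - 1 / Suc k) * n"
          using k unfolding frequently_sequentially by blast
        have nK: "g 1 x + \<bar>b - 1 / Suc (Suc k)\<bar> < \<delta> * n"
        proof -
          define y where "y = g 1 x + \<bar>b - 1 / Suc (Suc k)\<bar>"
          have "y / \<delta> \<le> K" unfolding K_def y_def by (rule real_nat_ceiling_ge)
          also have "real K < n" using n by simp
          finally have "y < \<delta> * n" using \<delta> by (simp add: field_simps)
          then show ?thesis by (simp add: y_def)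
        qed
        have "g (1 + n) x \<le> g 1 x + g n ((T ^^ 1) x)" by (rule sub[OF x])
        also have "\<dots> < g 1 x + (b - 1 / Suc k) * n" using n by simp
        also have "\<dots> = g 1 x + (b - 1 / Suc (Suc k)) * n - \<delta> * n" by (simp add: \<delta>_def algebra_simps)
        also have "\<dots> < (b - 1 / Suc (Suc k)) * n - \<bar>b - 1 / Suc (Suc k)\<bar>" using nK by simp
        also have "\<dots> \<le> (b - 1 / Suc (Suc k)) * (1 + n)"
          unfolding of_nat_add distrib_left by simp
        finally show ?thesis using n by (intro exI[of _ "1 + n"]) auto
      qed
      then show "x \<in> D b" using x unfolding D_def frequently_sequentially by blast
    qed
    then show ?thesis using erg by (auto simp: zero_one_def)
  qed
  have D0: "measure M (D b) = 0" if b: "b < \<gamma>" for b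
  proof (rule ccontr)
    assume "measure M (D b) \<noteq> 0"
    then have "AE x in M. x \<in> D b" using D01[of b] by (subst AE_in_set_eq_1) auto
    moreover have "D b \<inter> (\<Inter>N. {x\<in>space M. \<forall>n\<in>{1..N}. b * n \<le> g n x}) = {}"
    proof safe
      fix x assume "x \<in> D b" and x: "x \<in> (\<Inter>N. {x\<in>space M. \<forall>n\<in>{1..N}. b * n \<le> g n x})"
      then obtain k n where n: "n \<ge> (1::nat)" "g n x < (b - 1 / Suc k) * n"
        unfolding D_def frequently_sequentially by blast
      have "x \<in> {x\<in>space M. \<forall>m\<in>{1..n}. b * m \<le> g m x}" using x by blast
      then have "b * n \<le> g n x" using n by auto
      also have "\<dots> < b * n - n / Suc k" using n by (simp add: algebra_simps)
      finally have "0 < - (real n / Suc k)" by linarith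
      moreover have "0 \<le> real n / Suc k" by simp
      ultimately show "x \<in> {}" by linarith
    qed
    ultimately have "AE x in M. x \<notin> (\<Inter>N. {x\<in>space M. \<forall>n\<in>{1..N}. b * n \<le> g n x})"
      by (elim eventually_mono) blast
    moreover have "(\<Inter>N. {x\<in>space M. \<forall>n\<in>{1..N}. b * n \<le> g n x}) \<in> sets M"
      by measurable
    ultimately have "measure M (\<Inter>N. {x\<in>space M. \<forall>n\<in>{1..N}. b * n \<le> g n x}) = 0"
      by (subst prob_eq_0)
    with low[OF b] show False by simp
  qed
  define b where "b = (c + \<gamma>) / 2"
  have b: "c < b" "b < \<gamma>" using c by (auto simp: b_def)
  have "AE x in M. x \<notin> D b" using D0[OF b(2)] by (subst (asm) prob_eq_0) auto
  then show ?thesis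
    using AE_space
  proof eventually_elim
    case (elim x)
    obtain k where k: "1 / Suc k < b - c" using nat_approx_posE[of "b - c"] b by auto
    have "\<forall>\<^sub>F n in sequentially. (b - 1 / Suc k) * n \<le> g n x"
      using elim by (simp add: D_def frequently_def not_less)
    then show ?case
    proof eventually_elim
      case (elim n)
      have "c * n \<le> (b - 1 / Suc k) * n" using k by (intro mult_right_mono) auto
      with elim show ?case by simp
    qed
  qed
qed

text \<open>Birkhoff sums are additive, so \<open>kingman_lower\<close> applies to \<open>f\<close>
  and to \<open>- f\<close>; the second application is the upper bound.\<close>

lemma (in prob_space) birkhoff:
  fixes f :: "'a \<Rightarrow> real" and \<epsilon> :: real
  assumes T: "preserves M T" and erg: "zero_one M T" and f: "integrable M f" and \<epsilon>: "0 < \<epsilon>"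
  shows "AE x in M. \<forall>\<^sub>F n in sequentially. \<bar>(\<Sum>j<n. f ((T ^^ j) x)) - n * (\<integral>x. f x \<partial>M)\<bar> \<le> \<epsilon> * n"
proof -
  have *: "AE x in M. \<forall>\<^sub>F n in sequentially. ((\<integral>x. h x \<partial>M) - \<epsilon>) * n \<le> (\<Sum>j<n. h ((T ^^ j) x))"
    if h: "integrable M h" for h :: "'a \<Rightarrow> real"
  proof (rule kingman_lower[OF T erg, where \<gamma>="\<integral>x. h x \<partial>M"])
    have ih: "integrable M (\<lambda>x. h ((T ^^ j) x))" "(\<integral>x. h ((T ^^ j) x) \<partial>M) = (\<integral>x. h x \<partial>M)" for j
      using preserves_integrable[OF preserves_funpow[OF T] h] preserves_integral[OF preserves_funpow[OF T]] h by auto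
    show "integrable M (\<lambda>x. \<Sum>j<n. h ((T ^^ j) x))" for n
      by (intro Bochner_Integration.integrable_sum ih)
    show "(\<integral>x. h x \<partial>M) * real n \<le> (\<integral>x. (\<Sum>j<n. h ((T ^^ j) x)) \<partial>M)" for n
      by (subst Bochner_Integration.integral_sum) (simp_all add: ih)
    show "(\<Sum>j<m + n. h ((T ^^ j) x)) \<le> (\<Sum>j<m. h ((T ^^ j) x)) + (\<Sum>j<n. h ((T ^^ j) ((T ^^ m) x)))" for m n x
    proof -
      have "(\<Sum>j<n. h ((T ^^ j) ((T ^^ m) x))) = (\<Sum>j=m..<m+n. h ((T ^^ j) x))"
        using sum.shift_bounds_nat_ivl[of "\<lambda>j. h ((T ^^ j) x)" 0 m n]
        by (simp add: lessThan_atLeast0 funpow_add add.commute)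
      then show ?thesis
        using sum.atLeastLessThan_concat[of 0 m "m + n" "\<lambda>j. h ((T ^^ j) x)"] by (simp add: lessThan_atLeast0)
    qed
  qed (use \<epsilon> in auto)
  have "integrable M (\<lambda>x. - f x)" using f by simp
  from *[OF f] *[OF this] show ?thesis
  proof eventually_elim
    case (elim x)
    then show ?case
    proof eventually_elim
      case (elim n)
      then show ?case by (simp add: sum_negf algebra_simps abs_le_iff)
    qed
  qed
qed

text \<open>Time is cut into blocks of length \<open>N\<close>. Subadditivity bounds
  \<open>g\<close> at a multiple of \<open>N\<close> by a Birkhoff sum of \<open>g N\<close> under
  \<open>T ^^ N\<close>, whose ergodicity is the reason for the assumption on all powers. The
  incomplete last block is bounded by \<open>h\<close>.\<close>

lemma (in prob_space) kingman_upper: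
  fixes g :: "nat \<Rightarrow> 'a \<Rightarrow> real" and c :: real
  assumes T: "preserves M T" and erg: "\<And>N. 0 < N \<Longrightarrow> zero_one M (T ^^ N)"
    and int: "\<And>n. integrable M (g n)"
    and sub: "\<And>m n x. x \<in> space M \<Longrightarrow> g (m + n) x \<le> g m x + g n ((T ^^ m) x)"
    and g0: "\<And>x. x \<in> space M \<Longrightarrow> g 0 x \<le> 0"
    and N: "0 < N" and c: "(\<integral>x. g N x \<partial>M) < c * N"
  shows "AE x in M. \<forall>\<^sub>F n in sequentially. g n x \<le> c * n"
proof -
  define S where "S = T ^^ N"
  have S: "preserves M S" "zero_one M S" unfolding S_def by (rule preserves_funpow[OF T], rule erg[OF N])
  have Sj: "(S ^^ j) = T ^^ (j * N)" for j by (simp add: S_def funpow_mult mult.commute)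
  define h where "h x = (\<Sum>j<N. \<bar>g 1 ((T ^^ j) x)\<bar>)" for x
  have h: "integrable M h" unfolding h_def
    using preserves_integrable[OF preserves_funpow[OF T] int[of 1]] by auto
  define G where "G = (\<integral>x. g N x \<partial>M)"
  define \<epsilon> where "\<epsilon> = (c * N - G) / 8"
  have \<epsilon>: "0 < \<epsilon>" using c by (simp add: \<epsilon>_def G_def)
  show ?thesis
    using birkhoff[OF S int[of N] \<epsilon>] birkhoff[OF S h \<epsilon>] AE_space
  proof eventually_elim
    case (elim x)
    have TS: "(T ^^ j) x \<in> space M" for j using preserves_space[OF preserves_funpow[OF T] elim(3)] .
    have step: "g (m * N + r) x \<le> (\<Sum>j<m. g N ((S ^^ j) x)) + h ((S ^^ m) x)" if r: "r < N" for m r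
    proof -
      have 1: "g (m * N) x \<le> (\<Sum>j<m. g N ((S ^^ j) x))"
      proof (induction m)
        case 0 show ?case using g0[OF elim(3)] by simp
      next
        case (Suc m)
        have "g (m * N + N) x \<le> g (m * N) x + g N ((T ^^ (m * N)) x)" by (rule sub[OF elim(3)])
        with Suc show ?case by (simp add: Sj add.commute)
      qed
      have 2: "g r y \<le> (\<Sum>j<r. \<bar>g 1 ((T ^^ j) y)\<bar>)" if y: "y \<in> space M" for y
      proof (induction r)
        case 0 show ?case using g0[OF y] by simp
      next
        case (Suc r)
        have "g (r + 1) y \<le> g r y + g 1 ((T ^^ r) y)" by (rule sub[OF y])
        with Suc show ?case by simp
      qed
      have 3: "(\<Sum>j<r. \<bar>g 1 ((T ^^ j) y)\<bar>) \<le> h y" for y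
        unfolding h_def using r by (intro sum_mono2) auto
      have "g (m * N + r) x \<le> g (m * N) x + g r ((T ^^ (m * N)) x)" by (rule sub[OF elim(3)])
      with 1 2[OF TS[of "m * N"]] 3[of "(T ^^ (m * N)) x"] show ?thesis by (simp add: Sj)
    qed
    define H where "H = (\<integral>x. h x \<partial>M)"
    from elim obtain m0 where m0: "\<And>m. m \<ge> m0 \<Longrightarrow> (\<Sum>j<m. g N ((S ^^ j) x)) \<le> (G + \<epsilon>) * m"
        "\<And>m. m \<ge> m0 \<Longrightarrow> \<bar>(\<Sum>j<m. h ((S ^^ j) x)) - m * H\<bar> \<le> \<epsilon> * m"
    proof -
      from elim(1,2) have "\<forall>\<^sub>F m in sequentially. (\<Sum>j<m. g N ((S ^^ j) x)) \<le> (G + \<epsilon>) * m \<and> \<bar>(\<Sum>j<m. h ((S ^^ j) x)) - m * H\<bar> \<le> \<epsilon> * m"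
        by eventually_elim (auto simp: G_def H_def algebra_simps abs_le_iff)
      then show ?thesis using that unfolding eventually_sequentially by blast
    qed
    \<comment> \<open>A single term is the difference of two consecutive Birkhoff sums, hence small
      compared with \<open>m\<close>.\<close>
    have hb: "h ((S ^^ m) x) \<le> 2 * \<epsilon> * m + H + \<epsilon>" if "m \<ge> m0" for m
    proof -
      have "h ((S ^^ m) x) = (\<Sum>j<Suc m. h ((S ^^ j) x)) - (\<Sum>j<m. h ((S ^^ j) x))" by simp
      also have "\<dots> \<le> (Suc m * H + \<epsilon> * Suc m) - (m * H - \<epsilon> * m)"
        using m0(2)[of m] m0(2)[of "Suc m"] that unfolding abs_le_iff by linarith
      finally show ?thesis by (simp add: algebra_simps)
    qed
    \<comment> \<open>From \<open>m1\<close> on, \<open>\<epsilon> * m\<close> absorbs the constants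
      of \<open>hb\<close> and the error \<open>\<bar>c\<bar> * N\<close> made in replacing
      \<open>m * N\<close> by \<open>n\<close>; the sign of \<open>c\<close> is arbitrary.\<close>
    define m1 where "m1 = nat \<lceil>(\<bar>H\<bar> + \<epsilon> + \<bar>c\<bar> * N) / \<epsilon>\<rceil>"
    show ?case
      unfolding eventually_sequentially
    proof (intro exI[of _ "(max m0 m1 + 1) * N"] allI impI)
      fix n assume n: "(max m0 m1 + 1) * N \<le> n"
      define m where "m = n div N"
      define r where "r = n mod N"
      have nm: "n = m * N + r" by (simp add: m_def r_def)
      have r: "r < N" using N by (simp add: r_def)
      have m: "m \<ge> m0" "m \<ge> m1" using n N div_le_mono[OF n, of N] by (auto simp: m_def)
      have m1: "\<bar>H\<bar> + \<epsilon> + \<bar>c\<bar> * N \<le> \<epsilon> * m"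
      proof -
        have "(\<bar>H\<bar> + \<epsilon> + \<bar>c\<bar> * N) / \<epsilon> \<le> m1" unfolding m1_def by (rule real_nat_ceiling_ge)
        also have "real m1 \<le> m" using m by simp
        finally show ?thesis using \<epsilon> by (simp add: pos_divide_le_eq mult.commute)
      qed
      have "g n x \<le> (G + \<epsilon>) * m + (2 * \<epsilon> * m + H + \<epsilon>)"
        using step[OF r, of m] m0(1)[OF m(1)] hb[OF m(1)] by (simp add: nm)
      also have "\<dots> \<le> (G + \<epsilon>) * m + (2 * \<epsilon> * m + \<epsilon> * m - \<bar>c\<bar> * N)" using m1 by linarith
      also have "\<dots> = (G + 4 * \<epsilon>) * m - \<bar>c\<bar> * N" by (simp add: algebra_simps)
      also have "\<dots> \<le> (c * N) * m - \<bar>c\<bar> * N"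
      proof -
        have "G + 4 * \<epsilon> \<le> c * N" using c by (simp add: \<epsilon>_def G_def field_simps)
        then show ?thesis by (intro diff_mono mult_right_mono) auto
      qed
      also have "\<dots> \<le> c * n"
      proof -
        have "- (\<bar>c\<bar> * N) \<le> c * r"
        proof -
          have "- (c * r) \<le> \<bar>c\<bar> * r" using abs_ge_minus_self[of "c * r"] by (simp add: abs_mult)
          also have "\<dots> \<le> \<bar>c\<bar> * N" using r by (intro mult_left_mono) auto
          finally show ?thesis by simp
        qed
        then show ?thesis by (simp add: nm algebra_simps)
      qed
      finally show "g n x \<le> c * n" .
    qed
  qed
qed

text \<open>The limit is the infimum of the means of \<open>g n / n\<close>. Being a lower bound it
  feeds \<open>kingman_lower\<close>; being the greatest one it provides, for each margin
  \<open>1 / Suc k\<close>, an \<open>N\<close> for \<open>kingman_upper\<close>.\<close>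

lemma (in prob_space) kingman:
  fixes g :: "nat \<Rightarrow> 'a \<Rightarrow> real"
  assumes T: "preserves M T" and erg: "\<And>N. 0 < N \<Longrightarrow> zero_one M (T ^^ N)"
    and int: "\<And>n. integrable M (g n)"
    and sub: "\<And>m n x. x \<in> space M \<Longrightarrow> g (m + n) x \<le> g m x + g n ((T ^^ m) x)"
    and g0: "\<And>x. x \<in> space M \<Longrightarrow> g 0 x = 0"
    and pos: "\<And>n x. x \<in> space M \<Longrightarrow> 0 \<le> g n x"
  obtains \<gamma> where "AE x in M. (\<lambda>n. g n x / n) \<longlonglongrightarrow> \<gamma>"
proof -
  define \<gamma> where "\<gamma> = (INF n\<in>{0<..}. (\<integral>x. g n x \<partial>M) / real n)"
  have nn: "0 \<le> (\<integral>x. g n x \<partial>M)" for n using pos by (intro Bochner_Integration.integral_nonneg) auto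
  have bdd: "bdd_below ((\<lambda>n. (\<integral>x. g n x \<partial>M) / real n) ` {0<..})"
    by (rule bdd_belowI[of _ 0]) (auto simp: nn)
  have low: "\<gamma> * n \<le> (\<integral>x. g n x \<partial>M)" for n
  proof (cases "n = 0")
    case False
    then have "\<gamma> \<le> (\<integral>x. g n x \<partial>M) / n" unfolding \<gamma>_def by (intro cINF_lower bdd) auto
    then show ?thesis using False by (simp add: field_simps)
  qed (simp add: nn)
  have lo: "AE x in M. \<forall>\<^sub>F n in sequentially. (\<gamma> - 1 / Suc k) * n \<le> g n x" for k
    by (rule kingman_lower[OF T _ int sub]) (use erg[of 1] g0 low in auto)
  have up: "AE x in M. \<forall>\<^sub>F n in sequentially. g n x \<le> (\<gamma> + 1 / Suc k) * n" for k
  proof -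
    have "\<gamma> < \<gamma> + 1 / Suc k" by simp
    then obtain N where N: "0 < N" "(\<integral>x. g N x \<partial>M) / N < \<gamma> + 1 / Suc k"
      unfolding \<gamma>_def using cINF_less_iff[OF _ bdd, of "(INF n\<in>{0<..}. (\<integral>x. g n x \<partial>M) / real n) + 1 / Suc k"] by auto
    then have N2: "(\<integral>x. g N x \<partial>M) < (\<gamma> + 1 / Suc k) * N" by (simp add: pos_divide_less_eq)
    show ?thesis
      by (rule kingman_upper[OF T erg int sub _ N(1) N2]) (use g0 in auto)
  qed
  have "AE x in M. (\<lambda>n. g n x / n) \<longlonglongrightarrow> \<gamma>"
  proof -
    have "AE x in M. \<forall>k. (\<forall>\<^sub>F n in sequentially. (\<gamma> - 1 / Suc k) * n \<le> g n x) \<and> (\<forall>\<^sub>F n in sequentially. g n x \<le> (\<gamma> + 1 / Suc k) * n)"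
      unfolding AE_all_countable using lo up by auto
    then show ?thesis
    proof eventually_elim
      case (elim x)
      show ?case
      proof (rule LIMSEQ_I)
        fix r :: real assume "0 < r"
        then obtain k where k: "1 / Suc k < r" using nat_approx_posE by blast
        have "\<forall>\<^sub>F n in sequentially. (\<gamma> - 1 / Suc k) * n \<le> g n x" "\<forall>\<^sub>F n in sequentially. g n x \<le> (\<gamma> + 1 / Suc k) * n"
          using elim by auto
        then have "\<forall>\<^sub>F n in sequentially. norm (g n x / n - \<gamma>) < r"
          using eventually_gt_at_top[of 0]
        proof eventually_elim
          case (elim n)
          then have "\<gamma> - 1 / Suc k \<le> g n x / n" "g n x / n \<le> \<gamma> + 1 / Suc k"
            by (simp_all add: pos_le_divide_eq pos_divide_le_eq)
          with k show ?case unfolding real_norm_def by linarith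
        qed
        then show "\<exists>no. \<forall>n\<ge>no. norm (g n x / n - \<gamma>) < r" by (simp add: eventually_sequentially)
      qed
    qed
  qed
  then show ?thesis by (rule that)
qed

section \<open>Shifts of the environment\<close>

definition site_shift :: "'d site \<Rightarrow> (('d::finite) site \<Rightarrow> 'a) \<Rightarrow> 'd site \<Rightarrow> 'a" where
  "site_shift z \<omega> = (\<lambda>x. \<omega> (x + z))"

definition env_shift :: "'d site \<Rightarrow> ('d::finite) jump_env \<times> 'd holding_env \<Rightarrow> 'd jump_env \<times> 'd holding_env" where
  "env_shift z = map_prod (site_shift z) (site_shift z)"

lemma of_nat_vec_Suc: "of_nat (Suc n) *s z = z + of_nat n *s (z :: ('d::finite) site)"
  by (simp add: vec_eq_iff algebra_simps)

lemma shift_0 [simp]: "site_shift 0 = id"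
  by (simp add: site_shift_def fun_eq_iff)

lemma shift_shift: "site_shift z (site_shift w \<omega>) = site_shift (z + w) \<omega>"
  by (simp add: site_shift_def add.assoc)

lemma env_shift_funpow: "env_shift z ^^ n = env_shift (of_nat n *s z)"
proof (induction n)
  case 0
  show ?case by (simp add: env_shift_def vec_eq_iff fun_eq_iff)
next
  case (Suc n)
  then show ?case
    by (simp add: env_shift_def fun_eq_iff shift_shift of_nat_vec_Suc del: of_nat_Suc)
qed

section \<open>Mixing of i.i.d. fields under lattice shifts\<close>

lemma prob_space_iid_field: "prob_space \<kappa> \<Longrightarrow> prob_space (iid_field \<kappa>)"
  unfolding iid_field_def by (rule prob_space_PiM)

lemma preserves_shift:
  assumes "prob_space \<kappa>"
  shows "preserves (iid_field \<kappa>) (site_shift (z :: ('d::finite) site))"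
proof -
  have "distr (Pi\<^sub>M UNIV (\<lambda>_. \<kappa>)) (\<Pi>\<^sub>M i\<in>UNIV. \<kappa>) (\<lambda>\<omega>. \<lambda>n\<in>UNIV. \<omega> (n + z)) = (\<Pi>\<^sub>M i\<in>(UNIV::'d site set). \<kappa>)"
    by (rule distr_PiM_reindex[where f="\<lambda>n. n + z"]) (use assms in \<open>auto simp: inj_on_def\<close>)
  moreover have "(\<lambda>\<omega> n. \<omega> (n + z)) \<in> (Pi\<^sub>M UNIV (\<lambda>_. \<kappa>)) \<rightarrow>\<^sub>M (\<Pi>\<^sub>M i\<in>(UNIV::'d site set). \<kappa>)"
    by (rule measurable_PiM_single') (auto simp: space_PiM)
  ultimately show ?thesis
    by (simp add: preserves_def iid_field_def site_shift_def[abs_def] restrict_def)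
qed

text \<open>For cylinder sets the defining sequence is eventually constant: a large shift moves the
  finite base of \<open>B\<close> off the base of \<open>A\<close>, and the two events become
  independent.\<close>

lemma mixing_shift:
  fixes z :: "('d::finite) site"
  assumes \<kappa>: "prob_space \<kappa>" and z: "z \<noteq> 0"
  shows "mixing (iid_field \<kappa>) (\<lambda>n. site_shift (of_nat n *s z))"
proof -
  interpret \<kappa>: prob_space \<kappa> by fact
  interpret P: product_prob_space "\<lambda>_. \<kappa>" "UNIV :: 'd site set"
    by unfold_locales
  have sp: "space (iid_field \<kappa>) = (\<Pi>\<^sub>E i\<in>(UNIV::'d site set). space \<kappa>)"
    by (simp add: iid_field_def space_PiM)
  show ?thesis
  proof (rule prob_space.mixing_generator[OF prob_space_iid_field[OF \<kappa>]])
    show "Int_stable (prod_algebra (UNIV::'d site set) (\<lambda>_. \<kappa>))" by (rule Int_stable_prod_algebra)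
    show "prod_algebra (UNIV::'d site set) (\<lambda>_. \<kappa>) \<subseteq> Pow (space (iid_field \<kappa>))"
      unfolding sp by (rule prod_algebra_sets_into_space)
    show "sets (iid_field \<kappa>) = sigma_sets (space (iid_field \<kappa>)) (prod_algebra (UNIV::'d site set) (\<lambda>_. \<kappa>))"
      unfolding sp unfolding iid_field_def by (rule sets_PiM)
    show "preserves (iid_field \<kappa>) (site_shift (of_nat n *s z))" for n by (rule preserves_shift[OF \<kappa>])
    fix A B assume "A \<in> prod_algebra (UNIV::'d site set) (\<lambda>_. \<kappa>)" "B \<in> prod_algebra (UNIV::'d site set) (\<lambda>_. \<kappa>)"
    then obtain J E K F where A: "A = P.emb UNIV J (Pi\<^sub>E J E)" "finite J" "\<And>i. i \<in> J \<Longrightarrow> E i \<in> sets \<kappa>"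
      and B: "B = P.emb UNIV K (Pi\<^sub>E K F)" "finite K" "\<And>i. i \<in> K \<Longrightarrow> F i \<in> sets \<kappa>"
      by (elim prod_algebraE) metis
    obtain i where i: "z $ i \<noteq> 0" using z by (auto simp: vec_eq_iff)
    \<comment> \<open>A crude bound for all differences in a coordinate where \<open>z\<close> does
      not vanish. A shift by more than \<open>R\<close> steps changes this coordinate by more than
      any of them.\<close>
    define R where "R = (\<Sum>j\<in>J. \<Sum>k\<in>K. nat \<bar>j $ i - k $ i\<bar>)"
    have disj: "J \<inter> (\<lambda>k. k + of_nat n *s z) ` K = {}" if n: "n > R" for n
    proof safe
      fix k assume k: "k + of_nat n *s z \<in> J" "k \<in> K"
      have "nat \<bar>(k + of_nat n *s z) $ i - k $ i\<bar> \<le> (\<Sum>k'\<in>K. nat \<bar>(k + of_nat n *s z) $ i - k' $ i\<bar>)"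
        by (rule member_le_sum[OF k(2) _ B(2)]) auto
      also have "\<dots> \<le> R"
        unfolding R_def by (rule member_le_sum[OF k(1) _ A(2)]) auto
      finally have "\<bar>int n * z $ i\<bar> \<le> int R" by simp
      moreover have "int n * 1 \<le> int n * \<bar>z $ i\<bar>" using i by (intro mult_left_mono) auto
      ultimately show "k + of_nat n *s z \<in> {}" using n by (simp add: abs_mult)
    qed
    have "measure (iid_field \<kappa>) (A \<inter> site_shift (of_nat n *s z) -` B) = measure (iid_field \<kappa>) A * measure (iid_field \<kappa>) B"
      if n: "n > R" for n
    proof -
      define v where "v = of_nat n *s z"
      define K' where "K' = (\<lambda>k. k + v) ` K"
      define E' where "E' x = (if x \<in> J then E x else F (x - v))" for x
      have d: "J \<inter> K' = {}" using disj[OF n] by (simp add: K'_def v_def)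
      have "A \<inter> site_shift v -` B = P.emb UNIV (J \<union> K') (Pi\<^sub>E (J \<union> K') E')"
        using d unfolding A(1) B(1)
        by (auto simp: prod_emb_def PiE_iff site_shift_def K'_def E'_def extensional_def Ball_def split: if_splits; force)
      also have "measure (iid_field \<kappa>) \<dots> = (\<Prod>x\<in>J \<union> K'. measure \<kappa> (E' x))"
        unfolding iid_field_def
        by (rule P.measure_PiM_emb) (use A B in \<open>auto simp: E'_def K'_def\<close>)
      also have "\<dots> = (\<Prod>x\<in>J. measure \<kappa> (E' x)) * (\<Prod>x\<in>K'. measure \<kappa> (E' x))"
        using A B d by (intro prod.union_disjoint) (auto simp: K'_def)
      also have "(\<Prod>x\<in>J. measure \<kappa> (E' x)) = (\<Prod>x\<in>J. measure \<kappa> (E x))" by (simp add: E'_def)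
      also have "(\<Prod>x\<in>K'. measure \<kappa> (E' x)) = (\<Prod>k\<in>K. measure \<kappa> (F k))"
      proof -
        have "(\<Prod>x\<in>K'. measure \<kappa> (E' x)) = (\<Prod>k\<in>K. measure \<kappa> (E' (k + v)))"
          unfolding K'_def by (subst prod.reindex) (auto simp: inj_on_def)
        also have "\<dots> = (\<Prod>k\<in>K. measure \<kappa> (F k))"
          using d by (intro prod.cong) (auto simp: E'_def K'_def)
        finally show ?thesis .
      qed
      also have "(\<Prod>x\<in>J. measure \<kappa> (E x)) = measure (iid_field \<kappa>) A"
        unfolding iid_field_def A(1) by (rule P.measure_PiM_emb[symmetric]) (use A in auto)
      also have "(\<Prod>k\<in>K. measure \<kappa> (F k)) = measure (iid_field \<kappa>) B"
        unfolding iid_field_def B(1) by (rule P.measure_PiM_emb[symmetric]) (use B in auto)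
      finally show ?thesis by (simp add: v_def)
    qed
    then show "(\<lambda>n. measure (iid_field \<kappa>) (A \<inter> site_shift (of_nat n *s z) -` B)) \<longlonglongrightarrow> measure (iid_field \<kappa>) A * measure (iid_field \<kappa>) B"
      by (intro tendsto_eventually eventually_mono[OF eventually_gt_at_top[of R]])
  qed
qed

lemma preserves_map_prod:
  assumes M: "prob_space M" "prob_space N" and S: "preserves M S" and T: "preserves N T"
  shows "preserves (M \<Otimes>\<^sub>M N) (map_prod S T)"
proof -
  interpret M: prob_space M by fact
  interpret N: prob_space N by fact
  have [measurable]: "S \<in> M \<rightarrow>\<^sub>M M" "T \<in> N \<rightarrow>\<^sub>M N" using S T by (auto dest: preserves_measurable)
  have "M \<Otimes>\<^sub>M N = distr M M S \<Otimes>\<^sub>M distr N N T"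
    using S T by (simp add: preserves_distr)
  also have "\<dots> = distr (M \<Otimes>\<^sub>M N) (M \<Otimes>\<^sub>M N) (\<lambda>(x, y). (S x, T y))"
  proof (rule pair_measure_distr)
    show "sigma_finite_measure (distr N N T)"
      using T N.sigma_finite_measure_axioms by (simp add: preserves_distr)
  qed auto
  also have "(\<lambda>(x, y). (S x, T y)) = map_prod S T" by auto
  finally have "distr (M \<Otimes>\<^sub>M N) (M \<Otimes>\<^sub>M N) (map_prod S T) = M \<Otimes>\<^sub>M N" by simp
  moreover have "map_prod S T \<in> M \<Otimes>\<^sub>M N \<rightarrow>\<^sub>M M \<Otimes>\<^sub>M N"
    unfolding map_prod_def by measurable
  ultimately show ?thesis by (simp add: preserves_def)
qed

text \<open>On rectangles the measure factorizes and the two limits multiply. Ergodicity alone would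
  not pass to products.\<close>

lemma mixing_map_prod:
  assumes M: "prob_space M" "prob_space N" and S: "mixing M S" and T: "mixing N T"
  shows "mixing (M \<Otimes>\<^sub>M N) (\<lambda>n. map_prod (S n) (T n))"
proof -
  interpret M: prob_space M by fact
  interpret N: prob_space N by fact
  interpret MN: pair_prob_space M N by unfold_locales
  have pre: "preserves M (S n)" "preserves N (T n)" for n using S T by (auto simp: mixing_def)
  have rect: "measure (M \<Otimes>\<^sub>M N) (A \<times> B) = measure M A * measure N B" if "A \<in> sets M" "B \<in> sets N" for A B
    using that by (simp add: measure_def N.emeasure_pair_measure_Times enn2real_mult)
  show ?thesis
  proof (rule MN.mixing_generator)
    show "Int_stable {a \<times> b | a b. a \<in> sets M \<and> b \<in> sets N}" by (rule Int_stable_pair_measure_generator)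
    show "{a \<times> b | a b. a \<in> sets M \<and> b \<in> sets N} \<subseteq> Pow (space (M \<Otimes>\<^sub>M N))"
      unfolding space_pair_measure by (rule pair_measure_closed)
    show "sets (M \<Otimes>\<^sub>M N) = sigma_sets (space (M \<Otimes>\<^sub>M N)) {a \<times> b | a b. a \<in> sets M \<and> b \<in> sets N}"
      unfolding space_pair_measure by (rule sets_pair_measure)
    show "preserves (M \<Otimes>\<^sub>M N) (map_prod (S n) (T n))" for n
      by (rule preserves_map_prod[OF M pre])
    fix A B assume "A \<in> {a \<times> b | a b. a \<in> sets M \<and> b \<in> sets N}" "B \<in> {a \<times> b | a b. a \<in> sets M \<and> b \<in> sets N}"
    then obtain A1 A2 B1 B2 where AB: "A = A1 \<times> A2" "B = B1 \<times> B2"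
      and [measurable]: "A1 \<in> sets M" "A2 \<in> sets N" "B1 \<in> sets M" "B2 \<in> sets N" by auto
    have eq: "A \<inter> map_prod (S n) (T n) -` B = (A1 \<inter> S n -` B1) \<times> (A2 \<inter> T n -` B2)" for n
      unfolding AB by auto
    have s1: "A1 \<inter> S n -` B1 \<in> sets M" "A2 \<inter> T n -` B2 \<in> sets N" for n
    proof -
      have "A1 \<inter> S n -` B1 = A1 \<inter> (S n -` B1 \<inter> space M)" "A2 \<inter> T n -` B2 = A2 \<inter> (T n -` B2 \<inter> space N)"
        using sets.sets_into_space[of A1 M] sets.sets_into_space[of A2 N] by auto
      then show "A1 \<inter> S n -` B1 \<in> sets M" "A2 \<inter> T n -` B2 \<in> sets N"
        using measurable_sets[OF preserves_measurable[OF pre(1)], of B1 n] measurable_sets[OF preserves_measurable[OF pre(2)], of B2 n]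
        by simp_all
    qed
    have "(\<lambda>n. measure M (A1 \<inter> S n -` B1) * measure N (A2 \<inter> T n -` B2)) \<longlonglongrightarrow>
        (measure M A1 * measure M B1) * (measure N A2 * measure N B2)"
      using S T by (intro tendsto_mult) (auto simp: mixing_def)
    then show "(\<lambda>n. measure (M \<Otimes>\<^sub>M N) (A \<inter> map_prod (S n) (T n) -` B)) \<longlonglongrightarrow>
        measure (M \<Otimes>\<^sub>M N) A * measure (M \<Otimes>\<^sub>M N) B"
      unfolding eq by (simp add: rect s1 AB mult_ac)
  qed
qed

lemma site_shift_funpow: "site_shift z ^^ n = site_shift (of_nat n *s z)"
proof (induction n)
  case 0
  show ?case by (simp add: fun_eq_iff)
next
  case (Suc n)
  show ?case
    by (rule ext) (simp add: Suc shift_shift of_nat_vec_Suc del: of_nat_Suc)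
qed

lemma zero_one_shift:
  fixes z :: "('d::finite) site" and \<kappa> :: "'a measure"
  assumes "prob_space \<kappa>" "z \<noteq> 0"
  shows "zero_one (iid_field \<kappa>) (site_shift z)"
proof -
  show ?thesis
    by (intro prob_space.mixing_zero_one[OF prob_space_iid_field[OF assms(1)]]) (simp only: site_shift_funpow mixing_shift[OF assms])
qed

lemma
  assumes "prob_space \<mu>" "prob_space \<nu>"
  shows prob_space_env_law: "prob_space (env_law \<mu> \<nu>)"
    and preserves_env_shift: "preserves (env_law \<mu> \<nu>) (env_shift z)"
    and zero_one_env_shift: "z \<noteq> 0 \<Longrightarrow> zero_one (env_law \<mu> \<nu>) (env_shift z)"
proof -
  note p = prob_space_iid_field[OF assms(1)] prob_space_iid_field[OF assms(2)]
  show P: "prob_space (env_law \<mu> \<nu>)" unfolding env_law_def by (intro prob_space_pair p)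
  show "preserves (env_law \<mu> \<nu>) (env_shift z)" 
    unfolding env_law_def env_shift_def by (intro preserves_map_prod p preserves_shift assms)
  assume z: "z \<noteq> 0"
  have "mixing (env_law \<mu> \<nu>) (\<lambda>n. env_shift (of_nat n *s z))"
    unfolding env_law_def env_shift_def by (intro mixing_map_prod p mixing_shift assms z)
  then show "zero_one (env_law \<mu> \<nu>) (env_shift z)"
    using prob_space.mixing_zero_one[OF P] by (simp add: env_shift_funpow)
qed

section \<open>The Laplace transform of the hitting time as a recursion over steps\<close>

lemma vec_box_subset: "{v :: 'a ^ 'n::finite. \<forall>i. v $ i \<in> A} \<subseteq> vec_lambda ` (\<Pi>\<^sub>E i\<in>UNIV. A)"
proof safe
  fix v :: "'a ^ 'n" assume "\<forall>i. v $ i \<in> A"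
  then have "vec_nth v \<in> (\<Pi>\<^sub>E i\<in>UNIV. A)" by auto
  then have "vec_lambda (vec_nth v) \<in> vec_lambda ` (\<Pi>\<^sub>E i\<in>UNIV. A)" by (rule imageI)
  then show "v \<in> vec_lambda ` (\<Pi>\<^sub>E i\<in>UNIV. A)" by simp
qed

lemma finite_vec_box: "finite A \<Longrightarrow> finite {v :: 'a ^ 'n::finite. \<forall>i. v $ i \<in> A}"
  by (rule finite_subset[OF vec_box_subset]) (intro finite_imageI finite_PiE, auto)

text \<open>The integrand depends on the coordinates in \<open>J\<close> only, so the product
  measure is projected to the finite product over \<open>J\<close>. Used for the holding times along
  a path and for the exponential moments along a segment.\<close>

lemma
  fixes g :: "'i \<Rightarrow> 'a \<Rightarrow> real"
  assumes M: "\<And>i. prob_space (M i)" and J: "finite J" and g: "\<And>i. i \<in> J \<Longrightarrow> integrable (M i) (g i)"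
  shows integral_PiM_prod: "(\<integral>\<omega>. (\<Prod>i\<in>J. g i (\<omega> i)) \<partial>PiM UNIV M) = (\<Prod>i\<in>J. integral\<^sup>L (M i) (g i))"
    and integrable_PiM_prod: "integrable (PiM UNIV M) (\<lambda>\<omega>. \<Prod>i\<in>J. g i (\<omega> i))"
proof -
  interpret M: prob_space "M i" for i by (rule M)
  interpret P: product_prob_space M UNIV by unfold_locales
  have r: "(\<lambda>\<omega>. restrict \<omega> J) \<in> PiM UNIV M \<rightarrow>\<^sub>M PiM J M" by (rule measurable_restrict_subset) simp
  have gm: "(\<lambda>\<omega>. \<Prod>i\<in>J. g i (\<omega> i)) \<in> borel_measurable (PiM J M)"
    using g by (intro borel_measurable_prod measurable_compose[OF measurable_component_singleton]) auto
  have eq: "(\<Prod>i\<in>J. g i (restrict \<omega> J i)) = (\<Prod>i\<in>J. g i (\<omega> i))" for \<omega> by simp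
  have d: "distr (PiM UNIV M) (PiM J M) (\<lambda>\<omega>. restrict \<omega> J) = PiM J M"
    by (rule P.distr_PiM_restrict_finite[OF J]) simp
  show "(\<integral>\<omega>. (\<Prod>i\<in>J. g i (\<omega> i)) \<partial>PiM UNIV M) = (\<Prod>i\<in>J. integral\<^sup>L (M i) (g i))"
    using integral_distr[OF r gm] P.product_integral_prod[OF J g] unfolding d eq by simp
  show "integrable (PiM UNIV M) (\<lambda>\<omega>. \<Prod>i\<in>J. g i (\<omega> i))"
    using integrable_distr[OF r, of "\<lambda>\<omega>. \<Prod>i\<in>J. g i (\<omega> i)"] P.product_integrable_prod[OF J g] unfolding d eq by simp
qed

lemma finite_unit_steps: "finite (unit_steps :: ('d::finite) site set)"
proof (rule finite_subset)
  show "(unit_steps :: 'd site set) \<subseteq> {v. \<forall>i. v $ i \<in> {-1..1}}"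
  proof safe
    fix e :: "'d site" and i assume "e \<in> unit_steps"
    then have "(\<Sum>i\<in>UNIV. \<bar>e $ i\<bar>) = 1"
      by (simp add: unit_steps_def l1norm_def of_site_def flip: of_int_abs of_int_sum)
    moreover have "\<bar>e $ i\<bar> \<le> (\<Sum>i\<in>UNIV. \<bar>e $ i\<bar>)" by (rule member_le_sum) auto
    ultimately show "e $ i \<in> {-1..1}" by auto
  qed
qed (rule finite_vec_box, simp)

section \<open>Discounted first passage along a fixed path\<close>

definition first_hit :: "'d site \<Rightarrow> nat \<Rightarrow> (nat \<Rightarrow> ('d::finite) site) \<Rightarrow> bool" where
  "first_hit y k X \<longleftrightarrow> X k = y \<and> (\<forall>i<k. X i \<noteq> y)"

text \<open>At most one summand is nonzero, that of the first visit to \<open>y\<close>. With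
  \<open>r m x = exp (- lam * \<tau> (m, x))\<close> it is the discount
  \<open>exp (- lam * H)\<close> restricted to hits within \<open>N\<close> jumps; with the Laplace
  transforms of the holding laws it is the mean of this over \<tau>.\<close>

definition disc_hit :: "(nat \<Rightarrow> ('d::finite) site \<Rightarrow> real) \<Rightarrow> 'd site \<Rightarrow> nat \<Rightarrow> (nat \<Rightarrow> 'd site) \<Rightarrow> real" where
  "disc_hit r y N X = (\<Sum>k\<le>N. of_bool (first_hit y k X) * (\<Prod>m<k. r m (X m)))"

text \<open>The mean of \<open>disc_hit\<close> over a walk with jump law \<open>p x\<close>,
  conditioned on its first step. Here \<open>q x\<close> is the discount for one visit to
  \<open>x\<close>, so \<open>q\<close> can also be read as a survival probability.\<close>

primrec hit_gen :: "(('d::finite) site \<Rightarrow> 'd site \<Rightarrow> real) \<Rightarrow> ('d site \<Rightarrow> real) \<Rightarrow> 'd site \<Rightarrow> nat \<Rightarrow> 'd site \<Rightarrow> real" where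
  "hit_gen p q y 0 x = of_bool (x = y)"
| "hit_gen p q y (Suc n) x =
     (if x = y then 1 else q x * (\<Sum>e\<in>unit_steps. p x e * hit_gen p q y n (x + e)))"

lemma first_hit_unique: "first_hit y k X \<Longrightarrow> first_hit y j X \<Longrightarrow> k = j"
  by (metis first_hit_def linorder_neqE_nat)

lemma first_hit_Least:
  assumes "X n = y"
  shows "\<exists>k\<le>n. first_hit y k X"
proof (intro exI conjI)
  show "(LEAST k. X k = y) \<le> n" by (rule Least_le) (rule assms)
  have "X (LEAST k. X k = y) = y" by (rule LeastI) (rule assms)
  then show "first_hit y (LEAST k. X k = y) X"
    by (auto simp: first_hit_def dest: not_less_Least)
qed

lemma first_hit_Suc: "first_hit y (Suc k) X \<longleftrightarrow> X 0 \<noteq> y \<and> first_hit y k (\<lambda>i. X (Suc i))"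
  by (auto simp: first_hit_def less_Suc_eq_0_disj)

lemma disc_hit_Suc:
  "disc_hit r y (Suc N) X =
     (if X 0 = y then 1 else r 0 (X 0) * disc_hit (\<lambda>m. r (Suc m)) y N (\<lambda>i. X (Suc i)))"
proof -
  have "disc_hit r y (Suc N) X = of_bool (first_hit y 0 X) +
      (\<Sum>k\<le>N. of_bool (first_hit y (Suc k) X) * (\<Prod>m<Suc k. r m (X m)))"
    unfolding disc_hit_def by (subst sum.atMost_Suc_shift) simp
  also have "\<dots> = (if X 0 = y then 1 else r 0 (X 0) * disc_hit (\<lambda>m. r (Suc m)) y N (\<lambda>i. X (Suc i)))"
  proof (cases "X 0 = y")
    case False
    have "(\<Sum>k\<le>N. of_bool (first_hit y (Suc k) X) * (\<Prod>m<Suc k. r m (X m))) =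
        r 0 (X 0) * disc_hit (\<lambda>m. r (Suc m)) y N (\<lambda>i. X (Suc i))"
      unfolding disc_hit_def sum_distrib_left
      by (intro sum.cong refl) (simp add: first_hit_Suc False prod.lessThan_Suc_shift del: prod.lessThan_Suc)
    then show ?thesis using False by (simp add: first_hit_def)
  qed (simp add: first_hit_Suc, simp add: first_hit_def)
  finally show ?thesis .
qed

lemma disc_hit_0: "disc_hit r y 0 X = of_bool (X 0 = y)"
  by (simp add: disc_hit_def first_hit_def)

lemma disc_hit_bounds:
  assumes "\<And>m x. 0 \<le> r m x \<and> r m x \<le> 1"
  shows "0 \<le> disc_hit r y N X \<and> disc_hit r y N X \<le> 1"
  using assms
proof (induction N arbitrary: r X)
  case (Suc N)
  then show ?case
    using Suc.IH[of "\<lambda>m. r (Suc m)" "\<lambda>i. X (Suc i)", OF Suc.prems] by (auto simp: disc_hit_Suc intro!: mult_le_one)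
qed (simp add: disc_hit_0)

lemma disc_hit_eq:
  assumes "first_hit y k X" "k \<le> N"
  shows "disc_hit r y N X = (\<Prod>m<k. r m (X m))"
proof -
  have "disc_hit r y N X = (\<Sum>j\<le>N. if j = k then (\<Prod>m<k. r m (X m)) else 0)"
    unfolding disc_hit_def
  proof (intro sum.cong refl)
    fix j
    show "of_bool (first_hit y j X) * (\<Prod>m<j. r m (X m)) = (if j = k then (\<Prod>m<k. r m (X m)) else 0)"
      using first_hit_unique[OF assms(1), of j] assms(1) by (cases "j = k") auto
  qed
  then show ?thesis using assms(2) by simp
qed

lemma disc_hit_cong:
  assumes "\<And>i. i \<le> N \<Longrightarrow> X i = X' i"
  shows "disc_hit r y N X = disc_hit r y N X'"
  unfolding disc_hit_def first_hit_def using assms by (intro sum.cong arg_cong2[where f="(*)"] prod.cong) auto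

text \<open>The partial sums \<open>S n\<close> of the holding times are strictly increasing and
  \<open>Zproc\<close> equals \<open>X n\<close> on the interval from \<open>S n\<close> to
  \<open>S (Suc n)\<close>. The infimum over hitting times is thus attained at \<open>S k\<close>,
  for the first index \<open>k\<close> with \<open>X k = y\<close>.\<close>

lemma
  fixes X :: "nat \<Rightarrow> ('d::finite) site" and \<tau> :: "nat \<times> 'd site \<Rightarrow> real"
  assumes pos: "\<And>m. 0 < \<tau> (m, X m)"
  shows hitting_time_first_hit: "first_hit y k X \<Longrightarrow> hitting_time y X \<tau> = ennreal (\<Sum>m<k. \<tau> (m, X m))"
    and hitting_time_never: "(\<And>n. X n \<noteq> y) \<Longrightarrow> hitting_time y X \<tau> = \<infinity>"
proof -
  define S where "S n = (\<Sum>m<n. \<tau> (m, X m))" for n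
  have mono: "strict_mono S" by (rule strict_mono_Suc_iff[THEN iffD2]) (simp add: S_def pos)
  have S0: "0 \<le> S n" for n unfolding S_def using pos by (intro sum_nonneg) (auto intro: less_imp_le)
  have fin: "(\<Sum>m<n. ennreal (\<tau> (m, X m))) = ennreal (S n)" for n
    unfolding S_def using pos by (intro sum_ennreal) (auto intro: less_imp_le)
  have Z: "Zproc X \<tau> t = Some (X n)" if t: "S n \<le> t" "t < S (Suc n)" for n t
  proof -
    have "ennreal t < ennreal (S (Suc n))" using t S0[of n] by (intro ennreal_lessI) auto
    also have "\<dots> \<le> (\<Sum>m. ennreal (\<tau> (m, X m)))"
      unfolding fin[symmetric] by (rule sum_le_suminf) auto
    finally have 1: "\<not> (\<Sum>m. ennreal (\<tau> (m, X m))) \<le> ennreal t" by simp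
    have "(THE n. S n \<le> t \<and> t < S (Suc n)) = n"
    proof (rule the_equality)
      fix m assume m: "S m \<le> t \<and> t < S (Suc m)"
      then have "S m < S (Suc n)" "S n < S (Suc m)" using t by auto
      then show "m = n" using strict_mono_less[OF mono] by auto
    qed (use t in auto)
    then show ?thesis using 1 by (simp add: Zproc_def S_def)
  qed
  \<comment> \<open>Before the explosion time some partial sum exceeds \<open>t\<close>. The least
    index with this property is positive since \<open>S 0 = 0\<close>, and its predecessor is the
    index of the current state.\<close>
  have Z': "\<exists>n. S n \<le> t \<and> X n = x" if t: "0 \<le> t" "Zproc X \<tau> t = Some x" for t x
  proof -
    have "ennreal t < (\<Sum>m. ennreal (\<tau> (m, X m)))" using t by (auto simp: Zproc_def split: if_splits)
    also have "\<dots> = (SUP n. \<Sum>m<n. ennreal (\<tau> (m, X m)))" by (rule suminf_eq_SUP) 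
    finally obtain n where "ennreal t < ennreal (S n)" unfolding less_SUP_iff fin by auto
    then have n: "t < S n" using S0 t by (simp add: ennreal_less_iff)
    define k where "k = (LEAST n. t < S n)"
    have k: "t < S k" unfolding k_def using n by (rule LeastI)
    have "k \<noteq> 0"
    proof
      assume "k = 0"
      then show False using k t by (simp add: S_def)
    qed
    then obtain m where m: "k = Suc m" by (cases k) auto
    then have "S m \<le> t" using not_less_Least[of m "\<lambda>n. t < S n"] by (simp add: k_def)
    with k m Z[of m t] t show ?thesis by auto
  qed
  show "hitting_time y X \<tau> = \<infinity>" if "\<And>n. X n \<noteq> y"
  proof -
    have "{t. 0 \<le> t \<and> Zproc X \<tau> t = Some y} = {}" using Z' that by blast
    then show ?thesis unfolding hitting_time_def by simp
  qed
  assume k: "first_hit y k X"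
  show "hitting_time y X \<tau> = ennreal (\<Sum>m<k. \<tau> (m, X m))"
    unfolding hitting_time_def S_def[symmetric]
  proof (rule antisym)
    have "Zproc X \<tau> (S k) = Some y" using Z[of k "S k"] k mono by (simp add: first_hit_def strict_mono_Suc_iff)
    then show "(INF t\<in>{t. 0 \<le> t \<and> Zproc X \<tau> t = Some y}. ennreal t) \<le> ennreal (S k)"
      using S0 by (intro INF_lower) auto
    show "ennreal (S k) \<le> (INF t\<in>{t. 0 \<le> t \<and> Zproc X \<tau> t = Some y}. ennreal t)"
    proof (rule INF_greatest)
      fix t assume "t \<in> {t. 0 \<le> t \<and> Zproc X \<tau> t = Some y}"
      then obtain n where n: "S n \<le> t" "X n = y" using Z' by auto
      then have "k \<le> n" using k by (auto simp: first_hit_def not_less[symmetric])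
      then have "S k \<le> S n" using mono by (simp add: strict_mono_less_eq)
      with n show "ennreal (S k) \<le> ennreal t" by (intro ennreal_leI) simp
    qed
  qed
qed

text \<open>The sequence is constant from the first hitting index on, and identically
  \<open>0\<close> if \<open>y\<close> is never visited. This includes explosion before
  \<open>y\<close>, where the hitting time is infinite.\<close>

lemma exp_hitting_time_limit:
  fixes X :: "nat \<Rightarrow> ('d::finite) site" and \<tau> :: "nat \<times> 'd site \<Rightarrow> real"
  assumes pos: "\<And>m. 0 < \<tau> (m, X m)"
  shows "(\<lambda>N. disc_hit (\<lambda>m x. exp (- lam * \<tau> (m, x))) y N X) \<longlonglongrightarrow>
    exp (- lam * enn2real (hitting_time y X \<tau>)) * of_bool (hitting_time y X \<tau> < \<infinity>)"
proof (cases "\<exists>n. X n = y")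
  case True
  then obtain k where k: "first_hit y k X" using first_hit_Least by blast
  have "0 \<le> (\<Sum>m<k. \<tau> (m, X m))" using pos by (intro sum_nonneg) (auto intro: less_imp_le)
  then have "exp (- lam * enn2real (hitting_time y X \<tau>)) * of_bool (hitting_time y X \<tau> < \<infinity>) = (\<Prod>m<k. exp (- lam * \<tau> (m, X m)))"
    by (simp add: hitting_time_first_hit[of \<tau> X, OF pos k] sum_distrib_left sum_negf exp_sum flip: exp_minus)
       (simp add: exp_sum sum_distrib_left exp_minus flip: sum_negf prod_inversef)
  moreover have "\<forall>\<^sub>F N in sequentially. disc_hit (\<lambda>m x. exp (- lam * \<tau> (m, x))) y N X = (\<Prod>m<k. exp (- lam * \<tau> (m, X m)))"
    using eventually_ge_at_top[of k] by eventually_elim (rule disc_hit_eq[OF k])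
  ultimately show ?thesis by (simp add: tendsto_eventually)
next
  case False
  then show ?thesis
    using hitting_time_never[of \<tau> X y, OF pos]
    by (simp add: disc_hit_def first_hit_def)
qed

section \<open>Finite paths and the law of the quenched walk\<close>

definition walk_path :: "'d site \<Rightarrow> ('d::finite) site list \<Rightarrow> nat \<Rightarrow> 'd site" where
  "walk_path x es i = x + sum_list (take i es)"

primrec path_weight :: "(('d::finite) site \<Rightarrow> 'd site \<Rightarrow> real) \<Rightarrow> 'd site \<Rightarrow> 'd site list \<Rightarrow> real" where
  "path_weight p x [] = 1"
| "path_weight p x (e # es) = p x e * path_weight p (x + e) es"

definition step_lists :: "nat \<Rightarrow> ('d::finite) site list set" where
  "step_lists n = {es. set es \<subseteq> unit_steps \<and> length es = n}"

lemma step_lists_0: "step_lists 0 = {[]}"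
  by (auto simp: step_lists_def)

lemma finite_step_lists: "finite (step_lists n)"
  unfolding step_lists_def by (rule finite_lists_length_eq[OF finite_unit_steps])

lemma walk_path_Cons_Suc: "walk_path x (e # es) (Suc i) = walk_path (x + e) es i"
  and walk_path_0: "walk_path x es 0 = x"
  by (simp_all add: walk_path_def add.assoc)

lemma sum_step_lists_Suc:
  fixes f :: "('d::finite) site list \<Rightarrow> real"
  shows "(\<Sum>es\<in>step_lists (Suc n). f es) = (\<Sum>e\<in>unit_steps. \<Sum>es\<in>step_lists n. f (e # es))"
proof -
  have "step_lists (Suc n) = (\<lambda>(e, es). e # es) ` (unit_steps \<times> (step_lists n :: 'd site list set))"
    by (auto simp: step_lists_def length_Suc_conv image_iff)
  then have "(\<Sum>es\<in>step_lists (Suc n). f es) = (\<Sum>(e, es)\<in>unit_steps \<times> step_lists n. f (e # es))"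
    by (simp add: sum.reindex inj_on_def case_prod_unfold)
  then show ?thesis by (simp add: sum.cartesian_product)
qed

lemma sum_path_weight:
  assumes "\<And>x. (\<Sum>e\<in>unit_steps. p x e) = 1"
  shows "(\<Sum>es\<in>step_lists n. path_weight p x es) = 1"
proof (induction n arbitrary: x)
  case 0
  show ?case by (simp add: step_lists_0)
next
  case (Suc n)
  then show ?case using assms by (simp add: sum_step_lists_Suc flip: sum_distrib_left)
qed

text \<open>Decomposition by the first step turns the sum over paths into the recursion. At
  \<open>x = y\<close> the remaining path weights sum to \<open>1\<close>.\<close>

lemma sum_path_weight_disc_hit:
  assumes p: "\<And>x. (\<Sum>e\<in>unit_steps. p x e) = 1"
  shows "(\<Sum>es\<in>step_lists n. path_weight p x es * disc_hit (\<lambda>_. q) y n (walk_path x es)) = hit_gen p q y n x"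
proof (induction n arbitrary: x)
  case 0
  show ?case by (simp add: step_lists_0 disc_hit_0 walk_path_0)
next
  case (Suc n)
  show ?case
  proof (cases "x = y")
    case True
    have "disc_hit (\<lambda>_. q) y (Suc n) (walk_path x es) = 1" for es
      unfolding disc_hit_Suc walk_path_0 using True by simp
    then show ?thesis using sum_path_weight[OF p, where n="Suc n" and x=x] True by simp
  next
    case False
    have "disc_hit (\<lambda>_. q) y (Suc n) (walk_path x (e # es)) = q x * disc_hit (\<lambda>_. q) y n (walk_path (x + e) es)" for e es
      unfolding disc_hit_Suc walk_path_0 walk_path_Cons_Suc using False by simp
    then have "(\<Sum>es\<in>step_lists (Suc n). path_weight p x es * disc_hit (\<lambda>_. q) y (Suc n) (walk_path x es))
      = (\<Sum>e\<in>unit_steps. \<Sum>es\<in>step_lists n. q x * (p x e * (path_weight p (x + e) es * disc_hit (\<lambda>_. q) y n (walk_path (x + e) es))))"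
      by (simp add: sum_step_lists_Suc mult_ac)
    also have "\<dots> = q x * (\<Sum>e\<in>unit_steps. p x e * hit_gen p q y n (x + e))"
      by (simp only: Suc.IH flip: sum_distrib_left)
    finally show ?thesis using False by simp
  qed
qed

lemma walk_path_inj:
  assumes "length es = n" "length es' = n" "\<And>i. i \<le> n \<Longrightarrow> walk_path x es i = walk_path x es' i"
  shows "es = es'"
  using assms
proof (induction n arbitrary: x es es')
  case (Suc n)
  then obtain e f fs fs' where es: "es = e # fs" "es' = f # fs'" by (auto simp: length_Suc_conv)
  have "e = f" using Suc.prems(3)[of 1] by (simp add: es walk_path_def)
  moreover have "fs = fs'"
    using Suc.prems \<open>e = f\<close> by (intro Suc.IH[of fs fs' "x + e"]) (auto simp: es simp flip: walk_path_Cons_Suc)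
  ultimately show ?case by (simp add: es)
qed auto

lemma path_weight_prod:
  "(\<Prod>i<length es. jump_prob \<omega> (walk_path x es i) (walk_path x es (Suc i) - walk_path x es i)) = path_weight (jump_prob \<omega>) x es"
proof (induction es arbitrary: x)
  case (Cons e es)
  then show ?case
    by (simp add: prod.lessThan_Suc_shift walk_path_Cons_Suc walk_path_0 del: prod.lessThan_Suc)
qed simp

context
  fixes \<omega> :: "('d::finite) jump_env"
  assumes \<omega>: "\<And>y. \<omega> y \<in> space jump_laws"
begin

lemma jump_laws_prob: "prob_space (\<omega> y)" and jump_laws_sets: "sets (\<omega> y) = sets (count_space unit_steps)"
  using \<omega>[of y] by (auto simp: jump_laws_def space_prob_algebra)

lemma sum_jump_prob: "(\<Sum>e\<in>unit_steps. jump_prob \<omega> x e) = 1"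
proof -
  interpret prob_space "\<omega> x" by (rule jump_laws_prob)
  have "(\<Sum>e\<in>unit_steps. measure (\<omega> x) {e}) = measure (\<omega> x) unit_steps"
    using finite_unit_steps by (intro finite_measure_eq_sum_singleton[symmetric]) (auto simp: jump_laws_sets)
  also have "\<dots> = 1"
    using prob_space sets_eq_imp_space_eq[OF jump_laws_sets[of x]] by simp
  finally show ?thesis by (simp add: jump_prob_def)
qed

lemma sets_walk_law: "sets (walk_law \<omega> x) = sets (PiM UNIV (\<lambda>_. count_space UNIV))"
  and prob_space_walk_law: "prob_space (walk_law \<omega> x)"
proof -
  interpret IT: Ionescu_Tulcea "walk_kernel \<omega> x" "\<lambda>_. count_space UNIV"
    by (rule Ionescu_Tulcea_walk) fact
  show "sets (walk_law \<omega> x) = sets (PiM UNIV (\<lambda>_. count_space UNIV))"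
    unfolding walk_law_def by (rule IT.PF.sets_lim)
  interpret C: prob_space "IT.CI {}" by (rule IT.PF.prob_space_P) auto
  have "emeasure (walk_law \<omega> x) (IT.PF.emb UNIV {} (space (PiM {} (\<lambda>_. count_space UNIV)))) = emeasure (IT.CI {}) (space (PiM {} (\<lambda>_. count_space UNIV)))"
    unfolding walk_law_def by (rule IT.lim) auto
  also have "\<dots> = 1" using C.emeasure_space_1 by (simp add: IT.PF.space_P)
  also have "IT.PF.emb UNIV {} (space (PiM {} (\<lambda>_. count_space UNIV))) = space (walk_law \<omega> x)"
    unfolding walk_law_def by (auto simp: prod_emb_def space_PiM)
  finally show "prob_space (walk_law \<omega> x)" by (rule prob_spaceI)
qed

text \<open>The cylinders \<open>A es\<close> of the lattice paths with \<open>n\<close> steps are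
  disjoint and their probabilities add up to \<open>1\<close>. A function of the first
  \<open>n\<close> steps is therefore almost surely a finite linear combination of their
  indicators.\<close>

lemma integral_walk_law:
  fixes f :: "(nat \<Rightarrow> 'd site) \<Rightarrow> real"
  assumes f: "\<And>X X'. (\<And>i. i \<le> n \<Longrightarrow> X i = X' i) \<Longrightarrow> f X = f X'"
    and fm: "f \<in> borel_measurable (walk_law \<omega> x)"
  shows "(\<integral>X. f X \<partial>walk_law \<omega> x) = (\<Sum>es\<in>step_lists n. path_weight (jump_prob \<omega>) x es * f (walk_path x es))"
proof -
  interpret W: prob_space "walk_law \<omega> x" by (rule prob_space_walk_law)
  define A where "A es = {X. \<forall>i\<le>n. X i = walk_path x es i}" for es
  have A: "A es \<in> sets (walk_law \<omega> x)" for es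
  proof -
    have "A es = (\<Inter>i\<in>{..n}. (\<lambda>X. X i) -` {walk_path x es i} \<inter> space (PiM UNIV (\<lambda>_. count_space UNIV)))"
      by (auto simp: A_def space_PiM)
    also have "\<dots> \<in> sets (PiM UNIV (\<lambda>_. count_space UNIV))"
      by (intro sets.finite_INT measurable_sets[OF measurable_component_singleton]) auto
    finally show ?thesis by (simp add: sets_walk_law)
  qed
  have pw: "0 \<le> path_weight (jump_prob \<omega>) x es" for es x
    by (induction es arbitrary: x) (auto simp: jump_prob_def)
  have PA: "measure (walk_law \<omega> x) (A es) = path_weight (jump_prob \<omega>) x es" if "es \<in> step_lists n" for es
  proof -
    have "emeasure (walk_law \<omega> x) (A es) = ennreal (path_weight (jump_prob \<omega>) x es)"
      unfolding A_def using emeasure_walk_law[OF \<omega>, where x=x and n=n and p="walk_path x es"] that path_weight_prod[of \<omega> x es]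
      by (simp add: walk_path_0 step_lists_def)
    then show ?thesis using pw by (simp add: measure_def)
  qed
  have disj: "disjoint_family_on A (step_lists n)"
    unfolding disjoint_family_on_def
  proof (intro ballI impI)
    fix es es' :: "'d site list" assume "es \<in> step_lists n" "es' \<in> step_lists n" and ne: "es \<noteq> es'"
    then have "length es = n" "length es' = n" by (auto simp: step_lists_def)
    from walk_path_inj[OF this, of x] ne show "A es \<inter> A es' = {}" by (fastforce simp: A_def)
  qed
  have "measure (walk_law \<omega> x) (\<Union>es\<in>step_lists n. A es) = (\<Sum>es\<in>step_lists n. measure (walk_law \<omega> x) (A es))"
    using A disj finite_step_lists by (intro W.finite_measure_finite_Union) auto
  also have "\<dots> = 1" using sum_path_weight[OF sum_jump_prob] by (simp add: PA)
  finally have "AE X in walk_law \<omega> x. X \<in> (\<Union>es\<in>step_lists n. A es)"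
    using A finite_step_lists by (subst W.AE_in_set_eq_1) auto
  then have ae: "AE X in walk_law \<omega> x. f X = (\<Sum>es\<in>step_lists n. indicator (A es) X * f (walk_path x es))"
  proof eventually_elim
    case (elim X)
    then obtain es where es: "es \<in> step_lists n" "X \<in> A es" by auto
    have "(\<Sum>es'\<in>step_lists n. indicator (A es') X * f (walk_path x es')) = (\<Sum>es'\<in>step_lists n. if es' = es then f (walk_path x es) else 0)"
      using es disj by (intro sum.cong) (auto simp: disjoint_family_on_def indicator_def)
    moreover have "f X = f (walk_path x es)" using es by (intro f) (auto simp: A_def)
    ultimately show ?case using es by (simp add: finite_step_lists)
  qed
  have "(\<integral>X. f X \<partial>walk_law \<omega> x) = (\<integral>X. (\<Sum>es\<in>step_lists n. indicator (A es) X * f (walk_path x es)) \<partial>walk_law \<omega> x)"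
    using ae A fm by (intro integral_cong_AE) auto
  also have "\<dots> = (\<Sum>es\<in>step_lists n. (\<integral>X. indicator (A es) X * f (walk_path x es) \<partial>walk_law \<omega> x))"
    using A by (intro Bochner_Integration.integral_sum integrable_mult_left integrable_real_indicator) (auto simp: W.emeasure_eq_measure)
  also have "\<dots> = (\<Sum>es\<in>step_lists n. path_weight (jump_prob \<omega>) x es * f (walk_path x es))"
    using A PA by (intro sum.cong) (auto simp: sets.sets_into_space)
  finally show ?thesis .
qed


text \<open>Truncation at \<open>N\<close> jumps, Fubini's theorem with the holding times integrated
  first, the finite path sum for the walk, and dominated convergence in \<open>N\<close>.\<close>

lemma e_fun_limit:
  assumes \<sigma>: "\<And>y. \<sigma> y \<in> space holding_laws" and lam: "0 \<le> lam"
  shows "(\<lambda>n. hit_gen (jump_prob \<omega>) (\<lambda>z. \<integral>s. exp (- lam * s) \<partial>\<sigma> z) y n x) \<longlonglongrightarrow> e_fun lam x y \<omega> \<sigma>"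
proof -
  define \<phi> where "\<phi> z = (\<integral>s. exp (- lam * s) \<partial>\<sigma> z)" for z
  have ps: "prob_space (\<sigma> z)" and st: "sets (\<sigma> z) = sets (restrict_space borel {0<..})" for z
    using \<sigma>[of z] by (auto simp: holding_laws_def space_prob_algebra)
  have sp: "space (\<sigma> z) = {0<..}" for z
    using sets_eq_imp_space_eq[OF st] by (simp add: space_restrict_space)
  interpret \<sigma>: prob_space "\<sigma> z" for z by (rule ps)
  have em: "(\<lambda>s. exp (- lam * s)) \<in> borel_measurable (\<sigma> z)" for z
    unfolding measurable_cong_sets[OF st refl] by (intro measurable_restrict_space1) simp
  have ei: "integrable (\<sigma> z) (\<lambda>s. exp (- lam * s))" for z
    using lam by (intro \<sigma>.integrable_const_bound[where B=1] em) (auto simp: sp)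
  interpret P: product_prob_space "\<lambda>(n, z). \<sigma> z" "UNIV :: (nat \<times> 'd site) set"
  proof -
    interpret pair: prob_space "case i of (n, z) \<Rightarrow> \<sigma> z" for i :: "nat \<times> 'd site"
      by (cases i) (simp add: ps)
    show "product_prob_space (\<lambda>(n :: nat, z). \<sigma> z)" by unfold_locales
  qed
  define H where "H = holding_law \<sigma>"
  have H: "H = PiM UNIV (\<lambda>(n, z). \<sigma> z)" by (simp add: H_def holding_law_def)
  interpret H: prob_space H unfolding H by (rule P.prob_space_axioms)
  interpret W: prob_space "walk_law \<omega> x" by (rule prob_space_walk_law)
  interpret Q: pair_prob_space "walk_law \<omega> x" H by unfold_locales
  have Hpos: "0 < \<tau> i" if "\<tau> \<in> space H" for \<tau> i
  proof -
    have "\<tau> i \<in> space (case i of (n, z) \<Rightarrow> \<sigma> z)"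
      using that unfolding H space_PiM by (rule PiE_mem) simp
    then show ?thesis by (cases i) (simp add: sp)
  qed
  have comp: "(\<lambda>\<tau>. exp (- lam * \<tau> (m, z))) \<in> borel_measurable H" for m z
  proof -
    have "(\<lambda>\<tau>. \<tau> (m, z)) \<in> H \<rightarrow>\<^sub>M (case (m, z) of (n, z) \<Rightarrow> \<sigma> z)"
      unfolding H by (rule measurable_component_singleton) simp
    then have "(\<lambda>\<tau>. \<tau> (m, z)) \<in> H \<rightarrow>\<^sub>M \<sigma> z" by (simp only: prod.case)
    then show ?thesis using em by (rule measurable_compose)
  qed
  have Xm: "(\<lambda>X. X i) \<in> walk_law \<omega> x \<rightarrow>\<^sub>M count_space UNIV" for i
    unfolding measurable_cong_sets[OF sets_walk_law refl] by (rule measurable_component_singleton) simp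
  have fh: "Measurable.pred (walk_law \<omega> x) (\<lambda>X. first_hit y k X)" for k
  proof -
    have "Measurable.pred (walk_law \<omega> x) (\<lambda>X. X i = y)" for i
      by (rule measurable_compose[OF Xm]) simp
    then show ?thesis
      unfolding first_hit_def by (intro pred_intros_logic pred_intros_countable measurable_const) auto
  qed
  have qm: "(\<lambda>X. q m (X m) :: real) \<in> borel_measurable (walk_law \<omega> x)" for q m
    by (rule measurable_compose[OF Xm]) simp
  have dm1: "disc_hit q y N \<in> borel_measurable (walk_law \<omega> x)" for N q
    unfolding disc_hit_def[abs_def] using fh qm by measurable
  define D where "D N X \<tau> = disc_hit (\<lambda>m z. exp (- lam * \<tau> (m, z))) y N X" for N X \<tau>
  have dm: "(\<lambda>(X, \<tau>). D N X \<tau>) \<in> borel_measurable (walk_law \<omega> x \<Otimes>\<^sub>M H)" for N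
  proof -
    \<comment> \<open>The holding time is read at a random site. There are countably many sites, so
      measurability follows from that at each fixed site.\<close>
    have 1: "(\<lambda>\<xi>. exp (- lam * snd \<xi> (m, fst \<xi> m))) \<in> borel_measurable (walk_law \<omega> x \<Otimes>\<^sub>M H)" for m
      by (rule measurable_compose_countable[where f="\<lambda>z \<xi>. exp (- lam * snd \<xi> (m, z))" and g="\<lambda>\<xi>. fst \<xi> m"],
          rule measurable_compose[OF measurable_snd comp], rule measurable_compose[OF measurable_fst Xm])
    have 2: "Measurable.pred (walk_law \<omega> x \<Otimes>\<^sub>M H) (\<lambda>\<xi>. first_hit y k (fst \<xi>))" for k
      by (rule measurable_compose[OF measurable_fst fh])
    show ?thesis
      unfolding D_def disc_hit_def case_prod_unfold using 1 2 by measurable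
  qed
  have D01: "0 \<le> D N X \<tau> \<and> D N X \<tau> \<le> 1" if "\<tau> \<in> space H" for N X \<tau>
    unfolding D_def using Hpos[OF that] lam by (intro disc_hit_bounds) (simp add: less_imp_le)
  have inner: "(\<integral>\<tau>. D N X \<tau> \<partial>H) = disc_hit (\<lambda>_. \<phi>) y N X" for N X
  proof -
    have pr: "integrable H (\<lambda>\<tau>. \<Prod>m<k. exp (- lam * \<tau> (m, X m)))"
      "(\<integral>\<tau>. (\<Prod>m<k. exp (- lam * \<tau> (m, X m))) \<partial>H) = (\<Prod>m<k. \<phi> (X m))" for k
    proof -
      define J where "J = (\<lambda>m. (m, X m)) ` {..<k}"
      \<comment> \<open>The step number is part of the index, so the holding times along a path are
        distinct coordinates even when the path revisits a site. Hence they are independent.\<close>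
      have inj: "inj_on (\<lambda>m. (m, X m)) {..<k}" by (auto simp: inj_on_def)
      have J: "finite J" by (simp add: J_def)
      have eq: "(\<Prod>m<k. exp (- lam * \<tau> (m, X m))) = (\<Prod>i\<in>J. exp (- lam * \<tau> i))" for \<tau>
        unfolding J_def by (subst prod.reindex[OF inj]) simp
      have ps': "prob_space (case i of (n, z) \<Rightarrow> \<sigma> z)" for i :: "nat \<times> 'd site" using ps by (cases i) simp
      have ei': "integrable (case i of (n, z) \<Rightarrow> \<sigma> z) (\<lambda>s. exp (- lam * s))" for i :: "nat \<times> 'd site"
        using ei by (cases i) simp
      show "integrable H (\<lambda>\<tau>. \<Prod>m<k. exp (- lam * \<tau> (m, X m)))"
        unfolding eq H by (rule integrable_PiM_prod[OF ps' J ei'])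
      have "(\<integral>\<tau>. (\<Prod>m<k. exp (- lam * \<tau> (m, X m))) \<partial>H) = (\<Prod>i\<in>J. \<integral>s. exp (- lam * s) \<partial>(case i of (n, z) \<Rightarrow> \<sigma> z))"
        unfolding eq H by (rule integral_PiM_prod[OF ps' J ei'])
      also have "\<dots> = (\<Prod>m<k. \<phi> (X m))"
        unfolding J_def by (subst prod.reindex[OF inj]) (simp add: \<phi>_def)
      finally show "(\<integral>\<tau>. (\<Prod>m<k. exp (- lam * \<tau> (m, X m))) \<partial>H) = (\<Prod>m<k. \<phi> (X m))" .
    qed
    have "(\<integral>\<tau>. D N X \<tau> \<partial>H) = (\<Sum>k\<le>N. \<integral>\<tau>. of_bool (first_hit y k X) * (\<Prod>m<k. exp (- lam * \<tau> (m, X m))) \<partial>H)"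
      unfolding D_def disc_hit_def by (intro Bochner_Integration.integral_sum integrable_mult_right pr)
    then show ?thesis unfolding disc_hit_def by (simp only: pr integral_mult_right_zero)
  qed
  have int: "(\<integral>\<xi>. (case \<xi> of (X, \<tau>) \<Rightarrow> D N X \<tau>) \<partial>(walk_law \<omega> x \<Otimes>\<^sub>M H)) = hit_gen (jump_prob \<omega>) \<phi> y N x" for N
  proof -
    have "integrable (walk_law \<omega> x \<Otimes>\<^sub>M H) (\<lambda>(X, \<tau>). D N X \<tau>)"
      using D01 by (intro Q.integrable_const_bound[where B=1] dm AE_I2) (auto simp: space_pair_measure)
    then have "(\<integral>\<xi>. (case \<xi> of (X, \<tau>) \<Rightarrow> D N X \<tau>) \<partial>(walk_law \<omega> x \<Otimes>\<^sub>M H)) = (\<integral>X. (\<integral>\<tau>. D N X \<tau> \<partial>H) \<partial>walk_law \<omega> x)"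
      by (rule Q.integral_fst[symmetric])
    also have "\<dots> = (\<Sum>es\<in>step_lists N. path_weight (jump_prob \<omega>) x es * disc_hit (\<lambda>_. \<phi>) y N (walk_path x es))"
      unfolding inner by (rule integral_walk_law) (auto intro!: disc_hit_cong dm1)
    also have "\<dots> = hit_gen (jump_prob \<omega>) \<phi> y N x" by (rule sum_path_weight_disc_hit[OF sum_jump_prob])
    finally show ?thesis .
  qed
  have "(\<lambda>N. \<integral>\<xi>. (case \<xi> of (X, \<tau>) \<Rightarrow> D N X \<tau>) \<partial>(walk_law \<omega> x \<Otimes>\<^sub>M H)) \<longlonglongrightarrow> e_fun lam x y \<omega> \<sigma>"
    unfolding e_fun_def quenched_law_def H_def[symmetric]
  proof (rule integral_dominated_convergence[where w="\<lambda>_. 1"])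
    have lim: "(\<lambda>N. case \<xi> of (X, \<tau>) \<Rightarrow> D N X \<tau>) \<longlonglongrightarrow> (case \<xi> of (X, \<tau>) \<Rightarrow> exp (- lam * enn2real (hitting_time y X \<tau>)) * of_bool (hitting_time y X \<tau> < \<infinity>))"
      if "\<xi> \<in> space (walk_law \<omega> x \<Otimes>\<^sub>M H)" for \<xi>
    proof -
      note h = that
      obtain X \<tau> where \<xi>: "\<xi> = (X, \<tau>)" "\<tau> \<in> space H" using h by (auto simp: space_pair_measure)
      show ?thesis
        unfolding \<xi>(1) prod.case D_def by (rule exp_hitting_time_limit) (rule Hpos[OF \<xi>(2)])
    qed
    \<comment> \<open>The integrand is measurable as the pointwise limit of the truncations, which
      avoids any discussion of the measurability of \<open>hitting_time\<close>.\<close>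
    then show "(\<lambda>(X, \<tau>). exp (- lam * enn2real (hitting_time y X \<tau>)) * of_bool (hitting_time y X \<tau> < \<infinity>)) \<in> borel_measurable (walk_law \<omega> x \<Otimes>\<^sub>M H)"
      by (rule borel_measurable_LIMSEQ_metric[OF dm])
    show "AE \<xi> in walk_law \<omega> x \<Otimes>\<^sub>M H. (\<lambda>N. case \<xi> of (X, \<tau>) \<Rightarrow> D N X \<tau>) \<longlonglongrightarrow> (case \<xi> of (X, \<tau>) \<Rightarrow> exp (- lam * enn2real (hitting_time y X \<tau>)) * of_bool (hitting_time y X \<tau> < \<infinity>))"
      by (rule AE_I2) (rule lim)
    show "AE \<xi> in walk_law \<omega> x \<Otimes>\<^sub>M H. norm (case \<xi> of (X, \<tau>) \<Rightarrow> D N X \<tau>) \<le> 1" for N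
      using D01 by (intro AE_I2) (auto simp: space_pair_measure)
  qed (auto intro: dm)
  then show ?thesis unfolding int \<phi>_def .
qed

end

section \<open>Jensen's inequality for powers\<close>

lemma powr_tangent:
  fixes u r :: real
  assumes "0 \<le> u" "1 \<le> r"
  shows "1 + r * (u - 1) \<le> u powr r"
proof (cases "u = 0")
  case False
  have "(\<lambda>x. x powr r) u - (\<lambda>x. x powr r) 1 \<ge> r * (u - 1)"
  proof (rule convex_on_imp_above_tangent)
    show "convex_on {0<..} (\<lambda>x. x powr r)" by (rule powr_convex) (rule assms)
    show "((\<lambda>x. x powr r) has_real_derivative r) (at 1 within {0<..})"
      by (auto intro!: derivative_eq_intros)
  qed (use assms False in \<open>auto simp: interior_open\<close>)
  then show ?thesis by simp
qed (use assms in simp)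

lemma powr_tangent_at:
  fixes s t r :: real
  assumes "0 \<le> t" "0 < s" "1 \<le> r"
  shows "s powr r + r * s powr (r - 1) * (t - s) \<le> t powr r"
proof -
  have "s powr r * (1 + r * (t / s - 1)) \<le> s powr r * (t / s) powr r"
    using assms by (intro mult_left_mono powr_tangent) auto
  also have "\<dots> = t powr r" using assms by (simp add: powr_divide)
  also have "s powr r * (1 + r * (t / s - 1)) = s powr r + r * (s powr r / s) * (t - s)"
    using assms by (simp add: field_simps)
  also have "s powr r / s = s powr (r - 1)" using assms by (simp add: powr_diff)
  finally show ?thesis .
qed

text \<open>The tangent to the power function at the mean \<open>s\<close>, summed against the
  weights: its linear part cancels. The next lemma is the same computation with an
  expectation.\<close>

lemma powr_weighted_sum_le:
  fixes p t :: "'a \<Rightarrow> real"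
  assumes "finite S" "(\<Sum>i\<in>S. p i) = 1" "\<And>i. i \<in> S \<Longrightarrow> 0 \<le> p i" "\<And>i. i \<in> S \<Longrightarrow> 0 \<le> t i" "1 \<le> r"
  shows "(\<Sum>i\<in>S. p i * t i) powr r \<le> (\<Sum>i\<in>S. p i * t i powr r)"
proof (cases "(\<Sum>i\<in>S. p i * t i) = 0")
  case True
  then show ?thesis using assms by (auto intro!: sum_nonneg)
next
  case False
  define s where "s = (\<Sum>i\<in>S. p i * t i)"
  have s: "0 < s" using False assms unfolding s_def by (auto intro!: sum_nonneg simp: less_le)
  have eq: "(\<Sum>i\<in>S. p i * (s powr r + r * s powr (r - 1) * (t i - s))) = s powr r"
  proof -
    have "(\<Sum>i\<in>S. p i * (s powr r + r * s powr (r - 1) * (t i - s)))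
      = (\<Sum>i\<in>S. p i * (s powr r - r * s powr (r - 1) * s) + r * s powr (r - 1) * (p i * t i))"
      by (intro sum.cong) (auto simp: algebra_simps)
    also have "\<dots> = (\<Sum>i\<in>S. p i) * (s powr r - r * s powr (r - 1) * s) + r * s powr (r - 1) * s"
      by (simp add: sum.distrib s_def flip: sum_distrib_left sum_distrib_right)
    finally show ?thesis using assms by simp
  qed
  have "(\<Sum>i\<in>S. p i * (s powr r + r * s powr (r - 1) * (t i - s))) \<le> (\<Sum>i\<in>S. p i * t i powr r)"
    using assms s by (intro sum_mono mult_left_mono powr_tangent_at)
  then show ?thesis unfolding eq by (simp only: s_def)
qed

lemma (in prob_space) powr_expectation_le:
  fixes X :: "'a \<Rightarrow> real"
  assumes "integrable M X" "integrable M (\<lambda>x. X x powr r)" "\<And>x. x \<in> space M \<Longrightarrow> 0 < X x" "1 \<le> r"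
  shows "(\<integral>x. X x \<partial>M) powr r \<le> (\<integral>x. X x powr r \<partial>M)"
proof (cases "(\<integral>x. X x \<partial>M) = 0")
  case True
  then show ?thesis by (auto intro!: Bochner_Integration.integral_nonneg)
next
  case False
  define s where "s = (\<integral>x. X x \<partial>M)"
  have s: "0 < s" using False assms(3) unfolding s_def
    by (metis Bochner_Integration.integral_nonneg less_eq_real_def)
  have "s powr r = (\<integral>x. s powr r + r * s powr (r - 1) * (X x - s) \<partial>M)"
    using assms by (simp add: s_def prob_space)
  also have "\<dots> \<le> (\<integral>x. X x powr r \<partial>M)"
    using assms s by (intro integral_mono powr_tangent_at) (auto intro: less_imp_le)
  finally show ?thesis by (simp add: s_def)
qed

section \<open>The recursion for jump laws \<open>p x\<close> and discounts \<open>q x\<close> in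
  the unit interval\<close>

locale step_kernel =
  fixes p :: "('d::finite) site \<Rightarrow> 'd site \<Rightarrow> real" and q :: "'d site \<Rightarrow> real"
  assumes p_nonneg: "\<And>x e. 0 \<le> p x e" and p_sum: "\<And>x. (\<Sum>e\<in>unit_steps. p x e) = 1"
    and q_nonneg: "\<And>x. 0 \<le> q x" and q_le: "\<And>x. q x \<le> 1"
begin

lemma hit_gen_nonneg: "0 \<le> hit_gen p q y n x"
  by (induction n arbitrary: x) (auto intro!: mult_nonneg_nonneg sum_nonneg p_nonneg q_nonneg)

lemma hit_gen_le_1: "hit_gen p q y n x \<le> 1"
proof (induction n arbitrary: x)
  case (Suc n)
  have "(\<Sum>e\<in>unit_steps. p x e * hit_gen p q y n (x + e)) \<le> (\<Sum>e\<in>unit_steps. p x e * 1)"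
    by (intro sum_mono mult_left_mono Suc p_nonneg)
  then show ?case
    using mult_le_one[of "q x" "\<Sum>e\<in>unit_steps. p x e * hit_gen p q y n (x + e)"]
    by (auto simp: p_sum q_le intro!: sum_nonneg mult_nonneg_nonneg p_nonneg hit_gen_nonneg)
qed simp

lemma hit_gen_Suc_ge: "hit_gen p q y n x \<le> hit_gen p q y (Suc n) x"
proof (induction n arbitrary: x)
  case 0
  show ?case by (auto intro!: mult_nonneg_nonneg sum_nonneg p_nonneg q_nonneg)
next
  case (Suc n)
  show ?case
    by (subst (1 2) hit_gen.simps(2)) (auto intro!: mult_left_mono sum_mono Suc p_nonneg q_nonneg simp del: hit_gen.simps)
qed

text \<open>Reaching \<open>z\<close> by way of \<open>y\<close> is one way of reaching
  \<open>z\<close>. In the induction on the first step, arrival at \<open>z\<close> before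
  \<open>y\<close> only helps because all values are at most \<open>1\<close>, and a start at
  \<open>y\<close> uses monotonicity in the number of steps.\<close>

lemma hit_gen_supermult: "hit_gen p q y n x * hit_gen p q z m y \<le> hit_gen p q z (n + m) x"
proof (induction n arbitrary: x)
  case 0
  then show ?case using hit_gen_nonneg by simp
next
  case (Suc n)
  consider "x = z" | "x \<noteq> z" "x = y" | "x \<noteq> z" "x \<noteq> y" by blast
  then show ?case
  proof cases
    case 1
    then have "hit_gen p q z (Suc n + m) x = 1" by simp
    then show ?thesis
      using mult_le_one[OF hit_gen_le_1[of y "Suc n" x] hit_gen_nonneg[of z m y] hit_gen_le_1[of z m y]]
      by (simp del: hit_gen.simps)
  next
    case 2
    have "hit_gen p q z m x \<le> hit_gen p q z (m + k) x" for k
      by (induction k) (auto intro: order_trans[OF _ hit_gen_Suc_ge] simp del: hit_gen.simps)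
    from this[of "Suc n"] 2 show ?thesis by (simp add: add.commute del: hit_gen.simps(2)) (simp add: add.commute)
  next
    case 3
    have "hit_gen p q y (Suc n) x * hit_gen p q z m y = q x * (\<Sum>e\<in>unit_steps. p x e * (hit_gen p q y n (x + e) * hit_gen p q z m y))"
      using 3 by (simp add: sum_distrib_left sum_distrib_right mult_ac)
    also have "\<dots> \<le> q x * (\<Sum>e\<in>unit_steps. p x e * hit_gen p q z (n + m) (x + e))"
      by (intro mult_left_mono sum_mono Suc p_nonneg q_nonneg)
    also have "\<dots> = hit_gen p q z (Suc n + m) x" using 3 by simp
    finally show ?thesis .
  qed
qed

text \<open>Jensen's inequality for the jump law at every step of the recursion; the discount is
  handled by the assumption. For Laplace transforms \<open>q'\<close> will be the transform at
  \<open>r * lam\<close>, and \<open>r = 1\<close> gives monotonicity in the discount.\<close>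

lemma hit_gen_powr:
  assumes q': "\<And>x. q x powr r \<le> q' x" and r: "1 \<le> r"
  shows "hit_gen p q y n x powr r \<le> hit_gen p q' y n x"
proof (induction n arbitrary: x)
  case 0
  show ?case by simp
next
  case (Suc n)
  show ?case
  proof (cases "x = y")
    case False
    have "hit_gen p q y (Suc n) x powr r = q x powr r * (\<Sum>e\<in>unit_steps. p x e * hit_gen p q y n (x + e)) powr r"
      using False by (simp add: powr_mult q_nonneg sum_nonneg p_nonneg hit_gen_nonneg)
    also have "\<dots> \<le> q x powr r * (\<Sum>e\<in>unit_steps. p x e * hit_gen p q y n (x + e) powr r)"
      by (intro mult_left_mono powr_weighted_sum_le finite_unit_steps p_sum p_nonneg hit_gen_nonneg r) auto
    also have "\<dots> \<le> q' x * (\<Sum>e\<in>unit_steps. p x e * hit_gen p q' y n (x + e))"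
      by (intro mult_mono q' sum_mono mult_left_mono Suc p_nonneg sum_nonneg mult_nonneg_nonneg order_trans[OF _ q']) auto
    also have "\<dots> = hit_gen p q' y (Suc n) x" using False by simp
    finally show ?thesis .
  qed simp
qed

lemma hit_gen_mono:
  assumes q': "\<And>x. q x \<le> q' x"
  shows "hit_gen p q y n x \<le> hit_gen p q' y n x"
proof -
  have "hit_gen p q y n x powr 1 \<le> hit_gen p q' y n x"
    by (rule hit_gen_powr) (auto simp: q' q_nonneg)
  then show ?thesis by (simp add: hit_gen_nonneg)
qed

end

lemma hit_gen_translate:
  "hit_gen p q (y + z) n (x + z) = hit_gen (\<lambda>u. p (u + z)) (\<lambda>u. q (u + z)) y n x"
proof (induction n arbitrary: x)
  case (Suc n)
  have "hit_gen p q (y + z) n (x + z + e) = hit_gen (\<lambda>u. p (u + z)) (\<lambda>u. q (u + z)) y n (x + e)" for e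
    using Suc[of "x + e"] by (simp add: ac_simps)
  then show ?case by simp
qed simp

section \<open>Laplace transforms of holding laws\<close>

definition laplace :: "real \<Rightarrow> real measure \<Rightarrow> real" where
  "laplace lam \<rho> = (\<integral>s. exp (- lam * s) \<partial>\<rho>)"

context
  fixes \<rho> :: "real measure" and lam :: real
  assumes \<rho>: "\<rho> \<in> space holding_laws" and lam: "0 \<le> lam"
begin

lemma holding_prob: "prob_space \<rho>" and holding_sets: "sets \<rho> = sets (restrict_space borel {0<..})"
  using \<rho> by (auto simp: holding_laws_def space_prob_algebra)

lemma holding_space: "space \<rho> = {0<..}"
  using sets_eq_imp_space_eq[OF holding_sets] by (simp add: space_restrict_space)

lemma holding_borel:
  fixes f :: "real \<Rightarrow> 'a::topological_space"
  assumes "f \<in> borel_measurable borel"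
  shows "f \<in> borel_measurable \<rho>"
  unfolding measurable_cong_sets[OF holding_sets refl] by (intro measurable_restrict_space1 assms)

lemma integrable_exp_holding: "integrable \<rho> (\<lambda>s. exp (- lam * s))"
  using lam by (intro finite_measure.integrable_const_bound[where B=1] prob_space.finite_measure holding_prob holding_borel AE_I2)
    (auto simp: holding_space)

lemma laplace_bounds: "0 \<le> laplace lam \<rho>" "laplace lam \<rho> \<le> 1"
proof -
  interpret prob_space \<rho> by (rule holding_prob)
  show "0 \<le> laplace lam \<rho>" unfolding laplace_def by (intro Bochner_Integration.integral_nonneg) auto
  have "laplace lam \<rho> \<le> (\<integral>s. 1 \<partial>\<rho>)"
    unfolding laplace_def using lam by (intro integral_mono integrable_exp_holding) (auto simp: holding_space)
  then show "laplace lam \<rho> \<le> 1" by (simp add: prob_space)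
qed

text \<open>Jensen's inequality for the exponential, written with the tangent at the mean:
  \<open>exp (- lam * s) \<ge> exp (- lam * m) * (1 - lam * (s - m))\<close>.\<close>

lemma laplace_lower:
  assumes fin: "(\<integral>\<^sup>+ s. ennreal s \<partial>\<rho>) < \<infinity>"
  shows "exp (- lam * enn2real (\<integral>\<^sup>+ s. ennreal s \<partial>\<rho>)) \<le> laplace lam \<rho>"
proof -
  interpret prob_space \<rho> by (rule holding_prob)
  have "(\<integral>\<^sup>+ s. ennreal (norm s) \<partial>\<rho>) = (\<integral>\<^sup>+ s. ennreal s \<partial>\<rho>)"
    by (intro nn_integral_cong) (simp add: holding_space)
  then have i: "integrable \<rho> (\<lambda>s. s)"
    using fin by (intro integrableI_bounded holding_borel) (auto simp: holding_space cong: nn_integral_cong)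
  define m where "m = (\<integral>s. s \<partial>\<rho>)"
  have m: "enn2real (\<integral>\<^sup>+ s. ennreal s \<partial>\<rho>) = m"
    unfolding m_def by (rule integral_eq_nn_integral[symmetric]) (auto intro!: holding_borel AE_I2 simp: holding_space)
  have "exp (- lam * m) = (\<integral>s. exp (- lam * m) * (1 + (- lam * s + lam * m)) \<partial>\<rho>)"
    using i by (simp add: m_def prob_space)
  also have "\<dots> \<le> laplace lam \<rho>"
    unfolding laplace_def
  proof (rule integral_mono)
    fix s
    have "exp (- lam * m) * (1 + (- lam * s + lam * m)) \<le> exp (- lam * m) * exp (- lam * s + lam * m)"
      by (intro mult_left_mono exp_ge_add_one_self) auto
    also have "\<dots> = exp (- lam * s)" by (simp flip: exp_add)
    finally show "exp (- lam * m) * (1 + (- lam * s + lam * m)) \<le> exp (- lam * s)" .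
  qed (use i integrable_exp_holding in auto)
  finally show ?thesis by (simp add: m)
qed

text \<open>Jensen's inequality once more, for the power \<open>r\<close> of
  \<open>exp (- lam * s)\<close>. Together with \<open>hit_gen_powr\<close> it yields the scaling of
  \<open>a_fun\<close> in \<lambda>.\<close>

lemma laplace_powr:
  assumes "1 \<le> r"
  shows "laplace lam \<rho> powr r \<le> laplace (r * lam) \<rho>"
proof -
  interpret prob_space \<rho> by (rule holding_prob)
  have e: "exp (- lam * s) powr r = exp (- (r * lam) * s)" for s by (simp add: powr_def mult_ac)
  have "integrable \<rho> (\<lambda>s. exp (- (r * lam) * s))"
    using lam assms by (intro integrable_const_bound[where B=1] holding_borel AE_I2) (auto simp: holding_space)
  then show ?thesis
    unfolding laplace_def using powr_expectation_le[OF integrable_exp_holding, of r] assms by (simp only: e) auto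
qed

lemma laplace_antimono:
  assumes "lam \<le> lam'"
  shows "laplace lam' \<rho> \<le> laplace lam \<rho>"
proof -
  interpret prob_space \<rho> by (rule holding_prob)
  have "integrable \<rho> (\<lambda>s. exp (- lam' * s))"
    using lam assms by (intro integrable_const_bound[where B=1] holding_borel AE_I2) (auto simp: holding_space)
  then show ?thesis
    unfolding laplace_def using assms
    by (intro integral_mono integrable_exp_holding) (auto simp: holding_space mult_right_mono)
qed

end

lemma laplace_measurable:
  shows "laplace lam \<in> borel_measurable holding_laws"
proof -
  have "(\<lambda>\<rho>. \<integral>s. exp (- lam * s) \<partial>\<rho>) \<in> borel_measurable (subprob_algebra (restrict_space borel {0<..}))"
    by (intro integral_measurable_subprob_algebra measurable_restrict_space1) simp
  from measurable_compose[OF measurable_prob_algebraD[OF measurable_ident_sets[OF refl]] this]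
  show ?thesis unfolding laplace_def[abs_def] holding_laws_def .
qed

section \<open>The travel cost on good environments\<close>

text \<open>Here every jump probability is positive and every mean holding time finite, so that
  \<open>e_fun\<close> is positive and no logarithm of \<open>0\<close> occurs. The set is invariant
  under shifts.\<close>

definition good :: "(('d::finite) jump_env \<times> 'd holding_env) set" where
  "good = {(\<omega>, \<sigma>). (\<forall>x. \<omega> x \<in> space jump_laws \<and> 0 < min_jump (site_shift x \<omega>)) \<and>
     (\<forall>x. \<sigma> x \<in> space holding_laws \<and> mean_holding (site_shift x \<sigma>) < \<infinity>)}"

text \<open>An upper bound for the cost of going from \<open>x\<close> to any prescribed neighbour.
  The absolute value equals \<open>- ln\<close> because a minimal jump probability is at most
  \<open>1\<close>.\<close>

definition site_cost :: "real \<Rightarrow> ('d::finite) jump_env \<Rightarrow> 'd holding_env \<Rightarrow> 'd site \<Rightarrow> real" where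
  "site_cost lam \<omega> \<sigma> x =
     \<bar>ln (min_jump (site_shift x \<omega>))\<bar> + lam * enn2real (mean_holding (site_shift x \<sigma>))"

lemma good_shift: "(\<omega>, \<sigma>) \<in> good \<Longrightarrow> (site_shift z \<omega>, site_shift z \<sigma>) \<in> good"
  unfolding good_def by (simp add: shift_shift) (simp add: site_shift_def)

lemma axis_unit_step: "axis i 1 \<in> unit_steps" "- axis i 1 \<in> unit_steps" for i :: "'d::finite"
proof -
  have "(\<Sum>j\<in>UNIV. \<bar>(axis i 1 :: real ^ 'd) $ j\<bar>) = (\<Sum>j\<in>UNIV. if j = i then 1 else 0)"
    by (intro sum.cong) (auto simp: axis_def)
  moreover have "of_site (axis i 1) = axis i 1" "of_site (- axis i 1) = - axis i 1"
    by (auto simp: of_site_def axis_def vec_eq_iff)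
  ultimately show "axis i 1 \<in> unit_steps" "- axis i 1 \<in> unit_steps"
    by (simp_all add: unit_steps_def l1norm_def)
qed

lemma unit_step_nonzero: "e \<in> unit_steps \<Longrightarrow> e \<noteq> 0"
  by (auto simp: unit_steps_def l1norm_def of_site_def)

lemma min_jump_le: "e \<in> unit_steps \<Longrightarrow> min_jump (site_shift x \<omega>) \<le> jump_prob \<omega> x e"
  unfolding min_jump_def by (rule Min_le) (auto simp: finite_unit_steps jump_prob_def site_shift_def)

context
  fixes \<omega> :: "('d::finite) jump_env" and \<sigma> :: "'d holding_env"
  assumes good: "(\<omega>, \<sigma>) \<in> good"
begin

lemma good_jump: "\<omega> x \<in> space jump_laws" and good_holding: "\<sigma> x \<in> space holding_laws"
  and good_min_jump: "0 < min_jump (site_shift x \<omega>)" and good_mean: "mean_holding (site_shift x \<sigma>) < \<infinity>"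
  using good by (auto simp: good_def)

abbreviation hit :: "real \<Rightarrow> 'd site \<Rightarrow> nat \<Rightarrow> 'd site \<Rightarrow> real" where
  "hit lam y n x \<equiv> hit_gen (jump_prob \<omega>) (\<lambda>z. laplace lam (\<sigma> z)) y n x"

lemma hit_limit: "0 \<le> lam \<Longrightarrow> (\<lambda>n. hit lam y n x) \<longlonglongrightarrow> e_fun lam x y \<omega> \<sigma>"
  unfolding laplace_def by (rule e_fun_limit[OF good_jump good_holding])

lemma step_kernel: "0 \<le> lam \<Longrightarrow> step_kernel (jump_prob \<omega>) (\<lambda>z. laplace lam (\<sigma> z))"
  by unfold_locales (auto simp: sum_jump_prob[OF good_jump] laplace_bounds[OF good_holding], simp add: jump_prob_def)

lemma e_fun_bounds:
  assumes "0 \<le> lam"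
  shows "0 \<le> e_fun lam x y \<omega> \<sigma>" "e_fun lam x y \<omega> \<sigma> \<le> 1"
proof -
  interpret step_kernel "jump_prob \<omega>" "\<lambda>z. laplace lam (\<sigma> z)" by (rule step_kernel) fact
  show "0 \<le> e_fun lam x y \<omega> \<sigma>"
    by (rule LIMSEQ_le_const[OF hit_limit[OF assms]]) (auto simp: hit_gen_nonneg)
  show "e_fun lam x y \<omega> \<sigma> \<le> 1"
    by (rule LIMSEQ_le_const2[OF hit_limit[OF assms]]) (auto simp: hit_gen_le_1)
qed

lemma hit_le_e_fun:
  assumes "0 \<le> lam"
  shows "hit lam y n x \<le> e_fun lam x y \<omega> \<sigma>"
proof -
  interpret step_kernel "jump_prob \<omega>" "\<lambda>z. laplace lam (\<sigma> z)" by (rule step_kernel) fact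
  have "incseq (\<lambda>n. hit lam y n x)" by (rule incseq_SucI) (rule hit_gen_Suc_ge)
  then show ?thesis by (rule incseq_le) (rule hit_limit[OF assms])
qed

lemma e_fun_refl:
  assumes "0 \<le> lam"
  shows "e_fun lam x x \<omega> \<sigma> = 1"
  using hit_le_e_fun[OF assms, of x 0 x] e_fun_bounds[OF assms, of x x] by simp

lemma e_fun_supermult:
  assumes "0 \<le> lam"
  shows "e_fun lam x y \<omega> \<sigma> * e_fun lam y z \<omega> \<sigma> \<le> e_fun lam x z \<omega> \<sigma>"
proof -
  interpret step_kernel "jump_prob \<omega>" "\<lambda>z. laplace lam (\<sigma> z)" by (rule step_kernel) fact
  have "(\<lambda>n. hit lam y n x * hit lam z n y) \<longlonglongrightarrow> e_fun lam x y \<omega> \<sigma> * e_fun lam y z \<omega> \<sigma>"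
    by (intro tendsto_mult hit_limit assms)
  then show ?thesis
    by (rule LIMSEQ_le_const2) (use order_trans[OF hit_gen_supermult hit_le_e_fun[OF assms]] in blast)
qed

text \<open>The direct jump alone contributes
  \<open>jump_prob \<omega> x e * laplace lam (\<sigma> x)\<close>, which is the recursion after one
  step. The factors are bounded by the minimal jump probability and by
  \<open>laplace_lower\<close>.\<close>

lemma e_fun_step:
  assumes lam: "0 \<le> lam" and e: "e \<in> unit_steps"
  shows "exp (- site_cost lam \<omega> \<sigma> x) \<le> e_fun lam x (x + e) \<omega> \<sigma>"
proof -
  let ?m = "min_jump (site_shift x \<omega>)"
  interpret J: prob_space "\<omega> x" by (rule jump_laws_prob[OF good_jump])
  have m1: "?m \<le> 1"
    by (rule order_trans[OF min_jump_le[OF e, of x \<omega>, unfolded jump_prob_def] J.prob_le_1])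
  have "exp (- site_cost lam \<omega> \<sigma> x) = ?m * exp (- lam * enn2real (mean_holding (site_shift x \<sigma>)))"
    using good_min_jump[of x] m1 by (simp add: site_cost_def exp_diff exp_minus field_simps flip: exp_add)
  also have "\<dots> \<le> jump_prob \<omega> x e * laplace lam (\<sigma> x)"
  proof (rule mult_mono)
    have "mean_holding (site_shift x \<sigma>) = (\<integral>\<^sup>+ s. ennreal s \<partial>\<sigma> x)" by (simp add: mean_holding_def site_shift_def)
    then show "exp (- lam * enn2real (mean_holding (site_shift x \<sigma>))) \<le> laplace lam (\<sigma> x)"
      using laplace_lower[OF good_holding lam, of x] good_mean[of x] by simp
  qed (use min_jump_le[OF e, of x \<omega>] in \<open>auto simp: jump_prob_def\<close>)
  also have "\<dots> = laplace lam (\<sigma> x) * (\<Sum>e'\<in>unit_steps. jump_prob \<omega> x e' * of_bool (e' = e))"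
    using e by (simp add: finite_unit_steps of_bool_def mult_ac if_distrib cong: if_cong)
  also have "\<dots> = hit lam (x + e) 1 x"
    using unit_step_nonzero[OF e] by simp
  also have "\<dots> \<le> e_fun lam x (x + e) \<omega> \<sigma>" by (rule hit_le_e_fun[OF lam])
  finally show ?thesis .
qed

lemma e_fun_steps_pos:
  assumes lam: "0 \<le> lam" and es: "set es \<subseteq> unit_steps"
  shows "0 < e_fun lam x (x + sum_list es) \<omega> \<sigma>"
  using es
proof (induction es arbitrary: x)
  case Nil
  then show ?case by (simp add: e_fun_refl[OF lam])
next
  case (Cons e es)
  have "0 < e_fun lam x (x + e) \<omega> \<sigma>"
    using e_fun_step[OF lam, of e x] Cons.prems by (auto intro: less_le_trans[OF exp_gt_zero])
  moreover have "0 < e_fun lam (x + e) (x + e + sum_list es) \<omega> \<sigma>" using Cons by auto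
  ultimately have "0 < e_fun lam x (x + e) \<omega> \<sigma> * e_fun lam (x + e) (x + e + sum_list es) \<omega> \<sigma>" by simp
  also have "\<dots> \<le> e_fun lam x (x + e + sum_list es) \<omega> \<sigma>" by (rule e_fun_supermult[OF lam])
  finally show ?case by (simp add: add.assoc)
qed

end

text \<open>The l1-norm as a natural number, which is also the length of a shortest lattice
  path.\<close>

definition site_norm :: "('d::finite) site \<Rightarrow> nat" where
  "site_norm z = (\<Sum>i\<in>UNIV. nat \<bar>z $ i\<bar>)"

lemma l1norm_of_site: "l1norm (of_site z) = site_norm z"
  by (simp add: l1norm_def of_site_def site_norm_def)

text \<open>A unit step towards the origin in a nonzero coordinate lowers the norm by exactly one.
  The exact length is what later gives bounds proportional to the norm.\<close>

lemma steps_to_site: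
  fixes z :: "('d::finite) site"
  shows "\<exists>es. set es \<subseteq> unit_steps \<and> sum_list es = z \<and> length es = site_norm z"
proof (induction "site_norm z" arbitrary: z)
  case 0
  then have "z = 0" by (simp add: site_norm_def vec_eq_iff)
  then show ?case by (intro exI[of _ "[]"]) (simp add: site_norm_def)
next
  case (Suc n)
  have "\<exists>i. z $ i \<noteq> 0"
  proof (rule ccontr)
    assume "\<not> ?thesis"
    then have "site_norm z = 0" by (simp add: site_norm_def)
    then show False using Suc.hyps(2) by simp
  qed
  then obtain i where i: "z $ i \<noteq> 0" by blast
  define e where "e = (if 0 < z $ i then axis i 1 else - axis i 1 :: 'd site)"
  have e: "e \<in> unit_steps" by (simp add: e_def axis_unit_step)
  have "site_norm z = nat \<bar>z $ i\<bar> + (\<Sum>j\<in>UNIV-{i}. nat \<bar>z $ j\<bar>)"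
    unfolding site_norm_def by (rule sum.remove) auto
  moreover have "site_norm (z - e) = nat \<bar>(z - e) $ i\<bar> + (\<Sum>j\<in>UNIV-{i}. nat \<bar>(z - e) $ j\<bar>)"
    unfolding site_norm_def by (rule sum.remove) auto
  moreover have "(\<Sum>j\<in>UNIV-{i}. nat \<bar>(z - e) $ j\<bar>) = (\<Sum>j\<in>UNIV-{i}. nat \<bar>z $ j\<bar>)"
    by (intro sum.cong) (auto simp: e_def axis_def)
  moreover have "nat \<bar>z $ i\<bar> = Suc (nat \<bar>(z - e) $ i\<bar>)" using i by (auto simp: e_def axis_def)
  ultimately have "n = site_norm (z - e)" using Suc.hyps(2) by simp
  from Suc.hyps(1)[OF this] obtain es where "set es \<subseteq> unit_steps" "sum_list es = z - e" "length es = site_norm (z - e)" by auto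
  then show ?case using e \<open>n = site_norm (z - e)\<close> Suc.hyps(2) by (intro exI[of _ "e # es"]) auto
qed

context
  fixes \<omega> :: "('d::finite) jump_env" and \<sigma> :: "'d holding_env"
  assumes good: "(\<omega>, \<sigma>) \<in> good"
begin

lemma e_fun_pos:
  assumes lam: "0 \<le> lam"
  shows "0 < e_fun lam x y \<omega> \<sigma>"
proof -
  obtain es where "set es \<subseteq> unit_steps" "sum_list es = y - x" using steps_to_site[of "y - x"] by auto
  then show ?thesis using e_fun_steps_pos[OF good lam, of es x] by simp
qed

lemma a_fun_nonneg: "0 \<le> lam \<Longrightarrow> 0 \<le> a_fun lam x y \<omega> \<sigma>"
  using e_fun_bounds[OF good, of lam x y] e_fun_pos[of lam x y] by (simp add: a_fun_def)

lemma a_fun_refl: "0 \<le> lam \<Longrightarrow> a_fun lam x x \<omega> \<sigma> = 0"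
  by (simp add: a_fun_def e_fun_refl[OF good])

lemma a_fun_triangle:
  assumes lam: "0 \<le> lam"
  shows "a_fun lam x z \<omega> \<sigma> \<le> a_fun lam x y \<omega> \<sigma> + a_fun lam y z \<omega> \<sigma>"
proof -
  have "ln (e_fun lam x y \<omega> \<sigma> * e_fun lam y z \<omega> \<sigma>) \<le> ln (e_fun lam x z \<omega> \<sigma>)"
    using e_fun_supermult[OF good lam, of x y z] e_fun_pos[OF lam] by (intro ln_mono) auto
  then show ?thesis using e_fun_pos[OF lam, of x y] e_fun_pos[OF lam, of y z] by (simp add: a_fun_def ln_mult)
qed

lemma a_fun_step:
  assumes lam: "0 \<le> lam" and e: "e \<in> unit_steps"
  shows "a_fun lam x (x + e) \<omega> \<sigma> \<le> site_cost lam \<omega> \<sigma> x"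
proof -
  have "ln (exp (- site_cost lam \<omega> \<sigma> x)) \<le> ln (e_fun lam x (x + e) \<omega> \<sigma>)"
    by (intro ln_mono e_fun_step[OF good lam e]) (auto simp: e_fun_pos[OF lam])
  then show ?thesis by (simp add: a_fun_def)
qed

text \<open>The triangle inequality along the path. Costs are paid at the sites that are left, so
  the endpoint does not occur in the sum.\<close>

lemma a_fun_path:
  assumes lam: "0 \<le> lam" and es: "set es \<subseteq> unit_steps"
  shows "a_fun lam x (x + sum_list es) \<omega> \<sigma> \<le> (\<Sum>j<length es. site_cost lam \<omega> \<sigma> (x + sum_list (take j es)))"
  using es
proof (induction es arbitrary: x)
  case Nil
  then show ?case by (simp add: a_fun_refl[OF lam])
next
  case (Cons e es)
  have "a_fun lam x (x + e + sum_list es) \<omega> \<sigma> \<le> a_fun lam x (x + e) \<omega> \<sigma> + a_fun lam (x + e) (x + e + sum_list es) \<omega> \<sigma>"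
    by (rule a_fun_triangle[OF lam])
  with Cons.IH[of "x + e"] a_fun_step[OF lam, of e x] Cons.prems show ?case
    by (simp add: sum.lessThan_Suc_shift add.assoc del: sum.lessThan_Suc)
qed

lemma a_fun_mono:
  assumes lam: "0 \<le> lam" "lam \<le> lam'"
  shows "a_fun lam x y \<omega> \<sigma> \<le> a_fun lam' x y \<omega> \<sigma>"
proof -
  have lam': "0 \<le> lam'" using lam by simp
  interpret step_kernel "jump_prob \<omega>" "\<lambda>z. laplace lam' (\<sigma> z)" by (rule step_kernel[OF good lam'])
  have "e_fun lam' x y \<omega> \<sigma> \<le> e_fun lam x y \<omega> \<sigma>"
    by (rule LIMSEQ_le[OF hit_limit[OF good lam'] hit_limit[OF good lam(1)]])
      (auto intro!: hit_gen_mono laplace_antimono[OF good_holding[OF good]] lam)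
  then show ?thesis using e_fun_pos[OF lam'] e_fun_pos[OF lam(1)] by (simp add: a_fun_def)
qed

text \<open>Jensen's inequality for the recursion, in the limit of many steps. It makes the cost
  continuous in \<lambda> > 0 with a modulus that is uniform over the target relative to the cost
  itself.\<close>

lemma a_fun_scale:
  assumes lam: "0 \<le> lam" and r: "1 \<le> r"
  shows "a_fun (r * lam) x y \<omega> \<sigma> \<le> r * a_fun lam x y \<omega> \<sigma>"
proof -
  have lam': "0 \<le> r * lam" using lam r by simp
  interpret step_kernel "jump_prob \<omega>" "\<lambda>z. laplace lam (\<sigma> z)" by (rule step_kernel[OF good lam])
  have "(\<lambda>n. hit_gen (jump_prob \<omega>) (\<lambda>z. laplace lam (\<sigma> z)) y n x powr r) \<longlonglongrightarrow> e_fun lam x y \<omega> \<sigma> powr r"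
    using e_fun_pos[OF lam, of x y] by (intro tendsto_powr hit_limit[OF good lam] tendsto_const) auto
  then have "e_fun lam x y \<omega> \<sigma> powr r \<le> e_fun (r * lam) x y \<omega> \<sigma>"
    by (rule LIMSEQ_le[OF _ hit_limit[OF good lam']])
      (auto intro!: hit_gen_powr laplace_powr[OF good_holding[OF good]] lam r)
  then have "ln (e_fun lam x y \<omega> \<sigma> powr r) \<le> ln (e_fun (r * lam) x y \<omega> \<sigma>)"
    using e_fun_pos[OF lam, of x y] by (intro ln_mono) auto
  then show ?thesis using e_fun_pos[OF lam, of x y] by (simp add: a_fun_def ln_powr)
qed

lemma a_fun_translate:
  assumes lam: "0 \<le> lam"
  shows "a_fun lam (x + z) (y + z) \<omega> \<sigma> = a_fun lam x y (site_shift z \<omega>) (site_shift z \<sigma>)"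
proof -
  have "hit_gen (jump_prob \<omega>) (\<lambda>u. laplace lam (\<sigma> u)) (y + z) n (x + z) =
     hit_gen (jump_prob (site_shift z \<omega>)) (\<lambda>u. laplace lam (site_shift z \<sigma> u)) y n x" for n
    unfolding hit_gen_translate by (simp add: site_shift_def jump_prob_def[abs_def])
  then have "(\<lambda>n. hit_gen (jump_prob \<omega>) (\<lambda>u. laplace lam (\<sigma> u)) (y + z) n (x + z)) \<longlonglongrightarrow> e_fun lam x y (site_shift z \<omega>) (site_shift z \<sigma>)"
    using hit_limit[OF good_shift[OF good] lam] by simp
  then have "e_fun lam (x + z) (y + z) \<omega> \<sigma> = e_fun lam x y (site_shift z \<omega>) (site_shift z \<sigma>)"
    using hit_limit[OF good lam] LIMSEQ_unique by blast
  then show ?thesis by (simp add: a_fun_def)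
qed

end

section \<open>Integrability of the travel cost\<close>

text \<open>A form of Vitali's theorem. The truncation of \<open>\<bar>f n x\<bar>\<close> at
  \<open>\<bar>B\<bar>\<close> converges by dominated convergence, and what exceeds it is at most
  \<open>R\<close>, a function that may depend on \<open>n\<close> but has small mean.\<close>

lemma (in prob_space) L1_convergence_of_AE:
  fixes f :: "nat \<Rightarrow> 'a \<Rightarrow> real"
  assumes f: "\<And>n. integrable M (f n)" and ae: "AE x in M. (\<lambda>n. f n x) \<longlonglongrightarrow> 0"
    and bound: "\<And>\<epsilon>. 0 < \<epsilon> \<Longrightarrow> \<exists>B. \<forall>\<^sub>F n in sequentially.
       \<exists>R. integrable M R \<and> (\<forall>x\<in>space M. 0 \<le> R x) \<and> (AE x in M. \<bar>f n x\<bar> \<le> B + R x) \<and> (\<integral>x. R x \<partial>M) \<le> \<epsilon>"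
  shows "(\<lambda>n. \<integral>x. \<bar>f n x\<bar> \<partial>M) \<longlonglongrightarrow> 0"
proof (rule LIMSEQ_I)
  fix r :: real assume "0 < r"
  then obtain B where B: "\<forall>\<^sub>F n in sequentially.
       \<exists>R. integrable M R \<and> (\<forall>x\<in>space M. 0 \<le> R x) \<and> (AE x in M. \<bar>f n x\<bar> \<le> B + R x) \<and> (\<integral>x. R x \<partial>M) \<le> r / 3"
    using bound[of "r / 3"] by auto
  have [measurable]: "f n \<in> borel_measurable M" for n using f by auto
  have im: "integrable M (\<lambda>x. min \<bar>f n x\<bar> \<bar>B\<bar>)" for n
    by (rule integrable_const_bound[where B="\<bar>B\<bar>"]) auto
  have "(\<lambda>n. \<integral>x. min \<bar>f n x\<bar> \<bar>B\<bar> \<partial>M) \<longlonglongrightarrow> (\<integral>x. 0 \<partial>M)"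
  proof (rule integral_dominated_convergence[where w="\<lambda>_. \<bar>B\<bar>"])
    show "AE x in M. (\<lambda>n. min \<bar>f n x\<bar> \<bar>B\<bar>) \<longlonglongrightarrow> 0"
      using ae
    proof eventually_elim
      case (elim x)
      have "(\<lambda>n. min \<bar>f n x\<bar> \<bar>B\<bar>) \<longlonglongrightarrow> min \<bar>0\<bar> \<bar>B\<bar>"
        by (intro tendsto_min tendsto_rabs elim tendsto_const)
      then show ?case by simp
    qed
  qed auto
  from tendstoD[OF this, of "r / 3"]
  have "\<forall>\<^sub>F n in sequentially. norm ((\<integral>x. min \<bar>f n x\<bar> \<bar>B\<bar> \<partial>M) - 0) < r / 3"
    using \<open>0 < r\<close> by (simp add: dist_norm)
  with B have "\<forall>\<^sub>F n in sequentially. norm ((\<integral>x. \<bar>f n x\<bar> \<partial>M) - 0) < r"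
  proof eventually_elim
    case (elim n)
    then obtain R where R: "integrable M R" "\<forall>x\<in>space M. 0 \<le> R x" "AE x in M. \<bar>f n x\<bar> \<le> B + R x" "(\<integral>x. R x \<partial>M) \<le> r / 3"
      by auto
    have "(\<integral>x. \<bar>f n x\<bar> \<partial>M) \<le> (\<integral>x. min \<bar>f n x\<bar> \<bar>B\<bar> + R x \<partial>M)"
    proof (rule integral_mono_AE)
      show "AE x in M. \<bar>f n x\<bar> \<le> min \<bar>f n x\<bar> \<bar>B\<bar> + R x"
        using R(3) AE_space by eventually_elim (use R(2) in \<open>auto simp: min_def\<close>)
    qed (use f im R in auto)
    also have "\<dots> = (\<integral>x. min \<bar>f n x\<bar> \<bar>B\<bar> \<partial>M) + (\<integral>x. R x \<partial>M)"
      using im R by (intro Bochner_Integration.integral_add) auto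
    finally have "(\<integral>x. \<bar>f n x\<bar> \<partial>M) < r" using elim(2) R(4) \<open>0 < r\<close> by simp
    moreover have "0 \<le> (\<integral>x. \<bar>f n x\<bar> \<partial>M)" by (rule Bochner_Integration.integral_nonneg) simp
    ultimately show ?case by simp
  qed
  then show "\<exists>no. \<forall>n\<ge>no. norm ((\<integral>x. \<bar>f n x\<bar> \<partial>M) - 0) < r" by (simp add: eventually_sequentially)
qed

lemma (in prob_space) integral_excess_small:
  fixes f :: "'a \<Rightarrow> real"
  assumes f: "integrable M f" and "0 < \<epsilon>"
  shows "\<exists>K\<ge>0. (\<integral>x. max 0 (f x - K) \<partial>M) \<le> \<epsilon>"
proof -
  have "(\<lambda>n. \<integral>x. max 0 (f x - real n) \<partial>M) \<longlonglongrightarrow> (\<integral>x. 0 \<partial>M)"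
  proof (rule integral_dominated_convergence[where w="\<lambda>x. \<bar>f x\<bar>"])
    show "AE x in M. (\<lambda>n. max 0 (f x - real n)) \<longlonglongrightarrow> 0"
    proof (rule AE_I2)
      fix x
      obtain N :: nat where "f x \<le> N" using real_arch_simple by blast
      then have "max 0 (f x - real n) = 0" if "N \<le> n" for n using that by simp
      then have "\<forall>\<^sub>F n in sequentially. max 0 (f x - real n) = 0"
        unfolding eventually_sequentially by blast
      then show "(\<lambda>n. max 0 (f x - real n)) \<longlonglongrightarrow> 0" by (rule tendsto_eventually)
    qed
  qed (use f in auto)
  then have "\<forall>\<^sub>F n in sequentially. (\<integral>x. max 0 (f x - real n) \<partial>M) < \<epsilon>"
    using \<open>0 < \<epsilon>\<close> by (intro order_tendstoD) auto
  then obtain n where "(\<integral>x. max 0 (f x - real n) \<partial>M) < \<epsilon>" by (auto simp: eventually_sequentially)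
  then show ?thesis by (intro exI[of _ "real n"]) auto
qed

lemma distr_snd:
  assumes "prob_space M" "prob_space N"
  shows "distr (M \<Otimes>\<^sub>M N) N snd = N"
proof (rule measure_eqI)
  interpret M: prob_space M by fact
  interpret N: prob_space N by fact
  fix A assume A: "A \<in> sets (distr (M \<Otimes>\<^sub>M N) N snd)"
  have "snd -` A \<inter> space (M \<Otimes>\<^sub>M N) = space M \<times> A"
    using A sets.sets_into_space[of A N] by (auto simp: space_pair_measure)
  with A show "emeasure (distr (M \<Otimes>\<^sub>M N) N snd) A = emeasure N A"
    by (simp add: emeasure_distr N.emeasure_pair_measure_Times M.emeasure_space_1)
qed simp

section \<open>The random environment: measurability and integrability\<close>

locale rwre =
  fixes \<mu> :: "('d::finite) site measure measure" and \<nu> :: "real measure measure"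
  assumes \<mu>: "prob_space \<mu>" "sets \<mu> = sets jump_laws"
    and \<nu>: "prob_space \<nu>" "sets \<nu> = sets holding_laws"
    and elliptic: "AE \<omega> in iid_field \<mu>. 0 < min_jump (\<omega> :: 'd jump_env)"
    and moment_jump: "integrable (iid_field \<mu>) (\<lambda>\<omega> :: 'd jump_env. \<bar>ln (min_jump \<omega>)\<bar> ^ CARD('d))"
    and moment_holding: "(\<integral>\<^sup>+ \<sigma>. mean_holding (\<sigma> :: 'd holding_env) ^ CARD('d) \<partial>iid_field \<nu>) < \<infinity>"
begin

abbreviation J :: "'d jump_env measure" where "J \<equiv> iid_field \<mu>"
abbreviation H :: "'d holding_env measure" where "H \<equiv> iid_field \<nu>"
abbreviation M :: "('d jump_env \<times> 'd holding_env) measure" where "M \<equiv> env_law \<mu> \<nu>"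

sublocale J: prob_space J by (rule prob_space_iid_field[OF \<mu>(1)])
sublocale H: prob_space H by (rule prob_space_iid_field[OF \<nu>(1)])
sublocale M: prob_space M by (rule prob_space_env_law[OF \<mu>(1) \<nu>(1)])

lemma space_J: "\<omega> \<in> space J \<Longrightarrow> \<omega> x \<in> space jump_laws"
  and space_H: "\<sigma> \<in> space H \<Longrightarrow> \<sigma> x \<in> space holding_laws"
  using sets_eq_imp_space_eq[OF \<mu>(2)] sets_eq_imp_space_eq[OF \<nu>(2)]
  by (auto simp: iid_field_def space_PiM PiE_iff)

lemma space_M: "space M = space J \<times> space H"
  by (simp add: env_law_def space_pair_measure)

lemma coord_J: "(\<lambda>\<omega>. \<omega> x) \<in> J \<rightarrow>\<^sub>M jump_laws" and coord_H: "(\<lambda>\<sigma>. \<sigma> x) \<in> H \<rightarrow>\<^sub>M holding_laws"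
  unfolding measurable_cong_sets[OF refl \<mu>(2)[symmetric]] measurable_cong_sets[OF refl \<nu>(2)[symmetric]] iid_field_def
  by (rule measurable_component_singleton, simp)+

lemma fst_measurable: "fst \<in> M \<rightarrow>\<^sub>M J" and snd_measurable: "snd \<in> M \<rightarrow>\<^sub>M H"
  by (simp_all add: env_law_def)

lemma distr_fst_M: "distr M J fst = J" and distr_snd_M: "distr M H snd = H"
  unfolding env_law_def by (rule H.distr_pair_fst, rule distr_snd[OF J.prob_space_axioms H.prob_space_axioms])

lemma jump_prob_measurable:
  assumes "e \<in> unit_steps"
  shows "(\<lambda>\<omega>. jump_prob \<omega> x e) \<in> borel_measurable J"
proof -
  have "(\<lambda>\<rho>. emeasure \<rho> {e}) \<in> borel_measurable (subprob_algebra (count_space unit_steps))"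
    using assms by (intro measurable_emeasure_subprob_algebra) auto
  from measurable_compose[OF measurable_prob_algebraD[OF coord_J[unfolded jump_laws_def]] this]
  show ?thesis unfolding jump_prob_def measure_def by simp
qed

lemma min_jump_measurable: "(\<lambda>\<omega>. min_jump (site_shift x \<omega>)) \<in> borel_measurable J"
proof -
  have "(\<lambda>\<omega>. Min ((\<lambda>e. jump_prob \<omega> x e) ` unit_steps)) \<in> borel_measurable J"
    by (rule borel_measurable_Min[OF finite_unit_steps jump_prob_measurable])
  then show ?thesis by (simp add: min_jump_def jump_prob_def site_shift_def)
qed

lemma mean_holding_measurable: "(\<lambda>\<sigma>. mean_holding (site_shift x \<sigma>)) \<in> borel_measurable H"
proof -
  have "(\<lambda>\<rho>. \<integral>\<^sup>+ s. ennreal s \<partial>\<rho>) \<in> borel_measurable (subprob_algebra (restrict_space borel {0<..}))"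
    by (intro nn_integral_measurable_subprob_algebra measurable_restrict_space1) simp
  from measurable_compose[OF measurable_prob_algebraD[OF coord_H[unfolded holding_laws_def]] this]
  show ?thesis unfolding mean_holding_def site_shift_def by simp
qed

lemma good_measurable: "good \<inter> space M \<in> sets M"
proof -
  have "good \<inter> space M = {\<xi> \<in> space M. \<forall>x. 0 < min_jump (site_shift x (fst \<xi>)) \<and> mean_holding (site_shift x (snd \<xi>)) < \<infinity>}"
    using space_J space_H by (auto simp: good_def space_M)
  also have "\<dots> \<in> sets M"
    using measurable_compose[OF fst_measurable min_jump_measurable]
      measurable_compose[OF snd_measurable mean_holding_measurable]
    by (intro sets.sets_Collect_countable_All sets.sets_Collect_conj borel_measurable_less) auto
  finally show ?thesis .
qed

text \<open>A finite moment excludes an infinite mean holding time at the origin. Invariance under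
  shifts and countability of the lattice carry both conditions to all sites.\<close>

lemma AE_good: "AE \<xi> in M. \<xi> \<in> good"
proof -
  have 1: "AE \<omega> in J. 0 < min_jump (site_shift x \<omega>)" for x
    by (rule preserves_AE[OF preserves_shift[OF \<mu>(1)] elliptic])
  have "AE \<sigma> in H. mean_holding \<sigma> ^ CARD('d) \<noteq> \<infinity>"
    using mean_holding_measurable[of 0] moment_holding
    by (intro nn_integral_PInf_AE) auto
  then have 2: "AE \<sigma> in H. mean_holding \<sigma> < \<infinity>"
  proof eventually_elim
    case (elim \<sigma>)
    then show ?case by (cases "mean_holding \<sigma> = \<infinity>") (auto simp: top.not_eq_extremum)
  qed
  have 2: "AE \<sigma> in H. mean_holding (site_shift x \<sigma>) < \<infinity>" for x
    by (rule preserves_AE[OF preserves_shift[OF \<nu>(1)] 2])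
  have "AE \<xi> in distr M J fst. \<forall>x. 0 < min_jump (site_shift x \<xi>)"
    unfolding distr_fst_M AE_all_countable using 1 by simp
  note 3 = AE_distrD[OF fst_measurable this]
  have "AE \<xi> in distr M H snd. \<forall>x. mean_holding (site_shift x \<xi>) < \<infinity>"
    unfolding distr_snd_M AE_all_countable using 2 by simp
  note 4 = AE_distrD[OF snd_measurable this]
  show ?thesis
    using 3 4 AE_space
    by eventually_elim (auto simp: good_def space_M space_J space_H)
qed

lemma hit_gen_measurable:
  "(\<lambda>\<xi>. hit_gen (jump_prob (fst \<xi>)) (\<lambda>z. laplace lam (snd \<xi> z)) y n x) \<in> borel_measurable M"
proof (induction n arbitrary: x)
  case (Suc n)
  have "(\<lambda>\<xi>. jump_prob (fst \<xi>) x e) \<in> borel_measurable M" if "e \<in> unit_steps" for e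
    by (rule measurable_compose[OF fst_measurable jump_prob_measurable[OF that]])
  moreover have "(\<lambda>\<xi>. laplace lam (snd \<xi> x)) \<in> borel_measurable M"
    by (rule measurable_compose[OF snd_measurable measurable_compose[OF coord_H laplace_measurable]])
  ultimately show ?case using Suc by (auto intro!: borel_measurable_times borel_measurable_sum)
qed simp

lemma a_fun_measurable:
  assumes "0 \<le> lam"
  shows "(\<lambda>(\<omega>, \<sigma>). a_fun lam x y \<omega> \<sigma>) \<in> borel_measurable M"
proof -
  have "(\<lambda>\<xi>. e_fun lam x y (fst \<xi>) (snd \<xi>)) \<in> borel_measurable M"
  proof (rule borel_measurable_LIMSEQ_real[OF _ hit_gen_measurable])
    fix \<xi> assume "\<xi> \<in> space M"
    then show "(\<lambda>n. hit_gen (jump_prob (fst \<xi>)) (\<lambda>z. laplace lam (snd \<xi> z)) y n x) \<longlonglongrightarrow> e_fun lam x y (fst \<xi>) (snd \<xi>)"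
      unfolding laplace_def by (intro e_fun_limit assms) (auto simp: space_M space_J space_H)
  qed
  then show ?thesis unfolding a_fun_def case_prod_unfold by (intro borel_measurable_uminus borel_measurable_ln)
qed

lemma le_one_plus_power: "(t::real) \<le> 1 + t ^ CARD('d)" if "0 \<le> t"
proof (cases "t \<le> 1")
  case False
  then have "t ^ 1 \<le> t ^ CARD('d)" by (intro power_increasing) (auto simp: Suc_le_eq)
  then show ?thesis by simp
qed (use that in \<open>simp add: add_increasing2\<close>)

definition jump_cost :: "'d jump_env \<Rightarrow> real" where
  "jump_cost \<omega> = \<bar>ln (min_jump \<omega>)\<bar>"

definition holding_cost :: "'d holding_env \<Rightarrow> real" where
  "holding_cost \<sigma> = enn2real (mean_holding \<sigma>)"

lemma jump_cost_measurable: "jump_cost \<in> borel_measurable J"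
  and holding_cost_measurable: "holding_cost \<in> borel_measurable H"
  unfolding jump_cost_def[abs_def] holding_cost_def[abs_def]
  using min_jump_measurable[of 0] mean_holding_measurable[of 0] by auto

lemma integrable_jump_cost_power: "integrable J (\<lambda>\<omega>. jump_cost \<omega> ^ CARD('d))"
  unfolding jump_cost_def by (rule moment_jump)

lemma integrable_holding_cost_power: "integrable H (\<lambda>\<sigma>. holding_cost \<sigma> ^ CARD('d))"
proof (rule integrableI_bounded)
  have "(\<integral>\<^sup>+ \<sigma>. ennreal (norm (holding_cost \<sigma> ^ CARD('d))) \<partial>H) \<le> (\<integral>\<^sup>+ \<sigma>. mean_holding \<sigma> ^ CARD('d) \<partial>H)"
  proof (rule nn_integral_mono)
    fix \<sigma>
    show "ennreal (norm (holding_cost \<sigma> ^ CARD('d))) \<le> mean_holding \<sigma> ^ CARD('d)"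
      by (cases "mean_holding \<sigma>") (auto simp: holding_cost_def ennreal_power)
  qed
  then show "(\<integral>\<^sup>+ \<sigma>. ennreal (norm (holding_cost \<sigma> ^ CARD('d))) \<partial>H) < \<infinity>"
    using moment_holding by (rule le_less_trans)
qed (use holding_cost_measurable in auto)

lemma integrable_jump_cost: "integrable J jump_cost"
  by (rule Bochner_Integration.integrable_bound[of _ "\<lambda>\<omega>. 1 + jump_cost \<omega> ^ CARD('d)"])
    (use integrable_jump_cost_power le_one_plus_power in \<open>auto intro!: jump_cost_measurable AE_I2 simp: jump_cost_def\<close>)

lemma integrable_holding_cost: "integrable H holding_cost"
  by (rule Bochner_Integration.integrable_bound[of _ "\<lambda>\<omega>. 1 + holding_cost \<omega> ^ CARD('d)"])
    (use integrable_holding_cost_power le_one_plus_power in \<open>auto intro!: holding_cost_measurable AE_I2 simp: holding_cost_def\<close>)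

lemma site_cost_eq: "site_cost lam (fst \<xi>) (snd \<xi>) x = jump_cost (fst (env_shift x \<xi>)) + lam * holding_cost (snd (env_shift x \<xi>))"
  by (simp add: site_cost_def jump_cost_def holding_cost_def env_shift_def)

abbreviation cost0 :: "real \<Rightarrow> 'd jump_env \<times> 'd holding_env \<Rightarrow> real" where
  "cost0 lam \<xi> \<equiv> jump_cost (fst \<xi>) + lam * holding_cost (snd \<xi>)"

lemma integrable_cost0: "integrable M (cost0 lam)"
proof -
  have "integrable (distr M J fst) jump_cost" "integrable (distr M H snd) holding_cost"
    by (simp_all add: distr_fst_M distr_snd_M integrable_jump_cost integrable_holding_cost)
  then have "integrable M (\<lambda>\<xi>. jump_cost (fst \<xi>))" "integrable M (\<lambda>\<xi>. holding_cost (snd \<xi>))"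
    by (simp_all add: integrable_distr[OF fst_measurable] integrable_distr[OF snd_measurable])
  then show ?thesis by simp
qed

lemma preserves_M: "preserves M (env_shift z)"
  by (rule preserves_env_shift[OF \<mu>(1) \<nu>(1)])

text \<open>Where a jump probability vanishes \<open>a_fun\<close> is not subadditive, since \<open>ln 0 = 0\<close>; it is replaced by \<open>0\<close> there.\<close>

definition a0 :: "real \<Rightarrow> 'd site \<Rightarrow> 'd jump_env \<times> 'd holding_env \<Rightarrow> real" where
  "a0 lam z \<xi> = (if \<xi> \<in> good then a_fun lam 0 z (fst \<xi>) (snd \<xi>) else 0)"

lemma a0_nonneg: "0 \<le> lam \<Longrightarrow> 0 \<le> a0 lam z \<xi>"
  unfolding a0_def using a_fun_nonneg[of "fst \<xi>" "snd \<xi>"] by auto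

lemma AE_a0: "AE \<xi> in M. a0 lam z \<xi> = a_fun lam 0 z (fst \<xi>) (snd \<xi>)"
  using AE_good by eventually_elim (simp add: a0_def)

lemma a0_measurable:
  assumes "0 \<le> lam"
  shows "a0 lam z \<in> borel_measurable M"
proof -
  have "(\<lambda>\<xi>. if \<xi> \<in> good \<inter> space M then (case \<xi> of (\<omega>, \<sigma>) \<Rightarrow> a_fun lam 0 z \<omega> \<sigma>) else 0) \<in> borel_measurable M"
    using good_measurable a_fun_measurable[OF assms] by (intro measurable_If_set) auto
  then show ?thesis
    by (rule measurable_cong[THEN iffD1, rotated]) (auto simp: a0_def)
qed

lemma a0_triangle:
  assumes lam: "0 \<le> lam" and \<xi>: "\<xi> \<in> good"
  shows "a0 lam (y + z) \<xi> \<le> a0 lam y \<xi> + a0 lam z (env_shift y \<xi>)"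
proof -
  have g: "(fst \<xi>, snd \<xi>) \<in> good" using \<xi> by simp
  have g': "env_shift y \<xi> \<in> good" using good_shift[OF g, of y] by (simp add: env_shift_def map_prod_def case_prod_unfold)
  have "a_fun lam 0 (y + z) (fst \<xi>) (snd \<xi>) \<le> a_fun lam 0 y (fst \<xi>) (snd \<xi>) + a_fun lam (0 + y) (z + y) (fst \<xi>) (snd \<xi>)"
    using a_fun_triangle[OF g lam, of 0 "z + y" y] by (simp add: add.commute)
  then show ?thesis
    using \<xi> g' unfolding a_fun_translate[OF g lam] by (simp add: a0_def env_shift_def)
qed

text \<open>The list of sites is chosen before the environment. Means along it can therefore be
  computed by stationarity.\<close>

lemma a0_path:
  assumes lam: "0 \<le> lam"
  shows "\<exists>xs. length xs = site_norm z \<and>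
    (\<forall>\<xi>. a0 lam z \<xi> \<le> (\<Sum>x\<leftarrow>xs. cost0 lam (env_shift x \<xi>)))"
proof -
  obtain es where es: "set es \<subseteq> unit_steps" "sum_list es = z" "length es = site_norm z"
    using steps_to_site[of z] by auto
  define xs where "xs = map (\<lambda>j. sum_list (take j es)) [0..<length es]"
  have "a0 lam z \<xi> \<le> (\<Sum>x\<leftarrow>xs. cost0 lam (env_shift x \<xi>))" for \<xi>
  proof (cases "\<xi> \<in> good")
    case True
    then have g: "(fst \<xi>, snd \<xi>) \<in> good" by simp
    have "(\<Sum>x\<leftarrow>xs. cost0 lam (env_shift x \<xi>)) = (\<Sum>j<length es. site_cost lam (fst \<xi>) (snd \<xi>) (0 + sum_list (take j es)))"
      unfolding xs_def by (simp add: o_def site_cost_eq sum_list_sum_nth atLeast0LessThan)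
    then show ?thesis
      using a_fun_path[OF g lam es(1), of 0] True by (simp add: a0_def es)
  next
    case False
    then show ?thesis using lam by (auto simp: a0_def jump_cost_def holding_cost_def intro!: sum_list_nonneg)
  qed
  then show ?thesis using es by (intro exI[of _ xs]) (auto simp: xs_def)
qed

lemma integral_excess_path:
  fixes lam K :: real
  assumes "0 \<le> K"
  defines "ex \<equiv> \<lambda>\<xi>. max 0 (cost0 lam \<xi> - K)"
  shows "integrable M (\<lambda>\<xi>. \<Sum>x\<leftarrow>xs. ex (env_shift x \<xi>))"
    and "(\<integral>\<xi>. (\<Sum>x\<leftarrow>xs. ex (env_shift x \<xi>)) \<partial>M) = length xs * (\<integral>\<xi>. ex \<xi> \<partial>M)"
proof -
  have i: "integrable M ex" unfolding ex_def using integrable_cost0[of lam] by auto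
  have 1: "integrable M (\<lambda>\<xi>. ex (env_shift x \<xi>))" "(\<integral>\<xi>. ex (env_shift x \<xi>) \<partial>M) = (\<integral>\<xi>. ex \<xi> \<partial>M)" for x
    by (rule preserves_integrable[OF preserves_M i]) (rule preserves_integral[OF preserves_M borel_measurable_integrable[OF i]])
  show 2: "integrable M (\<lambda>\<xi>. \<Sum>x\<leftarrow>xs. ex (env_shift x \<xi>))" for xs
    by (induction xs) (auto intro!: Bochner_Integration.integrable_add 1)
  show "(\<integral>\<xi>. (\<Sum>x\<leftarrow>xs. ex (env_shift x \<xi>)) \<partial>M) = length xs * (\<integral>\<xi>. ex \<xi> \<partial>M)"
    by (induction xs) (simp_all add: Bochner_Integration.integral_add[OF 1(1) 2] 1(2) algebra_simps)
qed

text \<open>One level \<open>K\<close>, chosen for a single site, serves all targets: by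
  stationarity the average excess over \<open>K\<close> along a path has the same mean as the excess
  at one site, whatever the length of the path.\<close>

lemma a0_uniformly_integrable:
  assumes lam: "0 \<le> lam" and \<epsilon>: "0 < \<epsilon>"
  shows "\<exists>K\<ge>0. \<forall>z. \<exists>R. integrable M R \<and> (\<forall>\<xi>. 0 \<le> R \<xi>) \<and> (\<forall>\<xi>. a0 lam z \<xi> \<le> real (site_norm z) * (K + R \<xi>)) \<and> (\<integral>\<xi>. R \<xi> \<partial>M) \<le> \<epsilon>"
proof -
  obtain K where K: "0 \<le> K" "(\<integral>\<xi>. max 0 (cost0 lam \<xi> - K) \<partial>M) \<le> \<epsilon>"
    using M.integral_excess_small[OF integrable_cost0 \<epsilon>] by blast
  have "\<exists>R. integrable M R \<and> (\<forall>\<xi>. 0 \<le> R \<xi>) \<and> (\<forall>\<xi>. a0 lam z \<xi> \<le> real (site_norm z) * (K + R \<xi>)) \<and> (\<integral>\<xi>. R \<xi> \<partial>M) \<le> \<epsilon>" for z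
  proof -
    obtain xs where xs: "length xs = site_norm z" "\<And>\<xi>. a0 lam z \<xi> \<le> (\<Sum>x\<leftarrow>xs. cost0 lam (env_shift x \<xi>))"
      using a0_path[OF lam, of z] by auto
    \<comment> \<open>For \<open>z = 0\<close> the path is empty and both sides of the bound are
      \<open>0\<close>, so the division by \<open>0\<close> is harmless.\<close>
    define R where "R \<xi> = (\<Sum>x\<leftarrow>xs. max 0 (cost0 lam (env_shift x \<xi>) - K)) / site_norm z" for \<xi>
    have "integrable M R"
      unfolding R_def by (intro integrable_divide integral_excess_path(1)[OF K(1)])
    moreover have "0 \<le> R \<xi>" for \<xi> unfolding R_def by (intro divide_nonneg_nonneg sum_list_nonneg) auto
    moreover have "(\<integral>\<xi>. R \<xi> \<partial>M) \<le> \<epsilon>"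
      unfolding R_def using K \<epsilon> by (simp add: integral_excess_path(2)[OF K(1)] xs)
    moreover have "a0 lam z \<xi> \<le> real (site_norm z) * (K + R \<xi>)" for \<xi>
    proof -
      have "(\<Sum>x\<leftarrow>xs. cost0 lam (env_shift x \<xi>)) \<le> (\<Sum>x\<leftarrow>xs. K + max 0 (cost0 lam (env_shift x \<xi>) - K))"
        by (intro sum_list_mono) auto
      also have "\<dots> = length xs * K + (\<Sum>x\<leftarrow>xs. max 0 (cost0 lam (env_shift x \<xi>) - K))"
        by (simp add: sum_list_addf sum_list_triv)
      also have "\<dots> = real (site_norm z) * (K + R \<xi>)"
        using xs(1) by (cases "site_norm z = 0") (simp_all add: R_def algebra_simps)
      finally show ?thesis using xs(2)[of \<xi>] by simp
    qed
    ultimately show ?thesis by blast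
  qed
  then show ?thesis using K(1) by blast
qed

lemma integrable_a0:
  assumes lam: "0 \<le> lam"
  shows "integrable M (a0 lam z)"
proof -
  obtain K R where R: "integrable M R" "\<And>\<xi>. a0 lam z \<xi> \<le> real (site_norm z) * (K + R \<xi>)"
    using a0_uniformly_integrable[OF lam zero_less_one] by metis
  have b: "integrable M (\<lambda>\<xi>. real (site_norm z) * (K + R \<xi>))" using R(1) by simp
  have "norm (a0 lam z \<xi>) \<le> norm (real (site_norm z) * (K + R \<xi>))" for \<xi>
    unfolding real_norm_def abs_of_nonneg[OF a0_nonneg[OF lam]] by (rule order_trans[OF R(2) abs_ge_self])
  then show ?thesis
    by (intro Bochner_Integration.integrable_bound[OF b a0_measurable[OF lam] AE_I2])
qed

lemma integral_a0_le:
  assumes lam: "0 \<le> lam"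
  shows "(\<integral>\<xi>. a0 lam z \<xi> \<partial>M) \<le> site_norm z * (\<integral>\<xi>. cost0 lam \<xi> \<partial>M)"
proof -
  obtain xs where xs: "length xs = site_norm z" "\<And>\<xi>. a0 lam z \<xi> \<le> (\<Sum>x\<leftarrow>xs. cost0 lam (env_shift x \<xi>))"
    using a0_path[OF lam, of z] by auto
  have c0: "max 0 (cost0 lam \<xi> - 0) = cost0 lam \<xi>" for \<xi>
    using lam by (simp add: jump_cost_def holding_cost_def)
  note i = integral_excess_path[where K=0 and lam=lam, unfolded c0, OF order_refl]
  have "(\<integral>\<xi>. a0 lam z \<xi> \<partial>M) \<le> (\<integral>\<xi>. (\<Sum>x\<leftarrow>xs. cost0 lam (env_shift x \<xi>)) \<partial>M)"
    by (intro integral_mono integrable_a0[OF lam] i xs)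
  then show ?thesis by (simp add: i xs)
qed

end

section \<open>Lyapunov exponents\<close>

context rwre
begin

lemma of_nat_smult_eq_0_iff: "of_nat n *s z = 0 \<longleftrightarrow> n = 0 \<or> z = 0" for z :: "'d site"
  by (auto simp: vec_eq_iff)

lemma of_nat_add_smult: "of_nat (m + n) *s z = of_nat m *s z + of_nat n *s z" for z :: "'d site"
  by (simp add: vec_eq_iff algebra_simps)

lemma site_norm_smult: "site_norm (of_nat n *s z) = n * site_norm (z :: 'd site)"
  by (simp add: site_norm_def abs_mult nat_mult_distrib sum_distrib_left)

lemma a0_zero: "0 \<le> lam \<Longrightarrow> a0 lam 0 \<xi> = 0"
  unfolding a0_def using a_fun_refl[of "fst \<xi>" "snd \<xi>"] by auto

text \<open>Kingman's theorem for the shift by \<open>z\<close>. Its powers are shifts by nonzero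
  vectors, so they satisfy the zero-one law as well.\<close>

lemma a0_limit_exists:
  assumes lam: "0 \<le> lam"
  shows "\<exists>c. AE \<xi> in M. (\<lambda>n. a0 lam (of_nat n *s z) \<xi> / n) \<longlonglongrightarrow> c"
proof (cases "z = 0")
  case True
  then show ?thesis by (intro exI[of _ 0]) (simp add: a0_zero[OF lam])
next
  case False
  have T: "env_shift z ^^ m = env_shift (of_nat m *s z)" for m by (rule env_shift_funpow)
  show ?thesis
  proof (rule M.kingman[of "env_shift z" "\<lambda>n. a0 lam (of_nat n *s z)"])
    show "preserves M (env_shift z)" by (rule preserves_M)
    show "zero_one M (env_shift z ^^ N)" if "0 < N" for N
      unfolding T using False that
      by (intro zero_one_env_shift \<mu>(1) \<nu>(1)) (simp add: of_nat_smult_eq_0_iff)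
    show "a0 lam (of_nat (m + n) *s z) \<xi> \<le> a0 lam (of_nat m *s z) \<xi> + a0 lam (of_nat n *s z) ((env_shift z ^^ m) \<xi>)" for m n \<xi>
    proof (cases "\<xi> \<in> good")
      case True
      then show ?thesis unfolding T of_nat_add_smult by (rule a0_triangle[OF lam])
    next
      case False
      \<comment> \<open>Off \<open>good\<close> the left side is \<open>0\<close> and the right side
        nonnegative: with \<open>a0\<close> subadditivity holds at every point, as
        \<open>kingman\<close> requires.\<close>
      then show ?thesis by (simp add: a0_def[of _ _ \<xi>] a0_nonneg[OF lam])
    qed
  qed (auto simp: a0_zero[OF lam] a0_nonneg[OF lam] integrable_a0[OF lam])
qed

text \<open>Uniform integrability of the cost per unit length, in a form that covers both the
  multiples of one site and the lattice approximations of a general sequence with its moving centres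
  \<open>c n\<close>.\<close>

lemma a0_L1_of_AE:
  fixes z :: "nat \<Rightarrow> 'd site" and l c :: "nat \<Rightarrow> real" and C D :: real
  assumes lam: "0 \<le> lam"
    and ae: "AE \<xi> in M. (\<lambda>n. a0 lam (z n) \<xi> / l n - c n) \<longlonglongrightarrow> 0"
    and l: "\<forall>\<^sub>F n in sequentially. 0 < l n \<and> site_norm (z n) \<le> C * l n" and c: "\<And>n. \<bar>c n\<bar> \<le> D"
  shows "(\<lambda>n. \<integral>\<xi>. \<bar>a0 lam (z n) \<xi> / l n - c n\<bar> \<partial>M) \<longlonglongrightarrow> 0"
proof (rule M.L1_convergence_of_AE[OF _ ae])
  show "integrable M (\<lambda>\<xi>. a0 lam (z n) \<xi> / l n - c n)" for n
    using integrable_a0[OF lam] by auto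
  fix \<epsilon> :: real assume "0 < \<epsilon>"
  define C' where "C' = \<bar>C\<bar> + 1"
  have C': "0 < C'" by (simp add: C'_def)
  obtain K where K: "0 \<le> K" "\<And>z. \<exists>R. integrable M R \<and> (\<forall>\<xi>. 0 \<le> R \<xi>) \<and> (\<forall>\<xi>. a0 lam z \<xi> \<le> real (site_norm z) * (K + R \<xi>)) \<and> (\<integral>\<xi>. R \<xi> \<partial>M) \<le> \<epsilon> / C'"
    using a0_uniformly_integrable[OF lam, of "\<epsilon> / C'"] \<open>0 < \<epsilon>\<close> C' by auto
  show "\<exists>B. \<forall>\<^sub>F n in sequentially. \<exists>R. integrable M R \<and> (\<forall>x\<in>space M. 0 \<le> R x) \<and>
      (AE x in M. \<bar>a0 lam (z n) x / l n - c n\<bar> \<le> B + R x) \<and> (\<integral>x. R x \<partial>M) \<le> \<epsilon>"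
  proof (intro exI[of _ "C' * K + D"] eventually_mono[OF l])
    fix n assume n: "0 < l n \<and> site_norm (z n) \<le> C * l n"
    obtain R where R: "integrable M R" "\<And>\<xi>. 0 \<le> R \<xi>" "\<And>\<xi>. a0 lam (z n) \<xi> \<le> real (site_norm (z n)) * (K + R \<xi>)" "(\<integral>\<xi>. R \<xi> \<partial>M) \<le> \<epsilon> / C'"
      using K(2)[of "z n"] by auto
    have "\<bar>a0 lam (z n) \<xi> / l n - c n\<bar> \<le> (C' * K + D) + C' * R \<xi>" for \<xi>
    proof -
      have "a0 lam (z n) \<xi> \<le> real (site_norm (z n)) * (K + R \<xi>)" by (rule R)
      also have "\<dots> \<le> (C' * l n) * (K + R \<xi>)"
      proof (rule mult_right_mono)
        have "C * l n \<le> C' * l n" using n by (intro mult_right_mono) (auto simp: C'_def)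
        then show "real (site_norm (z n)) \<le> C' * l n" using n by linarith
      qed (use K R in auto)
      finally have "a0 lam (z n) \<xi> / l n \<le> C' * (K + R \<xi>)" using n by (simp add: pos_divide_le_eq mult_ac)
      moreover have "0 \<le> a0 lam (z n) \<xi> / l n" using n by (simp add: a0_nonneg[OF lam])
      moreover have "\<bar>a0 lam (z n) \<xi> / l n - c n\<bar> \<le> \<bar>a0 lam (z n) \<xi> / l n\<bar> + \<bar>c n\<bar>" by (rule abs_triangle_ineq4)
      ultimately show ?thesis using c[of n] by (simp add: algebra_simps)
    qed
    moreover have "(\<integral>\<xi>. C' * R \<xi> \<partial>M) \<le> \<epsilon>" using R(4) C' by (simp add: field_simps)
    ultimately show "\<exists>R. integrable M R \<and> (\<forall>x\<in>space M. 0 \<le> R x) \<and>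
      (AE x in M. \<bar>a0 lam (z n) x / l n - c n\<bar> \<le> C' * K + D + R x) \<and> (\<integral>x. R x \<partial>M) \<le> \<epsilon>"
      using R C' by (intro exI[of _ "\<lambda>\<xi>. C' * R \<xi>"]) auto
  qed
qed

abbreviation \<alpha>0 :: "real \<Rightarrow> 'd site \<Rightarrow> real" where
  "\<alpha>0 lam z \<equiv> lyapunov_site \<mu> \<nu> lam z"

text \<open>The definite description is evaluated at the Kingman constant. Existence needs the
  transfer of the limits from \<open>a0\<close> to \<open>a_fun\<close>; uniqueness follows from
  uniqueness of almost sure limits.\<close>

lemma lyapunov_site_AE_L1:
  assumes lam: "0 \<le> lam"
  shows "AE \<xi> in M. (\<lambda>n. a0 lam (of_nat n *s z) \<xi> / n) \<longlonglongrightarrow> \<alpha>0 lam z"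
    and "(\<lambda>n. \<integral>\<xi>. \<bar>a0 lam (of_nat n *s z) \<xi> / n - \<alpha>0 lam z\<bar> \<partial>M) \<longlonglongrightarrow> 0"
proof -
  obtain c where c: "AE \<xi> in M. (\<lambda>n. a0 lam (of_nat n *s z) \<xi> / n) \<longlonglongrightarrow> c"
    using a0_limit_exists[OF lam] by blast
  have L1: "(\<lambda>n. \<integral>\<xi>. \<bar>a0 lam (of_nat n *s z) \<xi> / n - c\<bar> \<partial>M) \<longlonglongrightarrow> 0"
  proof (rule a0_L1_of_AE[OF lam, where C="site_norm z" and D="\<bar>c\<bar>"])
    show "AE \<xi> in M. (\<lambda>n. a0 lam (of_nat n *s z) \<xi> / n - c) \<longlonglongrightarrow> 0"
      using c by eventually_elim (rule LIM_zero)
    show "\<forall>\<^sub>F n in sequentially. 0 < real n \<and> real (site_norm (of_nat n *s z)) \<le> real (site_norm z) * real n"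
      using eventually_gt_at_top[of 0] by eventually_elim (simp add: site_norm_smult mult.commute)
  qed (simp_all add: site_norm_smult mult.commute)
  let ?P = "\<lambda>c. (AE (\<omega>, \<sigma>) in M. (\<lambda>n. a_fun lam 0 (of_nat n *s z) \<omega> \<sigma> / n) \<longlonglongrightarrow> c) \<and>
     L1_limit M (\<lambda>n (\<omega>, \<sigma>). a_fun lam 0 (of_nat n *s z) \<omega> \<sigma> / n) c"
  have "\<alpha>0 lam z = c"
    unfolding lyapunov_site_def
  proof (rule the_equality)
    have ae: "AE \<xi> in M. \<forall>n. a0 lam (of_nat n *s z) \<xi> = a_fun lam 0 (of_nat n *s z) (fst \<xi>) (snd \<xi>)"
      unfolding AE_all_countable by (intro allI AE_a0)
    have m: "(\<lambda>\<xi>. a_fun lam 0 (of_nat n *s z) (fst \<xi>) (snd \<xi>)) \<in> borel_measurable M" for n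
      using a_fun_measurable[OF lam] by (simp add: case_prod_unfold)
    have "AE (\<omega>, \<sigma>) in M. (\<lambda>n. a_fun lam 0 (of_nat n *s z) \<omega> \<sigma> / n) \<longlonglongrightarrow> c"
      using c ae by eventually_elim (simp add: case_prod_unfold)
    moreover have "integrable M (\<lambda>\<xi>. a_fun lam 0 (of_nat n *s z) (fst \<xi>) (snd \<xi>) / n)" for n
      using integrable_cong_AE_imp[OF integrable_a0[OF lam] m AE_a0] by auto
    moreover have "(\<integral>\<xi>. \<bar>a_fun lam 0 (of_nat n *s z) (fst \<xi>) (snd \<xi>) / n - c\<bar> \<partial>M) = (\<integral>\<xi>. \<bar>a0 lam (of_nat n *s z) \<xi> / n - c\<bar> \<partial>M)" for n
      using a0_measurable[OF lam, of "of_nat n *s z"] m[of n] AE_a0[of lam "of_nat n *s z"]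
      by (intro integral_cong_AE) auto
    ultimately show "?P c" using L1 by (simp add: L1_limit_def case_prod_unfold)
    fix c' assume "?P c'"
    then have "AE (\<omega>, \<sigma>) in M. (\<lambda>n. a_fun lam 0 (of_nat n *s z) \<omega> \<sigma> / n) \<longlonglongrightarrow> c'" by simp
    with c ae have "AE \<xi> in M. c' = c"
    proof eventually_elim
      case (elim \<xi>)
      then show ?case using LIMSEQ_unique by (force simp: case_prod_unfold)
    qed
    then show "c' = c" by simp
  qed
  with c L1 show "AE \<xi> in M. (\<lambda>n. a0 lam (of_nat n *s z) \<xi> / n) \<longlonglongrightarrow> \<alpha>0 lam z"
    and "(\<lambda>n. \<integral>\<xi>. \<bar>a0 lam (of_nat n *s z) \<xi> / n - \<alpha>0 lam z\<bar> \<partial>M) \<longlonglongrightarrow> 0" by simp_all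
qed

text \<open>Properties of the exponent are obtained through means rather than through almost sure
  limits, because shifted environments have the same mean.\<close>

lemma lyapunov_site_expectation:
  assumes lam: "0 \<le> lam"
  shows "(\<lambda>n. (\<integral>\<xi>. a0 lam (of_nat n *s z) \<xi> \<partial>M) / n) \<longlonglongrightarrow> \<alpha>0 lam z"
proof (rule LIM_zero_cancel, rule Lim_null_comparison[OF _ lyapunov_site_AE_L1(2)[OF lam, of z]])
  have "norm ((\<integral>\<xi>. a0 lam (of_nat n *s z) \<xi> \<partial>M) / n - \<alpha>0 lam z) \<le> (\<integral>\<xi>. \<bar>a0 lam (of_nat n *s z) \<xi> / n - \<alpha>0 lam z\<bar> \<partial>M)" for n
  proof -
    have "(\<integral>\<xi>. a0 lam (of_nat n *s z) \<xi> \<partial>M) / n - \<alpha>0 lam z = (\<integral>\<xi>. a0 lam (of_nat n *s z) \<xi> / n - \<alpha>0 lam z \<partial>M)"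
      using integrable_a0[OF lam] by (simp add: M.prob_space)
    then show ?thesis using integral_norm_bound[of M "\<lambda>\<xi>. a0 lam (of_nat n *s z) \<xi> / n - \<alpha>0 lam z"] by simp
  qed
  then show "\<forall>\<^sub>F n in sequentially. norm ((\<integral>\<xi>. a0 lam (of_nat n *s z) \<xi> \<partial>M) / n - \<alpha>0 lam z)
      \<le> (\<integral>\<xi>. \<bar>a0 lam (of_nat n *s z) \<xi> / n - \<alpha>0 lam z\<bar> \<partial>M)" by simp
qed

text \<open>The mean cost of one site; it becomes the Lipschitz constant of the exponent with
  respect to the l1-norm.\<close>

definition mean_cost :: "real \<Rightarrow> real" where
  "mean_cost lam = (\<integral>\<xi>. cost0 lam \<xi> \<partial>M)"

lemma mean_cost_nonneg: "0 \<le> lam \<Longrightarrow> 0 \<le> mean_cost lam"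
  unfolding mean_cost_def
  by (intro Bochner_Integration.integral_nonneg) (auto simp: jump_cost_def holding_cost_def)

context
  fixes lam :: real
  assumes lam: "0 \<le> lam"
begin

lemma lyapunov_site_nonneg: "0 \<le> \<alpha>0 lam z"
  by (rule LIMSEQ_le_const[OF lyapunov_site_expectation[OF lam, of z]])
    (auto intro!: Bochner_Integration.integral_nonneg divide_nonneg_nonneg a0_nonneg lam)

lemma lyapunov_site_le: "\<alpha>0 lam z \<le> site_norm z * mean_cost lam"
proof (rule LIMSEQ_le_const2[OF lyapunov_site_expectation[OF lam, of z]], intro exI allI impI)
  fix n :: nat assume n: "1 \<le> n"
  show "(\<integral>\<xi>. a0 lam (of_nat n *s z) \<xi> \<partial>M) / n \<le> site_norm z * mean_cost lam"
    using integral_a0_le[OF lam, of "of_nat n *s z"] n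
    by (simp add: pos_divide_le_eq site_norm_smult mean_cost_def mult_ac)
qed

text \<open>The limit for \<open>k * z\<close> runs along the subsequence of multiples of
  \<open>k\<close> of the limit for \<open>z\<close>.\<close>

lemma lyapunov_site_smult: "\<alpha>0 lam (of_nat k *s z) = k * \<alpha>0 lam z"
proof (cases "k = 0")
  case True
  have "\<alpha>0 lam 0 = 0" using lyapunov_site_le[of 0] lyapunov_site_nonneg[of 0] by (simp add: site_norm_def)
  then show ?thesis using True by simp
next
  case False
  have "strict_mono (\<lambda>n. n * k)" using False by (intro strict_monoI) simp
  from LIMSEQ_subseq_LIMSEQ[OF lyapunov_site_expectation[OF lam, of z] this]
  have "(\<lambda>n. k * ((\<integral>\<xi>. a0 lam (of_nat (n * k) *s z) \<xi> \<partial>M) / (n * k))) \<longlonglongrightarrow> k * \<alpha>0 lam z"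
    by (intro tendsto_mult tendsto_const) (simp add: o_def)
  moreover have "real k * ((\<integral>\<xi>. a0 lam (of_nat (n * k) *s z) \<xi> \<partial>M) / (n * k)) = (\<integral>\<xi>. a0 lam (of_nat n *s (of_nat k *s z)) \<xi> \<partial>M) / n" for n
    using False by (simp add: field_simps vector_smult_assoc)
  ultimately show ?thesis using lyapunov_site_expectation[OF lam, of "of_nat k *s z"] LIMSEQ_unique by simp
qed

text \<open>The second piece of the way to \<open>n * (y + z)\<close> sees the environment shifted
  by \<open>n * y\<close>, which disappears on taking means.\<close>

lemma lyapunov_site_triangle: "\<alpha>0 lam (y + z) \<le> \<alpha>0 lam y + \<alpha>0 lam z"
proof (rule LIMSEQ_le[OF lyapunov_site_expectation[OF lam] tendsto_add[OF lyapunov_site_expectation[OF lam] lyapunov_site_expectation[OF lam]]], intro exI allI impI)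
  fix n :: nat assume "0 \<le> n"
  have i: "integrable M (\<lambda>\<xi>. a0 lam (of_nat n *s z) (env_shift (of_nat n *s y) \<xi>))"
    by (rule preserves_integrable[OF preserves_M integrable_a0[OF lam]])
  have "(\<integral>\<xi>. a0 lam (of_nat n *s (y + z)) \<xi> \<partial>M) \<le> (\<integral>\<xi>. a0 lam (of_nat n *s y) \<xi> + a0 lam (of_nat n *s z) (env_shift (of_nat n *s y) \<xi>) \<partial>M)"
  proof (rule integral_mono_AE)
    show "AE \<xi> in M. a0 lam (of_nat n *s (y + z)) \<xi> \<le> a0 lam (of_nat n *s y) \<xi> + a0 lam (of_nat n *s z) (env_shift (of_nat n *s y) \<xi>)"
      using AE_good by eventually_elim (use a0_triangle[OF lam] in \<open>simp add: vector_add_ldistrib\<close>)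
  qed (use i integrable_a0[OF lam] in auto)
  also have "\<dots> = (\<integral>\<xi>. a0 lam (of_nat n *s y) \<xi> \<partial>M) + (\<integral>\<xi>. a0 lam (of_nat n *s z) \<xi> \<partial>M)"
    using i integrable_a0[OF lam] preserves_integral[OF preserves_M a0_measurable[OF lam]]
    by (subst Bochner_Integration.integral_add) auto
  finally show "(\<integral>\<xi>. a0 lam (of_nat n *s (y + z)) \<xi> \<partial>M) / n \<le> (\<integral>\<xi>. a0 lam (of_nat n *s y) \<xi> \<partial>M) / n + (\<integral>\<xi>. a0 lam (of_nat n *s z) \<xi> \<partial>M) / n"
    by (simp add: divide_right_mono flip: add_divide_distrib)
qed

lemma lyapunov_site_Lipschitz: "\<bar>\<alpha>0 lam y - \<alpha>0 lam z\<bar> \<le> mean_cost lam * site_norm (y - z)"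
proof -
  have *: "\<alpha>0 lam y - \<alpha>0 lam z \<le> mean_cost lam * site_norm (y - z)" for y z
    using lyapunov_site_triangle[of z "y - z"] lyapunov_site_le[of "y - z"] by (simp add: mult.commute)
  have "site_norm (z - y) = site_norm (y - z)"
    by (simp add: site_norm_def abs_minus_commute)
  then show ?thesis using *[of y z] *[of z y] by (simp add: abs_le_iff)
qed

end

text \<open>The McShane extension of the Lipschitz function on \<open>\<rat>\<^sup>d\<close>.\<close>

definition lyap_ext :: "real \<Rightarrow> real ^ 'd \<Rightarrow> real" where
  "lyap_ext lam x = (INF (z, q)\<in>UNIV \<times> {0<..}. \<alpha>0 lam z / real q + mean_cost lam * l1norm (x - of_site z /\<^sub>R real q))"

lemma l1norm_nonneg: "0 \<le> l1norm x"
  by (simp add: l1norm_def sum_nonneg)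

lemma l1norm_triangle: "l1norm (x + y) \<le> l1norm x + l1norm y"
  unfolding l1norm_def by (simp flip: sum.distrib) (intro sum_mono abs_triangle_ineq)

lemma l1norm_minus: "l1norm (x - y) = l1norm (y - x)"
  by (simp add: l1norm_def abs_minus_commute)

lemma l1norm_scaleR: "l1norm (c *\<^sub>R x) = \<bar>c\<bar> * l1norm x"
  by (simp add: l1norm_def abs_mult sum_distrib_left)

lemma l1norm_diff_triangle: "l1norm (x - z) \<le> l1norm (x - y) + l1norm (y - z)"
  using l1norm_triangle[of "x - y" "y - z"] by simp

lemma l1norm_le_norm: "l1norm x \<le> real CARD('d) * norm x" for x :: "real ^ 'd"
  unfolding l1norm_def using sum_bounded_above[of UNIV "\<lambda>i. \<bar>x $ i\<bar>" "norm x"] component_le_norm_cart[of x] by simp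

lemma of_site_diff: "of_site (y - z) = of_site y - of_site z"
  and of_site_smult: "of_site (of_nat n *s z) = real n *\<^sub>R of_site z"
  by (simp_all add: of_site_def vec_eq_iff)

section \<open>The extension of the exponent to real vectors\<close>

context
  fixes lam :: real
  assumes lam: "0 \<le> lam"
begin

lemma lyap_ext_bdd: "bdd_below ((\<lambda>(z, q). \<alpha>0 lam z / real q + mean_cost lam * l1norm (x - of_site z /\<^sub>R real q)) ` (UNIV \<times> {0<..}))"
  by (rule bdd_belowI[of _ 0]) (auto intro!: add_nonneg_nonneg mult_nonneg_nonneg divide_nonneg_nonneg
     lyapunov_site_nonneg lam mean_cost_nonneg l1norm_nonneg)

lemma lyap_ext_le: "0 < q \<Longrightarrow> lyap_ext lam x \<le> \<alpha>0 lam z / real q + mean_cost lam * l1norm (x - of_site z /\<^sub>R real q)"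
  unfolding lyap_ext_def by (rule cINF_lower2[OF lyap_ext_bdd, of "(z, q)"]) auto

lemma lyap_ext_Lipschitz: "\<bar>lyap_ext lam x - lyap_ext lam y\<bar> \<le> mean_cost lam * l1norm (x - y)"
proof -
  have *: "lyap_ext lam x - mean_cost lam * l1norm (x - y) \<le> lyap_ext lam y" for x y
    unfolding lyap_ext_def[of lam y]
  proof (rule cINF_greatest)
    fix zq :: "'d site \<times> nat" assume "zq \<in> UNIV \<times> {0<..}"
    then obtain z q where zq: "zq = (z, q)" "0 < q" by auto
    have "lyap_ext lam x \<le> \<alpha>0 lam z / real q + mean_cost lam * l1norm (x - of_site z /\<^sub>R real q)"
      by (rule lyap_ext_le) fact
    also have "\<dots> \<le> \<alpha>0 lam z / real q + mean_cost lam * (l1norm (x - y) + l1norm (y - of_site z /\<^sub>R real q))"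
      by (intro add_left_mono mult_left_mono l1norm_diff_triangle mean_cost_nonneg lam)
    finally show "lyap_ext lam x - mean_cost lam * l1norm (x - y) \<le> (case zq of (z, q) \<Rightarrow> \<alpha>0 lam z / real q + mean_cost lam * l1norm (y - of_site z /\<^sub>R real q))"
      by (simp add: zq algebra_simps)
  qed auto
  show ?thesis using *[of x y] *[of y x] by (simp add: abs_le_iff l1norm_minus[of y x])
qed

text \<open>The Lipschitz bound at the lattice points \<open>q * w\<close> and \<open>p * z\<close>,
  divided by \<open>p * q\<close>. It shows that no other fraction lowers the infimum, and in
  particular that the value does not depend on how a rational point is written.\<close>

lemma lyap_ext_rational:
  assumes p: "0 < p"
  shows "lyap_ext lam (of_site w /\<^sub>R real p) = \<alpha>0 lam w / real p"
proof (rule antisym)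
  show "lyap_ext lam (of_site w /\<^sub>R real p) \<le> \<alpha>0 lam w / real p"
    using lyap_ext_le[OF p, of "of_site w /\<^sub>R real p" w] by (simp add: l1norm_def)
  show "\<alpha>0 lam w / real p \<le> lyap_ext lam (of_site w /\<^sub>R real p)"
    unfolding lyap_ext_def
  proof (rule cINF_greatest)
    fix zq :: "'d site \<times> nat" assume "zq \<in> UNIV \<times> {0<..}"
    then obtain z q where zq: "zq = (z, q)" "0 < q" by auto
    have "\<alpha>0 lam (of_nat q *s w) - \<alpha>0 lam (of_nat p *s z) \<le> mean_cost lam * site_norm (of_nat q *s w - of_nat p *s z)"
      using lyapunov_site_Lipschitz[OF lam, of "of_nat q *s w" "of_nat p *s z"] by simp
    also have "real (site_norm (of_nat q *s w - of_nat p *s z)) = real p * real q * l1norm (of_site w /\<^sub>R real p - of_site z /\<^sub>R real q)"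
    proof -
      have "of_site (of_nat q *s w - of_nat p *s z) = (real p * real q) *\<^sub>R (of_site w /\<^sub>R real p - of_site z /\<^sub>R real q)"
        using p zq(2) by (simp add: of_site_diff of_site_smult vec_eq_iff field_simps)
      then show ?thesis by (simp add: l1norm_scaleR flip: l1norm_of_site)
    qed
    finally have "q * \<alpha>0 lam w - p * \<alpha>0 lam z \<le> mean_cost lam * (real p * real q * l1norm (of_site w /\<^sub>R real p - of_site z /\<^sub>R real q))"
      by (simp only: lyapunov_site_smult[OF lam])
    then show "\<alpha>0 lam w / real p \<le> (case zq of (z, q) \<Rightarrow> \<alpha>0 lam z / real q + mean_cost lam * l1norm (of_site w /\<^sub>R real p - of_site z /\<^sub>R real q))"
      using p zq(2) unfolding zq(1) by (simp add: field_simps)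
  qed auto
qed

lemma lyap_ext_continuous: "continuous_on UNIV (lyap_ext lam)"
proof -
  define L where "L = mean_cost lam * real CARD('d)"
  have "dist (lyap_ext lam x) (lyap_ext lam y) \<le> L * dist x y" for x y
  proof -
    have "mean_cost lam * l1norm (x - y) \<le> L * norm (x - y)"
      using mult_left_mono[OF l1norm_le_norm mean_cost_nonneg[OF lam], of "x - y"] by (simp add: L_def mult_ac)
    then show ?thesis using lyap_ext_Lipschitz[of x y] by (simp add: dist_norm)
  qed
  moreover have "0 \<le> L" by (simp add: L_def mean_cost_nonneg[OF lam])
  ultimately have "L-lipschitz_on UNIV (lyap_ext lam)" by (intro lipschitz_onI)
  then show ?thesis by (rule lipschitz_on_continuous_on)
qed

end

text \<open>Rounding \<open>(n + 1) * x\<close> down in each coordinate and dividing by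
  \<open>n + 1\<close> gives an error of at most \<open>1 / (n + 1)\<close>.\<close>

lemma rational_sites_dense: "closure {of_site z /\<^sub>R real q | z q. 0 < q} = (UNIV :: (real ^ 'd) set)"
proof -
  have "x \<in> closure {of_site z /\<^sub>R real q | z q. 0 < q}" for x :: "real ^ 'd"
  proof -
    define y where "y n = of_site (\<chi> i. \<lfloor>real (Suc n) * x $ i\<rfloor>) /\<^sub>R real (Suc n)" for n
    have "y \<longlonglongrightarrow> x"
    proof (rule vec_tendstoI)
      fix i
      have b: "\<bar>y n $ i - x $ i\<bar> \<le> 1 / real (Suc n)" for n
      proof -
        have "\<bar>of_int \<lfloor>real (Suc n) * x $ i\<rfloor> - real (Suc n) * x $ i\<bar> \<le> 1" by linarith
        then have "\<bar>of_int \<lfloor>real (Suc n) * x $ i\<rfloor> - real (Suc n) * x $ i\<bar> / real (Suc n) \<le> 1 / real (Suc n)"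
          by (rule divide_right_mono) simp
        moreover have "y n $ i - x $ i = (of_int \<lfloor>real (Suc n) * x $ i\<rfloor> - real (Suc n) * x $ i) / real (Suc n)"
          by (simp add: y_def of_site_def field_simps)
        ultimately show ?thesis by (simp add: abs_divide)
      qed
      have "(\<lambda>n. 1 / real (Suc n)) \<longlonglongrightarrow> 0" using LIMSEQ_Suc[OF lim_1_over_n] by simp
      then show "(\<lambda>n. y n $ i) \<longlonglongrightarrow> x $ i"
        by (rule LIM_zero_cancel[OF Lim_null_comparison[rotated]])
          (intro always_eventually allI, unfold real_norm_def, rule b)
    qed
    moreover have "y n \<in> {of_site z /\<^sub>R real q | z q. 0 < q}" for n unfolding y_def by blast
    ultimately show ?thesis unfolding closure_sequential by blast
  qed
  then show ?thesis by auto
qed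

text \<open>A continuous function is determined by its values on the dense set of rational points,
  where the description prescribes them.\<close>

lemma lyapunov_eq_ext:
  assumes lam: "0 \<le> lam"
  shows "lyapunov \<mu> \<nu> lam = lyap_ext lam"
  unfolding lyapunov_def
proof (rule the_equality)
  show "continuous_on UNIV (lyap_ext lam) \<and> (\<forall>x. \<forall>q::nat. 0 < real q \<longrightarrow> lyap_ext lam (of_site x /\<^sub>R real q) = \<alpha>0 lam x / real q)"
    using lyap_ext_continuous[OF lam] lyap_ext_rational[OF lam] by auto
  fix \<alpha> :: "real ^ 'd \<Rightarrow> real"
  assume \<alpha>: "continuous_on UNIV \<alpha> \<and> (\<forall>x. \<forall>q::nat. 0 < real q \<longrightarrow> \<alpha> (of_site x /\<^sub>R real q) = \<alpha>0 lam x / real q)"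
  show "\<alpha> = lyap_ext lam"
  proof (rule ext)
    fix x
    have "\<alpha> x - lyap_ext lam x = 0"
    proof (rule continuous_constant_on_closure[where S="{of_site z /\<^sub>R real q | z q. 0 < q}" and f="\<lambda>x. \<alpha> x - lyap_ext lam x"])
      show "continuous_on (closure {of_site z /\<^sub>R real q | z q. 0 < q}) (\<lambda>x. \<alpha> x - lyap_ext lam x)"
        unfolding rational_sites_dense using \<alpha> lyap_ext_continuous[OF lam] by (intro continuous_on_diff) auto
      show "x \<in> closure {of_site z /\<^sub>R real q | z q. 0 < q}" unfolding rational_sites_dense by simp
    qed (use \<alpha> lyap_ext_rational[OF lam] in auto)
    then show "\<alpha> x = lyap_ext lam x" by simp
  qed
qed

lemma lyapunov_Lipschitz: "0 \<le> lam \<Longrightarrow> \<bar>lyapunov \<mu> \<nu> lam x - lyapunov \<mu> \<nu> lam y\<bar> \<le> mean_cost lam * l1norm (x - y)"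
  by (simp add: lyapunov_eq_ext lyap_ext_Lipschitz)

lemma lyapunov_of_site: "0 \<le> lam \<Longrightarrow> lyapunov \<mu> \<nu> lam (of_site z) = \<alpha>0 lam z"
  using lyap_ext_rational[of lam 1 z] by (simp add: lyapunov_eq_ext)

end

section \<open>Sums of i.i.d. costs along short segments\<close>

lemma card_vec_box_le:
  assumes "finite A"
  shows "card {v :: 'a ^ 'n::finite. \<forall>i. v $ i \<in> A} \<le> card A ^ CARD('n)"
proof -
  have "card {v :: 'a ^ 'n. \<forall>i. v $ i \<in> A} \<le> card (vec_lambda ` (\<Pi>\<^sub>E i\<in>(UNIV::'n set). A))"
    by (intro card_mono vec_box_subset finite_imageI finite_PiE assms) auto
  also have "\<dots> \<le> card (\<Pi>\<^sub>E i\<in>(UNIV::'n set). A)" by (intro card_image_le finite_PiE assms) auto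
  also have "\<dots> = card A ^ CARD('n)" by (simp add: card_PiE)
  finally show ?thesis .
qed

definition site_box :: "nat \<Rightarrow> ('d::finite) site set" where
  "site_box n = {z. \<forall>i. \<bar>z $ i\<bar> \<le> int n}"

lemma site_box_eq: "site_box n = {z. \<forall>i. z $ i \<in> {- int n..int n}}"
  by (auto simp: site_box_def abs_le_iff) (smt (verit))+

lemma finite_site_box: "finite (site_box n)"
  unfolding site_box_eq by (rule finite_vec_box) simp

lemma card_site_box_le: "card (site_box n :: ('d::finite) site set) \<le> (2 * n + 1) ^ CARD('d)"
proof -
  have "card {- int n..int n} = 2 * n + 1" by simp
  then show ?thesis unfolding site_box_eq using card_vec_box_le[of "{- int n..int n}", where 'n='d] by (simp only: finite_atLeastAtMost_int simp_thms)
qed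

lemma power_sum_le: "(a + b) ^ n \<le> 2 ^ n * (a ^ n + b ^ n)" if "0 \<le> a" "0 \<le> (b::real)"
proof -
  have "(a + b) ^ n \<le> (2 * max a b) ^ n" using that by (intro power_mono) auto
  also have "\<dots> = 2 ^ n * max a b ^ n" by (simp add: power_mult_distrib)
  also have "\<dots> \<le> 2 ^ n * (a ^ n + b ^ n)" using that by (intro mult_left_mono) (auto simp: max_def)
  finally show ?thesis .
qed

text \<open>The bound \<open>1 - u \<le> exp (- u)\<close> gives
  \<open>exp u \<le> 1 + u * exp u\<close>, which is then inserted into itself. It needs a second
  moment only, as the exponential on the right will be bounded by truncation.\<close>

lemma exp_le_quadratic:
  fixes u :: real
  assumes "0 \<le> u"
  shows "exp u \<le> 1 + u + u\<^sup>2 * exp u"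
proof -
  have "1 - u \<le> exp (- u)" using exp_ge_add_one_self[of "-u"] by simp
  then have "(1 - u) * exp u \<le> exp (- u) * exp u" by (rule mult_right_mono) simp
  then have 1: "exp u \<le> 1 + u * exp u" by (simp add: algebra_simps flip: exp_add)
  then have "u * exp u \<le> u * (1 + u * exp u)" using assms by (rule mult_left_mono)
  with 1 show ?thesis by (simp add: power2_eq_square algebra_simps)
qed

text \<open>The jump part and the holding part of the site cost satisfy the same hypotheses, so the
  estimates are made once for a cost \<open>h\<close> of a single site. The parameter
  \<open>dim\<close> carries the dimension.\<close>

locale iid_cost =
  fixes \<kappa> :: "'a measure" and h :: "'a \<Rightarrow> real" and dim :: "('d::finite) itself"
  assumes \<kappa>: "prob_space \<kappa>" and h_measurable: "h \<in> borel_measurable \<kappa>" and h_nonneg: "\<And>s. 0 \<le> h s"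
    and h_moment: "integrable \<kappa> (\<lambda>s. h s ^ CARD('d))"
begin

sublocale \<kappa>: prob_space \<kappa> by (rule \<kappa>)

abbreviation X :: "('d site \<Rightarrow> 'a) measure" where "X \<equiv> iid_field \<kappa>"

sublocale X: prob_space X by (rule prob_space_iid_field[OF \<kappa>])

lemma coord_measurable: "(\<lambda>\<omega>. \<omega> z) \<in> X \<rightarrow>\<^sub>M \<kappa>"
  unfolding iid_field_def by (rule measurable_component_singleton) simp

lemma coord_distr: "distr X \<kappa> (\<lambda>\<omega>. \<omega> z) = \<kappa>"
  unfolding iid_field_def by (rule distr_PiM_component) (auto simp: \<kappa>)

lemma h_coord_measurable [measurable]: "(\<lambda>\<omega>. h (\<omega> z)) \<in> borel_measurable X"
  by (rule measurable_compose[OF coord_measurable h_measurable])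

lemma integrable_h_power:
  assumes "m \<le> CARD('d)"
  shows "integrable \<kappa> (\<lambda>s. h s ^ m)"
proof (rule Bochner_Integration.integrable_bound[of _ "\<lambda>s. 1 + h s ^ CARD('d)"])
  have "h s ^ m \<le> 1 + h s ^ CARD('d)" for s
  proof (cases "h s \<le> 1")
    case True
    then have "h s ^ m \<le> 1" using h_nonneg by (intro power_le_one)
    then show ?thesis using zero_le_power[OF h_nonneg[of s], of "CARD('d)"] by linarith
  next
    case False
    then have "h s ^ m \<le> h s ^ CARD('d)" using assms by (intro power_increasing) auto
    then show ?thesis by simp
  qed
  then show "AE s in \<kappa>. norm (h s ^ m) \<le> norm (1 + h s ^ CARD('d))"
    using h_nonneg by (intro AE_I2) (auto simp: add_nonneg_nonneg)
qed (use h_moment h_measurable in auto)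

text \<open>The expected number of these sites is finite: by Tonelli's theorem it is the mean number
  of lattice points in a box whose side is proportional to \<open>h\<close>, hence of order
  \<open>h ^ CARD('d)\<close>. This is where the moment of order d is used.\<close>

lemma few_large_values:
  assumes \<delta>: "0 < \<delta>"
  shows "AE \<omega> in X. finite {z. \<forall>i. \<delta> * \<bar>real_of_int (z $ i)\<bar> < h (\<omega> z)}"
proof -
  define E where "E t = {z :: 'd site. \<forall>i. \<delta> * \<bar>real_of_int (z $ i)\<bar> < t}" for t
  have E: "finite (E t)" "real (card (E t)) \<le> 2 ^ CARD('d) * ((2 * t / \<delta>) ^ CARD('d) + 1)" if t: "0 \<le> t" for t
  proof -
    define m where "m = nat \<lfloor>t / \<delta>\<rfloor>"
    have sub: "E t \<subseteq> site_box m"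
    proof
      fix z assume z: "z \<in> E t"
      show "z \<in> site_box m"
        unfolding site_box_def
      proof safe
        fix i
        have "\<bar>real_of_int (z $ i)\<bar> < t / \<delta>" using z \<delta> by (simp add: E_def pos_less_divide_eq mult.commute)
        then have "real_of_int \<bar>z $ i\<bar> \<le> t / \<delta>" by simp
        then have "\<bar>z $ i\<bar> \<le> \<lfloor>t / \<delta>\<rfloor>" by (simp add: le_floor_iff)
        moreover have "0 \<le> \<lfloor>t / \<delta>\<rfloor>" using t \<delta> by simp
        ultimately show "\<bar>z $ i\<bar> \<le> int m" by (simp add: m_def)
      qed
    qed
    then show "finite (E t)" using finite_site_box finite_subset by blast
    have "card (E t) \<le> card (site_box m :: 'd site set)" by (rule card_mono[OF finite_site_box sub])
    then have "real (card (E t)) \<le> real ((2 * m + 1) ^ CARD('d))"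
      using card_site_box_le[of m, where 'd='d] by (intro of_nat_mono) simp
    also have "\<dots> = (2 * real m + 1) ^ CARD('d)" by (simp add: add.commute)
    also have "\<dots> \<le> (2 * t / \<delta> + 1) ^ CARD('d)"
    proof (rule power_mono)
      have "real m \<le> t / \<delta>" unfolding m_def using t \<delta> by (intro of_nat_floor) simp
      then show "2 * real m + 1 \<le> 2 * t / \<delta> + 1" by simp
    qed simp
    also have "\<dots> \<le> 2 ^ CARD('d) * ((2 * t / \<delta>) ^ CARD('d) + 1 ^ CARD('d))"
      using t \<delta> by (intro power_sum_le) auto
    finally show "real (card (E t)) \<le> 2 ^ CARD('d) * ((2 * t / \<delta>) ^ CARD('d) + 1)" by simp
  qed
  have Em: "(\<lambda>s. indicator (E (h s)) z :: ennreal) \<in> borel_measurable \<kappa>" for z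
  proof -
    have "(\<lambda>s. indicator (E (h s)) z :: ennreal) = (\<lambda>s. indicator {s. \<forall>i. \<delta> * \<bar>real_of_int (z $ i)\<bar> < h s} s)"
      by (auto simp: E_def indicator_def)
    moreover have "Measurable.pred \<kappa> (\<lambda>s. \<forall>i. \<delta> * \<bar>real_of_int (z $ i)\<bar> < h s)"
    proof -
      have "Measurable.pred \<kappa> (\<lambda>s. c < h s)" for c using h_measurable by measurable
      then show ?thesis by (intro pred_intros_countable)
    qed
    ultimately show ?thesis by (simp add: indicator_def)
  qed
  have "(\<integral>\<^sup>+\<omega>. emeasure (count_space UNIV) {z. z \<in> E (h (\<omega> z))} \<partial>X) = (\<integral>\<^sup>+\<omega>. \<integral>\<^sup>+z. indicator (E (h (\<omega> z))) z \<partial>count_space UNIV \<partial>X)"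
  proof (rule nn_integral_cong)
    fix \<omega>
    have "(\<integral>\<^sup>+z. indicator (E (h (\<omega> z))) z \<partial>count_space UNIV) = (\<integral>\<^sup>+z. indicator {z. z \<in> E (h (\<omega> z))} z \<partial>count_space UNIV)"
      by (intro nn_integral_cong) (simp add: indicator_def)
    then show "emeasure (count_space UNIV) {z. z \<in> E (h (\<omega> z))} = (\<integral>\<^sup>+z. indicator (E (h (\<omega> z))) z \<partial>count_space UNIV)"
      by simp
  qed
  \<comment> \<open>Each site has law \<kappa>, so after exchanging sum and mean a single value
    \<open>s\<close> can stand for all sites, and a second exchange counts the sites for fixed
    \<open>s\<close>.\<close>
  also have "\<dots> = (\<integral>\<^sup>+z. \<integral>\<^sup>+\<omega>. indicator (E (h (\<omega> z))) z \<partial>X \<partial>count_space UNIV)"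
    by (rule nn_integral_count_space_nn_integral) (auto intro!: measurable_compose[OF coord_measurable Em])
  also have "\<dots> = (\<integral>\<^sup>+z. \<integral>\<^sup>+s. indicator (E (h s)) z \<partial>\<kappa> \<partial>count_space UNIV)"
  proof (rule nn_integral_cong)
    fix z
    have "(\<integral>\<^sup>+s. indicator (E (h s)) z \<partial>distr X \<kappa> (\<lambda>\<omega>. \<omega> z)) = (\<integral>\<^sup>+\<omega>. indicator (E (h (\<omega> z))) z \<partial>X)"
      by (rule nn_integral_distr[OF coord_measurable]) (simp add: Em)
    then show "(\<integral>\<^sup>+\<omega>. indicator (E (h (\<omega> z))) z \<partial>X) = (\<integral>\<^sup>+s. indicator (E (h s)) z \<partial>\<kappa>)"
      by (simp add: coord_distr)
  qed
  also have "\<dots> = (\<integral>\<^sup>+s. \<integral>\<^sup>+z. indicator (E (h s)) z \<partial>count_space UNIV \<partial>\<kappa>)"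
    by (rule nn_integral_count_space_nn_integral[symmetric]) (auto intro!: Em)
  also have "\<dots> \<le> (\<integral>\<^sup>+s. ennreal (2 ^ CARD('d) * ((2 * h s / \<delta>) ^ CARD('d) + 1)) \<partial>\<kappa>)"
  proof (rule nn_integral_mono)
    fix s
    have "(\<integral>\<^sup>+z. indicator (E (h s)) z \<partial>count_space UNIV) = of_nat (card (E (h s)))"
      using E(1)[OF h_nonneg] by (simp add: emeasure_count_space)
    also have "\<dots> = ennreal (real (card (E (h s))))" by (simp add: ennreal_of_nat_eq_real_of_nat)
    also have "\<dots> \<le> ennreal (2 ^ CARD('d) * ((2 * h s / \<delta>) ^ CARD('d) + 1))"
      by (intro ennreal_leI E(2) h_nonneg)
    finally show "(\<integral>\<^sup>+z. indicator (E (h s)) z \<partial>count_space UNIV) \<le> ennreal (2 ^ CARD('d) * ((2 * h s / \<delta>) ^ CARD('d) + 1))" .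
  qed
  also have "\<dots> < \<infinity>"
  proof -
    have "integrable \<kappa> (\<lambda>s. 2 ^ CARD('d) * ((2 * h s / \<delta>) ^ CARD('d) + 1))"
      using h_moment by (simp add: power_mult_distrib power_divide)
    then show ?thesis
      by (subst nn_integral_eq_integral) (use h_nonneg \<delta> in \<open>auto intro!: AE_I2 mult_nonneg_nonneg add_nonneg_nonneg zero_le_power divide_nonneg_nonneg\<close>)
  qed
  finally have fin: "(\<integral>\<^sup>+\<omega>. emeasure (count_space UNIV) {z. z \<in> E (h (\<omega> z))} \<partial>X) \<noteq> \<infinity>" by simp
  have meas: "(\<lambda>\<omega>. emeasure (count_space UNIV) {z. z \<in> E (h (\<omega> z))}) \<in> borel_measurable X"
  proof -
    have "(\<lambda>\<omega>. \<integral>\<^sup>+z. indicator (E (h (\<omega> z))) z \<partial>count_space UNIV) \<in> borel_measurable X"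
    proof (rule sigma_finite_measure.borel_measurable_nn_integral[OF sigma_finite_measure_count_space])
      show "(\<lambda>(\<omega>, z). indicator (E (h (\<omega> z))) z :: ennreal) \<in> borel_measurable (X \<Otimes>\<^sub>M count_space UNIV)"
        unfolding case_prod_unfold
        by (rule measurable_compose_countable[where f="\<lambda>z p. indicator (E (h (fst p z))) z" and g=snd],
            rule measurable_compose[OF measurable_fst measurable_compose[OF coord_measurable Em]], rule measurable_snd)
    qed
    moreover have "(\<integral>\<^sup>+z. indicator (E (h (\<omega> z))) z \<partial>count_space UNIV) = emeasure (count_space UNIV) {z. z \<in> E (h (\<omega> z))}" for \<omega>
    proof -
      have "(\<integral>\<^sup>+z. indicator (E (h (\<omega> z))) z \<partial>count_space UNIV) = (\<integral>\<^sup>+z. indicator {z. z \<in> E (h (\<omega> z))} z \<partial>count_space UNIV)"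
        by (intro nn_integral_cong) (simp add: indicator_def)
      then show ?thesis by simp
    qed
    ultimately show ?thesis by simp
  qed
  from nn_integral_PInf_AE[OF meas fin] show ?thesis
    by eventually_elim (auto simp: E_def emeasure_count_space split: if_splits)
qed

text \<open>Outside a finite set of sites the bound holds through the maximal coordinate; the
  finitely many exceptional values are overtaken by \<open>\<delta> * n\<close>.\<close>

lemma site_values_sublinear:
  fixes \<delta> :: real
  assumes \<delta>: "0 < \<delta>"
  shows "AE \<omega> in X. \<forall>\<^sub>F n in sequentially. \<forall>z\<in>site_box n. h (\<omega> z) \<le> \<delta> * n"
  using few_large_values[OF \<delta>]
proof eventually_elim
  case (elim \<omega>)
  define F where "F = {z. \<forall>i. \<delta> * \<bar>real_of_int (z $ i)\<bar> < h (\<omega> z)}"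
  have F: "finite F" using elim by (simp add: F_def)
  define N where "N = nat \<lceil>(\<Sum>z\<in>F. h (\<omega> z)) / \<delta>\<rceil>"
  show ?case
    unfolding eventually_sequentially
  proof (intro exI[of _ N] allI impI ballI)
    fix n and z :: "'d site" assume n: "N \<le> n" and z: "z \<in> site_box n"
    show "h (\<omega> z) \<le> \<delta> * n"
    proof (cases "z \<in> F")
      case True
      have "h (\<omega> z) \<le> (\<Sum>z\<in>F. h (\<omega> z))" by (rule member_le_sum[OF True _ F]) (rule h_nonneg)
      also have "(\<Sum>z\<in>F. h (\<omega> z)) / \<delta> \<le> N" unfolding N_def by (rule real_nat_ceiling_ge)
      then have "(\<Sum>z\<in>F. h (\<omega> z)) \<le> \<delta> * N" using \<delta> by (simp add: pos_divide_le_eq mult.commute)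
      also have "\<dots> \<le> \<delta> * n" using n \<delta> by simp
      finally show ?thesis .
    next
      case False
      then obtain i where "h (\<omega> z) \<le> \<delta> * \<bar>real_of_int (z $ i)\<bar>" by (auto simp: F_def not_less)
      also have "\<bar>real_of_int (z $ i)\<bar> \<le> n" using z by (simp add: site_box_def flip: of_int_abs) (metis of_int_le_iff of_int_of_nat_eq)
      then have "\<delta> * \<bar>real_of_int (z $ i)\<bar> \<le> \<delta> * n" using \<delta> by simp
      finally show ?thesis .
    qed
  qed
qed

definition segment :: "'d site \<Rightarrow> 'd \<Rightarrow> nat \<Rightarrow> 'd site" where
  "segment z i j = z + of_nat j *s axis i 1"

lemma segment_inj: "inj (segment z i)"
  by (rule injI) (auto simp: segment_def vec_eq_iff axis_def split: if_splits)

text \<open>One threshold for \<open>n\<close> serves all starting points, directions and lengths.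
  Only the starting point is confined to the box.\<close>

definition short_segments :: "('d site \<Rightarrow> 'a) \<Rightarrow> real \<Rightarrow> real \<Rightarrow> bool" where
  "short_segments \<omega> \<epsilon> \<eta> \<longleftrightarrow> (\<forall>\<^sub>F n in sequentially. \<forall>z\<in>site_box n. \<forall>i. \<forall>k. real k \<le> \<epsilon> * n \<longrightarrow>
     (\<Sum>j<k. h (\<omega> (segment z i j))) \<le> \<eta> * n)"


text \<open>Markov's inequality for the exponential of the truncated sum. The sites of a segment are
  distinct, so the exponential moment is a power of that of one site, which
  \<open>exp_le_quadratic\<close> bounds by the first two moments. The second one is at hand since d
  is at least \<open>2\<close>.\<close>

lemma segment_sum_tail:
  fixes n k :: nat and \<theta> \<delta> s :: real
  assumes "0 \<le> \<theta>" "0 \<le> \<delta>" and d: "2 \<le> CARD('d)"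
  shows "measure X {\<omega>\<in>space X. s \<le> (\<Sum>j<k. min (h (\<omega> (segment z i j))) \<delta>)}
    \<le> exp (k * (\<theta> * (\<integral>s. h s \<partial>\<kappa>) + \<theta>\<^sup>2 * (\<integral>s. (h s)\<^sup>2 \<partial>\<kappa>) * exp (\<theta> * \<delta>)) - \<theta> * s)"
proof -
  define g where "g t = exp (\<theta> * min (h t) \<delta>)" for t
  define V where "V = (segment z i) ` {..<k}"
  have V: "finite V" "card V = k" by (auto simp: V_def card_image segment_inj[THEN inj_on_subset])
  have i1: "integrable \<kappa> h" using integrable_h_power[of 1] by simp
  have i2: "integrable \<kappa> (\<lambda>s. (h s)\<^sup>2)" using integrable_h_power[OF d] .
  have ig: "integrable \<kappa> g"
    unfolding g_def using assms h_nonneg h_measurable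
    by (intro \<kappa>.integrable_const_bound[where B="exp (\<theta> * \<delta>)"]) (auto intro!: mult_left_mono)
  have g0: "0 \<le> (\<integral>t. g t \<partial>\<kappa>)" unfolding g_def by (intro Bochner_Integration.integral_nonneg) auto
  have "(\<integral>t. g t \<partial>\<kappa>) \<le> (\<integral>t. 1 + \<theta> * h t + \<theta>\<^sup>2 * (h t)\<^sup>2 * exp (\<theta> * \<delta>) \<partial>\<kappa>)"
  proof (rule integral_mono[OF ig])
    fix t
    define y where "y = min (h t) \<delta>"
    have y: "0 \<le> y" "y \<le> h t" "y \<le> \<delta>" using h_nonneg assms by (auto simp: y_def)
    have "exp (\<theta> * y) \<le> 1 + \<theta> * y + (\<theta> * y)\<^sup>2 * exp (\<theta> * y)"
      using assms y by (intro exp_le_quadratic) auto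
    also have "\<dots> \<le> 1 + \<theta> * h t + (\<theta> * h t)\<^sup>2 * exp (\<theta> * \<delta>)"
      using assms y by (intro add_mono mult_mono power_mono mult_left_mono iffD2[OF exp_le_cancel_iff]) auto
    finally show "g t \<le> 1 + \<theta> * h t + \<theta>\<^sup>2 * (h t)\<^sup>2 * exp (\<theta> * \<delta>)"
      by (simp add: g_def y_def power_mult_distrib)
  qed (use i1 i2 in auto)
  also have "\<dots> = 1 + (\<theta> * (\<integral>s. h s \<partial>\<kappa>) + \<theta>\<^sup>2 * (\<integral>s. (h s)\<^sup>2 \<partial>\<kappa>) * exp (\<theta> * \<delta>))"
    using i1 i2 by (simp add: \<kappa>.prob_space)
  also have "\<dots> \<le> exp (\<theta> * (\<integral>s. h s \<partial>\<kappa>) + \<theta>\<^sup>2 * (\<integral>s. (h s)\<^sup>2 \<partial>\<kappa>) * exp (\<theta> * \<delta>))"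
    by (rule exp_ge_add_one_self)
  finally have "(\<integral>t. g t \<partial>\<kappa>) ^ k \<le> exp (\<theta> * (\<integral>s. h s \<partial>\<kappa>) + \<theta>\<^sup>2 * (\<integral>s. (h s)\<^sup>2 \<partial>\<kappa>) * exp (\<theta> * \<delta>)) ^ k"
    using g0 by (rule power_mono)
  also have "\<dots> = exp (k * (\<theta> * (\<integral>s. h s \<partial>\<kappa>) + \<theta>\<^sup>2 * (\<integral>s. (h s)\<^sup>2 \<partial>\<kappa>) * exp (\<theta> * \<delta>)))"
    by (simp flip: exp_of_nat_mult)
  finally have mgf: "(\<integral>t. g t \<partial>\<kappa>) ^ k \<le> exp (k * (\<theta> * (\<integral>s. h s \<partial>\<kappa>) + \<theta>\<^sup>2 * (\<integral>s. (h s)\<^sup>2 \<partial>\<kappa>) * exp (\<theta> * \<delta>)))" .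
  define S where "S \<omega> = (\<Sum>j<k. min (h (\<omega> (segment z i j))) \<delta>)" for \<omega>
  have eS: "exp (\<theta> * S \<omega>) = (\<Prod>v\<in>V. g (\<omega> v))" for \<omega>
    unfolding S_def V_def g_def
    by (subst prod.reindex) (auto simp: segment_inj[THEN inj_on_subset] sum_distrib_left exp_sum)
  have iS: "integrable X (\<lambda>\<omega>. exp (\<theta> * S \<omega>))" "(\<integral>\<omega>. exp (\<theta> * S \<omega>) \<partial>X) = (\<integral>t. g t \<partial>\<kappa>) ^ k"
    unfolding eS iid_field_def
    using integrable_PiM_prod[of "\<lambda>_. \<kappa>" V "\<lambda>_. g"] integral_PiM_prod[of "\<lambda>_. \<kappa>" V "\<lambda>_. g"] V ig \<kappa>
    by simp_all
  have "measure X {\<omega>\<in>space X. s \<le> S \<omega>} \<le> measure X {\<omega>\<in>space X. exp (\<theta> * s) \<le> exp (\<theta> * S \<omega>)}"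
    unfolding S_def using assms by (intro X.finite_measure_mono) (auto intro!: mult_left_mono)
  also have "\<dots> \<le> (\<integral>\<omega>. exp (\<theta> * S \<omega>) \<partial>X) / exp (\<theta> * s)"
    by (rule integral_Markov_inequality_measure[OF iS(1) sets.empty_sets]) auto
  also have "\<dots> \<le> exp (k * (\<theta> * (\<integral>s. h s \<partial>\<kappa>) + \<theta>\<^sup>2 * (\<integral>s. (h s)\<^sup>2 \<partial>\<kappa>) * exp (\<theta> * \<delta>))) / exp (\<theta> * s)"
    unfolding iS using mgf by (rule divide_right_mono) simp
  finally show ?thesis unfolding S_def by (simp add: exp_diff)
qed

text \<open>The exponential inequality is used with \<theta> = \<open>B * ln n / n\<close> and
  truncation at \<open>\<delta> * n\<close>, followed by a union bound over the box and the
  Borel-Cantelli lemma.\<close>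

lemma short_segments_multidim:
  assumes d: "2 \<le> CARD('d)" and \<eta>: "0 < \<eta>"
  shows "\<exists>\<epsilon>>0. AE \<omega> in X. short_segments \<omega> \<epsilon> \<eta>"
proof -
  define m1 where "m1 = (\<integral>s. h s \<partial>\<kappa>)"
  define m2 where "m2 = (\<integral>s. (h s)\<^sup>2 \<partial>\<kappa>)"
  have m: "0 \<le> m1" "0 \<le> m2" unfolding m1_def m2_def by (auto intro!: Bochner_Integration.integral_nonneg h_nonneg)
  \<comment> \<open>Chosen so that \<open>\<theta> * (\<eta> * n) = (d + 3) * ln n\<close>: one
    power of \<open>n\<close> is lost to the mean, \<open>d\<close> to the number of starting
    points, and two remain for summability.\<close>
  define B where "B = (CARD('d) + 3) / \<eta>"
  have B: "0 < B" using \<eta> by (simp add: B_def add_pos_pos)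
  \<comment> \<open>For at most \<open>\<epsilon> * n\<close> sites the moment term in the exponent
    is then at most \<open>ln n\<close>. The factor \<open>2\<close> comes from
    \<open>ln n \<le> 2 * sqrt n\<close>.\<close>
  define \<epsilon> where "\<epsilon> = 1 / (B * (m1 + 2 * B * m2) + 1)"
  have "0 \<le> B * (m1 + 2 * B * m2)" using B m by simp
  then have \<epsilon>: "0 < \<epsilon>" "\<epsilon> * (B * (m1 + 2 * B * m2)) \<le> 1" by (auto simp: \<epsilon>_def field_simps)
  \<comment> \<open>With this level \<open>exp (\<theta> * (\<delta> * n)) = sqrt n\<close>, so the
    quadratic term stays of the order of the linear one.\<close>
  define \<delta> where "\<delta> = 1 / (2 * B)"
  have \<delta>: "0 < \<delta>" using B by (simp add: \<delta>_def)
  define kn where "kn n = nat \<lfloor>\<epsilon> * real n\<rfloor>" for n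
  define A where "A n z i = {\<omega>\<in>space X. \<eta> * n \<le> (\<Sum>j<kn n. min (h (\<omega> (segment z i j))) (\<delta> * n))}" for n :: nat and z i
  have Am: "A n z i \<in> sets X" for n z i unfolding A_def by measurable
  define C where "C = 3 ^ CARD('d) * real CARD('d)"
  have tail: "measure X (\<Union>(z, i)\<in>site_box n \<times> UNIV. A n z i) \<le> C * (1 / real n ^ 2)" if n: "1 \<le> n" for n
  proof -
    define \<theta> where "\<theta> = B * ln n / n"
    have ln0: "0 \<le> ln (real n)" using n by simp
    have \<theta>: "0 \<le> \<theta>" using B n ln0 by (simp add: \<theta>_def)
    have \<theta>\<delta>: "exp (\<theta> * (\<delta> * n)) = sqrt n"
    proof -
      have "\<theta> * (\<delta> * n) = ln n / 2" using n B by (simp add: \<theta>_def \<delta>_def)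
      also have "\<dots> = ln (sqrt n)" using n by (simp add: ln_sqrt)
      finally show ?thesis using n by simp
    qed
    have "ln (sqrt n) \<le> sqrt n - 1" using n by (intro ln_le_minus_one) simp
    then have lnsq: "ln n \<le> 2 * sqrt n" using n by (simp add: ln_sqrt)
    have kn: "real (kn n) \<le> \<epsilon> * n" unfolding kn_def using \<epsilon> by (simp add: of_nat_floor)
    have one: "measure X (A n z i) \<le> 1 / real n ^ (CARD('d) + 2)" for z i
    proof -
      have "measure X (A n z i) \<le> exp (kn n * (\<theta> * m1 + \<theta>\<^sup>2 * m2 * sqrt n) - \<theta> * (\<eta> * n))"
        using segment_sum_tail[of \<theta> "\<delta> * n" "\<eta> * n" z i "kn n"] \<theta> \<delta> d unfolding A_def m1_def m2_def \<theta>\<delta> by simp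
      also have "\<dots> \<le> exp (ln n - (CARD('d) + 3) * ln n)"
      proof -
        have "\<theta>\<^sup>2 * sqrt n * n = \<theta> * B * (ln n * sqrt n)"
          using n by (simp add: \<theta>_def power2_eq_square)
        also have "\<dots> \<le> \<theta> * B * (2 * sqrt n * sqrt n)"
          using \<theta> B lnsq by (intro mult_left_mono mult_right_mono) auto
        also have "\<dots> = 2 * B * (\<theta> * n)" by simp
        finally have q: "\<theta>\<^sup>2 * sqrt n * n \<le> 2 * B * (\<theta> * n)" .
        have "kn n * (\<theta> * m1 + \<theta>\<^sup>2 * m2 * sqrt n) \<le> (\<epsilon> * n) * (\<theta> * m1 + \<theta>\<^sup>2 * m2 * sqrt n)"
          using kn \<theta> m by (intro mult_right_mono) auto
        also have "\<dots> = \<epsilon> * ((\<theta> * n) * m1 + m2 * (\<theta>\<^sup>2 * sqrt n * n))" by (simp add: algebra_simps)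
        also have "\<dots> \<le> \<epsilon> * ((\<theta> * n) * m1 + m2 * (2 * B * (\<theta> * n)))"
          using \<epsilon> m q by (intro mult_left_mono add_left_mono) auto
        also have "\<theta> * n = B * ln n" using n by (simp add: \<theta>_def)
        also have "\<epsilon> * (B * ln n * m1 + m2 * (2 * B * (B * ln n))) = (\<epsilon> * (B * (m1 + 2 * B * m2))) * ln n"
          by (simp add: algebra_simps)
        also have "\<dots> \<le> 1 * ln n" using \<epsilon> ln0 by (intro mult_right_mono)
        finally have "kn n * (\<theta> * m1 + \<theta>\<^sup>2 * m2 * sqrt n) \<le> ln n" by simp
        moreover have "\<theta> * (\<eta> * n) = (CARD('d) + 3) * ln n" using n \<eta> by (simp add: \<theta>_def B_def)
        ultimately show ?thesis by simp
      qed
      also have "ln n - (CARD('d) + 3) * ln n = - ln (real n ^ (CARD('d) + 2))"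
        unfolding ln_realpow[of "real n"] by (simp add: algebra_simps)
      also have "exp \<dots> = 1 / real n ^ (CARD('d) + 2)" using n by (simp add: exp_minus inverse_eq_divide)
      finally show ?thesis .
    qed
    have "measure X (\<Union>zi\<in>site_box n \<times> UNIV. A n (fst zi) (snd zi)) \<le> (\<Sum>zi\<in>site_box n \<times> (UNIV :: 'd set). measure X (A n (fst zi) (snd zi)))"
      using Am by (intro X.finite_measure_subadditive_finite) (auto simp: finite_site_box)
    also have "\<dots> \<le> (\<Sum>zi\<in>(site_box n :: 'd site set) \<times> (UNIV :: 'd set). 1 / real n ^ (CARD('d) + 2))"
      by (intro sum_mono one)
    also have "\<dots> = real (card (site_box n :: 'd site set)) * CARD('d) / real n ^ (CARD('d) + 2)"
      by (simp add: card_cartesian_product)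
    also have "\<dots> \<le> (3 * real n) ^ CARD('d) * CARD('d) / real n ^ (CARD('d) + 2)"
    proof (intro divide_right_mono mult_right_mono)
      have "real (card (site_box n :: 'd site set)) \<le> real ((2 * n + 1) ^ CARD('d))"
        using card_site_box_le[of n, where 'd='d] by (intro of_nat_mono) simp
      also have "\<dots> = (2 * real n + 1) ^ CARD('d)" by (simp add: add.commute)
      also have "\<dots> \<le> (3 * real n) ^ CARD('d)" using n by (intro power_mono) auto
      finally show "real (card (site_box n :: 'd site set)) \<le> (3 * real n) ^ CARD('d)" .
    qed auto
    also have "\<dots> = C * (1 / real n ^ 2)"
      using n by (simp add: C_def power_mult_distrib power_add power2_eq_square field_simps)
    finally show ?thesis by (simp add: case_prod_unfold)
  qed
  have "AE \<omega> in X. \<forall>\<^sub>F n in sequentially. \<omega> \<in> space X - (\<Union>(z, i)\<in>site_box n \<times> UNIV. A n z i)"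
  proof (rule borel_cantelli_AE1)
    show "(\<Union>(z, i)\<in>site_box n \<times> UNIV. A n z i) \<in> sets X" for n
      using Am by (intro sets.finite_UN) (auto simp: finite_site_box)
    show "summable (\<lambda>n. measure X (\<Union>(z, i)\<in>site_box n \<times> UNIV. A n z i))"
    proof (rule summable_comparison_test_ev)
      show "\<forall>\<^sub>F n in sequentially. norm (measure X (\<Union>(z, i)\<in>site_box n \<times> UNIV. A n z i)) \<le> C * (1 / real n ^ 2)"
        using eventually_ge_at_top[of 1] by eventually_elim (use tail in simp)
      show "summable (\<lambda>n. C * (1 / real n ^ 2))"
        using inverse_power_summable[of 2] by (intro summable_mult) (simp add: inverse_eq_divide)
    qed
  qed (simp add: X.emeasure_eq_measure)
  moreover have "AE \<omega> in X. \<forall>\<^sub>F n in sequentially. \<forall>z\<in>site_box n. h (\<omega> z) \<le> \<delta> / 2 * n"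
    using \<delta> by (intro site_values_sublinear) simp
  \<comment> \<open>The cap \<open>1\<close> keeps a segment that starts in the box of radius
    \<open>n\<close> inside the box of radius \<open>2 * n\<close>. There all values are at most
    \<open>\<delta> / 2 * (2 * n)\<close>, so the truncation changes nothing.\<close>
  ultimately have "AE \<omega> in X. short_segments \<omega> (min \<epsilon> 1) \<eta>"
  proof eventually_elim
    case (elim \<omega>)
    from elim(2) obtain N where N: "\<And>n z. N \<le> n \<Longrightarrow> z \<in> site_box n \<Longrightarrow> h (\<omega> z) \<le> \<delta> / 2 * n"
      unfolding eventually_sequentially by blast
    show ?case
      unfolding short_segments_def
      using elim(1) eventually_ge_at_top[of N]
    proof eventually_elim
      case (elim n)
      show ?case
      proof (intro ballI allI impI)
        fix z :: "'d site" and i k assume z: "z \<in> site_box n" and k: "real k \<le> min \<epsilon> 1 * n"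
        have "min \<epsilon> 1 \<le> 1" "min \<epsilon> 1 \<le> \<epsilon>" by (rule min.cobounded2, rule min.cobounded1)
        then have "real k \<le> 1 * real n" "real k \<le> \<epsilon> * real n"
          using order_trans[OF k mult_right_mono[of "min \<epsilon> 1" _ "real n"]] by (auto simp only: of_nat_0_le_iff)
        then have kn: "k \<le> n" "k \<le> kn n" unfolding kn_def by (auto simp: le_nat_floor)
        have "(\<Sum>j<k. h (\<omega> (segment z i j))) = (\<Sum>j<k. min (h (\<omega> (segment z i j))) (\<delta> * n))"
        proof (intro sum.cong refl)
          fix j assume j: "j \<in> {..<k}"
          have "segment z i j \<in> site_box (2 * n)"
            unfolding site_box_def
          proof safe
            fix i'
            have "\<bar>z $ i'\<bar> \<le> int n" using z by (simp add: site_box_def)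
            then show "\<bar>segment z i j $ i'\<bar> \<le> int (2 * n)"
              using j kn by (auto simp: segment_def axis_def)
          qed
          then have "h (\<omega> (segment z i j)) \<le> \<delta> / 2 * (2 * n)" using N[of "2 * n"] elim(2) by simp
          then show "h (\<omega> (segment z i j)) = min (h (\<omega> (segment z i j))) (\<delta> * n)" by simp
        qed
        also have "\<dots> \<le> (\<Sum>j<kn n. min (h (\<omega> (segment z i j))) (\<delta> * n))"
          using kn \<delta> h_nonneg by (intro sum_mono2) auto
        also have "\<dots> \<le> \<eta> * n" using elim(1) z by (auto simp: A_def not_le less_imp_le)
        finally show "(\<Sum>j<k. h (\<omega> (segment z i j))) \<le> \<eta> * n" .
      qed
    qed
  qed
  then show ?thesis using \<epsilon> by (intro exI[of _ "min \<epsilon> 1"]) auto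
qed

text \<open>The part of \<open>h\<close> below a level \<open>K\<close> is paid by the shortness of
  the segment. The excess over \<open>K\<close> has small mean, and Birkhoff's theorem in both
  directions bounds its sum over the whole interval from \<open>- 2 * n\<close> to
  \<open>2 * n\<close>.\<close>

lemma short_segments_onedim:
  assumes d: "CARD('d) = 1" and \<eta>: "0 < \<eta>"
  shows "\<exists>\<epsilon>>0. AE \<omega> in X. short_segments \<omega> \<epsilon> \<eta>"
proof -
  obtain i0 :: 'd where i0: "UNIV = {i0}" using d by (auto simp: card_1_singleton_iff)
  have all: "i = i0" for i using i0 by blast
  define e :: "'d site" where "e = axis i0 1"
  have e: "e \<noteq> 0" "- e \<noteq> 0" by (simp_all add: e_def axis_eq_0_iff)
  have i1: "integrable \<kappa> h" using integrable_h_power[of 1] d by simp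
  obtain K where K: "0 \<le> K" "(\<integral>s. max 0 (h s - K) \<partial>\<kappa>) \<le> \<eta> / 16"
    using \<kappa>.integral_excess_small[OF i1, of "\<eta> / 16"] \<eta> by auto
  define f where "f \<omega> = max 0 (h (\<omega> 0) - K)" for \<omega> :: "'d site \<Rightarrow> 'a"
  have f: "integrable X f" "(\<integral>\<omega>. f \<omega> \<partial>X) \<le> \<eta> / 16"
  proof -
    have i: "integrable \<kappa> (\<lambda>s. max 0 (h s - K))" using i1 by auto
    show "integrable X f"
      unfolding f_def using integrable_distr[OF coord_measurable[of 0], of "\<lambda>s. max 0 (h s - K)"] i by (simp add: coord_distr)
    show "(\<integral>\<omega>. f \<omega> \<partial>X) \<le> \<eta> / 16"
      unfolding f_def using integral_distr[OF coord_measurable[of 0], of "\<lambda>s. max 0 (h s - K)"] i K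
      by (simp add: coord_distr borel_measurable_integrable)
  qed
  have bk: "AE \<omega> in X. \<forall>\<^sub>F n in sequentially. (\<Sum>j<n. f (site_shift (of_nat j *s v) \<omega>)) \<le> \<eta> / 8 * n" if v: "v \<noteq> 0" for v
  proof -
    have "AE \<omega> in X. \<forall>\<^sub>F n in sequentially. \<bar>(\<Sum>j<n. f ((site_shift v ^^ j) \<omega>)) - n * (\<integral>\<omega>. f \<omega> \<partial>X)\<bar> \<le> \<eta> / 16 * n"
      using \<eta> by (intro X.birkhoff preserves_shift zero_one_shift \<kappa> v f) auto
    then show ?thesis
    proof eventually_elim
      case (elim \<omega>)
      then show ?case
      proof eventually_elim
        case (elim n)
        have "n * (\<integral>\<omega>. f \<omega> \<partial>X) \<le> n * (\<eta> / 16)" using f by (intro mult_left_mono) auto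
        moreover have "n * (\<eta> / 16) + \<eta> / 16 * n = \<eta> / 8 * n" by simp
        ultimately show ?case using abs_le_D1[OF elim] unfolding site_shift_funpow by linarith
      qed
    qed
  qed
  \<comment> \<open>At most \<open>\<epsilon> * n\<close> sites then contribute at most
    \<open>\<eta> / 4 * n\<close> through the level \<open>K\<close>; \<open>K + 1\<close> avoids a
    division by \<open>0\<close>.\<close>
  define \<epsilon> where "\<epsilon> = min 1 (\<eta> / (4 * (K + 1)))"
  have "AE \<omega> in X. short_segments \<omega> \<epsilon> \<eta>"
    using bk[OF e(1)] bk[OF e(2)]
  proof eventually_elim
    case (elim \<omega>)
    define F where "F c = max 0 (h (\<omega> (c *s e)) - K)" for c
    from elim have "\<forall>\<^sub>F n in sequentially. (\<Sum>j<n. F (int j)) \<le> \<eta> / 8 * n \<and> (\<Sum>j<n. F (- int j)) \<le> \<eta> / 8 * n"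
    proof eventually_elim
      case (elim n)
      have "of_nat j *s - e = - int j *s e" for j by (simp add: vec_eq_iff)
      then show ?case using elim by (simp add: f_def F_def site_shift_def)
    qed
    then obtain N where N: "\<And>n. N \<le> n \<Longrightarrow> (\<Sum>j<n. F (int j)) \<le> \<eta> / 8 * n" "\<And>n. N \<le> n \<Longrightarrow> (\<Sum>j<n. F (- int j)) \<le> \<eta> / 8 * n"
      unfolding eventually_sequentially by blast
    show ?case
      unfolding short_segments_def eventually_sequentially
    proof (intro exI[of _ "N + 1"] allI impI ballI)
      fix n and z :: "'d site" and i k assume n: "N + 1 \<le> n" and z: "z \<in> site_box n" and k: "real k \<le> \<epsilon> * n"
      have "\<epsilon> \<le> 1" "\<epsilon> \<le> \<eta> / (4 * (K + 1))" unfolding \<epsilon>_def by (rule min.cobounded1, rule min.cobounded2)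
      then have "real k \<le> 1 * real n" "real k \<le> \<eta> / (4 * (K + 1)) * real n"
        using order_trans[OF k mult_right_mono[of \<epsilon> _ "real n"]] by (auto simp only: of_nat_0_le_iff)
      then have kn: "k \<le> n" and kK: "K * k \<le> \<eta> / 4 * n"
      proof -
        have "K * k \<le> (K + 1) * (\<eta> / (4 * (K + 1)) * n)"
          using K \<open>real k \<le> \<eta> / (4 * (K + 1)) * n\<close> by (intro mult_mono) auto
        also have "(K + 1) * (\<eta> / (4 * (K + 1)) * n) = \<eta> / 4 * n"
        proof -
          have *: "0 < D \<Longrightarrow> D * (\<eta> / (4 * D) * n) = \<eta> / 4 * n" for D by (simp add: field_simps)
          show ?thesis by (rule *) (use K(1) in simp)
        qed
        finally show "K * k \<le> \<eta> / 4 * n" .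
      qed simp
      have F0: "0 \<le> F c" for c by (simp add: F_def)
      have seg: "segment z i j = (z $ i0 + int j) *s e" for j
        unfolding vec_eq_iff using all by (auto simp: segment_def e_def axis_def) (metis all)+
      have zb: "\<bar>z $ i0\<bar> \<le> int n" using z by (simp add: site_box_def)
      have "(\<Sum>j<k. h (\<omega> (segment z i j))) \<le> (\<Sum>j<k. K + F (z $ i0 + int j))"
        unfolding seg F_def by (intro sum_mono) auto
      also have "\<dots> = K * k + (\<Sum>c\<in>(\<lambda>j. z $ i0 + int j) ` {..<k}. F c)"
        by (simp add: sum.distrib sum.reindex inj_on_def)
      \<comment> \<open>Start and length are at most \<open>n\<close> in absolute value. The two
        half-lines share the origin, so each is taken with \<open>2 * n + 1\<close> points.\<close>
      also have "(\<Sum>c\<in>(\<lambda>j. z $ i0 + int j) ` {..<k}. F c) \<le> (\<Sum>c\<in>int ` {..<2*n+1} \<union> (\<lambda>j. - int j) ` {..<2*n+1}. F c)"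
      proof (rule sum_mono2)
        show "(\<lambda>j. z $ i0 + int j) ` {..<k} \<subseteq> int ` {..<2*n+1} \<union> (\<lambda>j. - int j) ` {..<2*n+1}"
        proof safe
          fix j assume j: "j < k" and nn: "z $ i0 + int j \<notin> (\<lambda>j. - int j) ` {..<2*n+1}"
          have "\<not> z $ i0 + int j \<le> 0"
          proof
            assume "z $ i0 + int j \<le> 0"
            then have "z $ i0 + int j = - int (nat (- (z $ i0 + int j)))" "nat (- (z $ i0 + int j)) < 2*n+1" using zb by auto
            then show False using nn by blast
          qed
          then have "z $ i0 + int j = int (nat (z $ i0 + int j))" "nat (z $ i0 + int j) < 2*n+1" using zb j kn by auto
          then show "z $ i0 + int j \<in> int ` {..<2*n+1}" by blast
        qed
      qed (auto simp: F0)
      also have "\<dots> \<le> (\<Sum>c\<in>int ` {..<2*n+1}. F c) + (\<Sum>c\<in>(\<lambda>j. - int j) ` {..<2*n+1}. F c)"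
        by (subst sum_Un) (auto intro!: sum_nonneg F0)
      also have "\<dots> = (\<Sum>j<2*n+1. F (int j)) + (\<Sum>j<2*n+1. F (- int j))"
        by (simp add: sum.reindex inj_on_def del: sum.lessThan_Suc)
      also have "\<dots> \<le> \<eta> / 8 * real (2*n+1) + \<eta> / 8 * real (2*n+1)"
        by (intro add_mono N) (use n in auto)
      also have "\<dots> \<le> \<eta> * 3 / 4 * n" using n \<eta> by (simp add: field_simps)
      finally show "(\<Sum>j<k. h (\<omega> (segment z i j))) \<le> \<eta> * n" using kK by (simp add: field_simps)
    qed
  qed
  moreover have "0 < \<epsilon>" using K \<eta> by (simp add: \<epsilon>_def)
  ultimately show ?thesis by blast
qed

text \<open>It suffices to treat \<eta> = \<open>1 / Suc m\<close>, so countably many null sets are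
  discarded.\<close>

lemma AE_short_segments: "AE \<omega> in X. \<forall>\<eta>>0. \<exists>\<epsilon>>0. short_segments \<omega> \<epsilon> \<eta>"
proof -
  have ex: "\<exists>\<epsilon>>0. AE \<omega> in X. short_segments \<omega> \<epsilon> (1 / Suc m)" for m
  proof (cases "CARD('d) = 1")
    case False
    then have "2 \<le> CARD('d)" using zero_less_card_finite[where 'a='d] by linarith
    then show ?thesis by (rule short_segments_multidim) simp
  qed (rule short_segments_onedim, auto)
  have "AE \<omega> in X. \<exists>\<epsilon>>0. short_segments \<omega> \<epsilon> (1 / Suc m)" for m
  proof -
    obtain \<epsilon> where "0 < \<epsilon>" "AE \<omega> in X. short_segments \<omega> \<epsilon> (1 / Suc m)" using ex[of m] by blast
    then show ?thesis by (elim eventually_mono) blast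
  qed
  then have "AE \<omega> in X. \<forall>m. \<exists>\<epsilon>>0. short_segments \<omega> \<epsilon> (1 / Suc m)"
    unfolding AE_all_countable ..
  then show ?thesis
  proof eventually_elim
    case (elim \<omega>)
    show ?case
    proof (intro allI impI)
      fix \<eta> :: real assume "0 < \<eta>"
      then obtain m where m: "1 / Suc m < \<eta>" using nat_approx_posE by blast
      obtain \<epsilon> where \<epsilon>: "0 < \<epsilon>" "short_segments \<omega> \<epsilon> (1 / Suc m)" using elim by blast
      have "short_segments \<omega> \<epsilon> \<eta>"
        using \<epsilon>(2) unfolding short_segments_def
      proof eventually_elim
        case (elim n)
        have "1 / Suc m * n \<le> \<eta> * n" using m by (intro mult_right_mono) auto
        with elim show ?case by (meson order_trans)
      qed
      with \<epsilon> show "\<exists>\<epsilon>>0. short_segments \<omega> \<epsilon> \<eta>" by blast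
    qed
  qed
qed

end

section \<open>The shape theorem\<close>

lemma sum_list_replicate_take: "j \<le> k \<Longrightarrow> sum_list (take j (replicate k (e :: ('d::finite) site))) = of_nat j *s e"
proof (induction j)
  case (Suc j)
  then show ?case by (simp add: take_Suc_conv_app_nth of_nat_vec_Suc add.commute del: of_nat_Suc)
qed simp

lemma site_norm_le_box: "z \<in> site_box (site_norm z)"
  unfolding site_box_def
proof safe
  fix i
  have "\<bar>z $ i\<bar> \<le> (\<Sum>i\<in>UNIV. \<bar>z $ i\<bar>)" by (rule member_le_sum) auto
  then show "\<bar>z $ i\<bar> \<le> int (site_norm z)" by (simp add: site_norm_def)
qed

lemma site_norm_bounded: "(\<And>i. \<bar>z $ i\<bar> \<le> int n) \<Longrightarrow> site_norm (z :: ('d::finite) site) \<le> CARD('d) * n"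
  unfolding site_norm_def using sum_bounded_above[of UNIV "\<lambda>i. nat \<bar>z $ i\<bar>" n] by (simp add: nat_le_iff)

section \<open>Travel cost between nearby points of a box\<close>

context
  fixes \<omega> :: "('d::finite) jump_env" and \<sigma> :: "'d holding_env" and lam b :: real and n m :: nat
  assumes good: "(\<omega>, \<sigma>) \<in> good" and lam: "0 \<le> lam" and mn: "m \<le> n"
    and segs: "\<And>z i k. z \<in> site_box (2 * n) \<Longrightarrow> k \<le> m \<Longrightarrow>
      (\<Sum>j<k. site_cost lam \<omega> \<sigma> (z + of_nat j *s axis i 1)) \<le> b"
begin

lemma a_fun_axis_le:
  assumes x: "x \<in> site_box n" and c: "\<bar>c\<bar> \<le> int m"
  shows "a_fun lam x (x + c *s axis i 1) \<omega> \<sigma> \<le> b"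
proof -
  define k where "k = nat \<bar>c\<bar>"
  have k: "k \<le> m" using c by (simp add: k_def)
  show ?thesis
  proof (cases "0 \<le> c")
    case True
    let ?es = "replicate k (axis i 1 :: 'd site)"
    have "a_fun lam x (x + sum_list ?es) \<omega> \<sigma> \<le> (\<Sum>j<length ?es. site_cost lam \<omega> \<sigma> (x + sum_list (take j ?es)))"
      by (rule a_fun_path[OF good lam]) (auto simp: axis_unit_step)
    also have "\<dots> = (\<Sum>j<k. site_cost lam \<omega> \<sigma> (x + of_nat j *s axis i 1))"
    proof (rule sum.cong)
      fix j assume "j \<in> {..<k}"
      then have "j \<le> k" by simp
      then show "site_cost lam \<omega> \<sigma> (x + sum_list (take j ?es)) = site_cost lam \<omega> \<sigma> (x + of_nat j *s axis i 1)"
        by (simp only: sum_list_replicate_take)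
    qed simp
    also have "\<dots> \<le> b"
    proof (rule segs[OF _ k])
      have "\<bar>x $ i\<bar> \<le> int (2 * n)" for i
      proof (rule order_trans)
        show "\<bar>x $ i\<bar> \<le> int n" using x by (simp add: site_box_def)
      qed simp
      then show "x \<in> site_box (2 * n)" by (simp add: site_box_def)
    qed
    also have "sum_list ?es = c *s axis i 1"
      using sum_list_replicate_take[of k k "axis i 1 :: 'd site"] True by (simp add: k_def)
    finally show ?thesis .
  next
    case False
    let ?es = "replicate k (- axis i 1 :: 'd site)"
    \<comment> \<open>The path in the negative direction leaves \<open>x\<close> and the
      \<open>k - 1\<close> sites below it. In reverse order these form a positive segment starting
      at \<open>y\<close>, which may lie outside the box of radius \<open>n\<close>; hence the
      larger box in the assumption.\<close>
    define y where "y = x - of_nat (k - 1) *s axis i 1"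
    have yb: "y \<in> site_box (2 * n)"
      unfolding site_box_def
    proof safe
      fix i'
      have "\<bar>x $ i'\<bar> \<le> int n" using x by (simp add: site_box_def)
      then show "\<bar>y $ i'\<bar> \<le> int (2 * n)" using k mn by (auto simp: y_def axis_def)
    qed
    have "a_fun lam x (x + sum_list ?es) \<omega> \<sigma> \<le> (\<Sum>j<length ?es. site_cost lam \<omega> \<sigma> (x + sum_list (take j ?es)))"
      by (rule a_fun_path[OF good lam]) (auto simp: axis_unit_step)
    also have "\<dots> = (\<Sum>j<k. site_cost lam \<omega> \<sigma> (y + of_nat (k - Suc j) *s axis i 1))"
    proof (rule sum.cong)
      fix j assume "j \<in> {..<k}"
      then have "x + of_nat j *s - axis i 1 = y + of_nat (k - Suc j) *s axis i 1" and "j \<le> k"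
        by (auto simp: y_def vec_eq_iff algebra_simps of_nat_diff)
      then show "site_cost lam \<omega> \<sigma> (x + sum_list (take j ?es)) = site_cost lam \<omega> \<sigma> (y + of_nat (k - Suc j) *s axis i 1)"
        by (simp only: sum_list_replicate_take)
    qed simp
    also have "\<dots> = (\<Sum>j<k. site_cost lam \<omega> \<sigma> (y + of_nat j *s axis i 1))"
      by (rule sum.nat_diff_reindex)
    also have "\<dots> \<le> b" by (rule segs[OF yb k])
    also have "sum_list ?es = c *s axis i 1"
      using sum_list_replicate_take[of k k "- axis i 1 :: 'd site"] False by (simp add: k_def vec_eq_iff)
    finally show ?thesis .
  qed
qed

text \<open>Coordinates are corrected one at a time, by induction on a set containing those where
  the points differ. Intermediate points take each coordinate from \<open>y\<close> or
  \<open>z\<close>, so they remain in the box.\<close>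

lemma a_fun_near_le:
  assumes y: "y \<in> site_box n" and z: "z \<in> site_box n" and d: "\<And>i. \<bar>z $ i - y $ i\<bar> \<le> int m"
  shows "a_fun lam y z \<omega> \<sigma> \<le> real CARD('d) * b"
proof -
  have "a_fun lam y z \<omega> \<sigma> \<le> real (card S) * b" if "finite S" "y \<in> site_box n" "\<And>i. i \<notin> S \<Longrightarrow> y $ i = z $ i" "\<And>i. \<bar>z $ i - y $ i\<bar> \<le> int m" for S y
    using that
  proof (induction S arbitrary: y rule: finite_induct)
    case empty
    then have "y = z" by (simp add: vec_eq_iff)
    then show ?case by (simp add: a_fun_refl[OF good lam])
  next
    case (insert i S)
    define w where "w = y + (z $ i - y $ i) *s axis i 1"
    have wi: "w $ j = (if j = i then z $ i else y $ j)" for j by (simp add: w_def axis_def)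
    have wb: "w \<in> site_box n" using insert.prems(1) z by (simp add: site_box_def wi)
    have "a_fun lam w z \<omega> \<sigma> \<le> real (card S) * b"
      using insert.prems by (intro insert.IH wb) (auto simp: wi)
    moreover have "a_fun lam y w \<omega> \<sigma> \<le> b"
      unfolding w_def by (rule a_fun_axis_le) (use insert.prems in auto)
    ultimately show ?case
      using a_fun_triangle[OF good lam, of y z w] insert.hyps by (simp add: algebra_simps)
  qed
  from this[of UNIV y] y d show ?thesis by simp
qed

end

context rwre
begin

text \<open>\<open>jump_cost\<close> as a function of the law at one site, the form required by
  \<open>iid_cost\<close>; \<open>hH\<close> below does the same for
  \<open>holding_cost\<close>.\<close>

definition hJ :: "'d site measure \<Rightarrow> real" where
  "hJ \<rho> = \<bar>ln (Min ((\<lambda>e. measure \<rho> {e}) ` unit_steps))\<bar>"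

definition hH :: "real measure \<Rightarrow> real" where
  "hH \<rho> = enn2real (\<integral>\<^sup>+ s. ennreal s \<partial>\<rho>)"

lemma jump_cost_shift: "jump_cost (site_shift x \<omega>) = hJ (\<omega> x)"
  by (simp add: jump_cost_def hJ_def min_jump_def jump_prob_def site_shift_def)

lemma holding_cost_shift: "holding_cost (site_shift x \<sigma>) = hH (\<sigma> x)"
  by (simp add: holding_cost_def hH_def mean_holding_def site_shift_def)

lemma site_cost_h: "site_cost lam \<omega> \<sigma> x = hJ (\<omega> x) + lam * hH (\<sigma> x)"
  using jump_cost_shift[of x \<omega>] holding_cost_shift[of x \<sigma>]
  by (simp add: site_cost_def jump_cost_def holding_cost_def)

sublocale cJ: iid_cost \<mu> hJ "TYPE('d)"
proof (rule iid_cost.intro)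
  have "(\<lambda>\<rho>. emeasure \<rho> {e}) \<in> borel_measurable (subprob_algebra (count_space unit_steps))" if "e \<in> unit_steps" for e :: "'d site"
    using that by (intro measurable_emeasure_subprob_algebra) auto
  from measurable_compose[OF measurable_prob_algebraD[OF measurable_ident_sets[OF refl]] this]
  have "(\<lambda>\<rho>. measure \<rho> {e}) \<in> borel_measurable jump_laws" if "e \<in> unit_steps" for e :: "'d site"
    using that unfolding jump_laws_def measure_def by simp
  then have "(\<lambda>\<rho>. Min ((\<lambda>e. measure \<rho> {e}) ` unit_steps)) \<in> borel_measurable (jump_laws :: 'd site measure measure)"
    by (intro borel_measurable_Min finite_unit_steps)
  then have "hJ \<in> borel_measurable jump_laws" unfolding hJ_def[abs_def] by measurable
  then show m: "hJ \<in> borel_measurable \<mu>" by (simp only: measurable_cong_sets[OF \<mu>(2) refl])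
  have eq: "jump_cost \<omega> = hJ (\<omega> 0)" for \<omega> using jump_cost_shift[of 0 \<omega>] by simp
  have "distr J \<mu> (\<lambda>\<omega>. \<omega> 0) = \<mu>" unfolding iid_field_def by (rule distr_PiM_component) (auto simp: \<mu>)
  moreover have "integrable (distr J \<mu> (\<lambda>\<omega>. \<omega> 0)) (\<lambda>\<rho>. hJ \<rho> ^ CARD('d))"
    by (subst integrable_distr_eq) (use integrable_jump_cost_power m in \<open>auto simp: eq iid_field_def\<close>)
  ultimately show "integrable \<mu> (\<lambda>\<rho>. hJ \<rho> ^ CARD('d))" by simp
  show "prob_space \<mu>" by (rule \<mu>(1))
  show "0 \<le> hJ \<rho>" for \<rho> by (simp add: hJ_def)
qed

sublocale cH: iid_cost \<nu> hH "TYPE('d)"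
proof (rule iid_cost.intro)
  have "(\<lambda>\<rho>. \<integral>\<^sup>+ s. ennreal s \<partial>\<rho>) \<in> borel_measurable (subprob_algebra (restrict_space borel {0<..}))"
    by (intro nn_integral_measurable_subprob_algebra measurable_restrict_space1) simp
  from measurable_compose[OF measurable_prob_algebraD[OF measurable_ident_sets[OF refl]] this]
  have "hH \<in> borel_measurable holding_laws" unfolding hH_def[abs_def] holding_laws_def by measurable
  then show m: "hH \<in> borel_measurable \<nu>" by (simp only: measurable_cong_sets[OF \<nu>(2) refl])
  have eq: "holding_cost \<sigma> = hH (\<sigma> 0)" for \<sigma> using holding_cost_shift[of 0 \<sigma>] by simp
  have "distr H \<nu> (\<lambda>\<sigma>. \<sigma> (0 :: 'd site)) = \<nu>" unfolding iid_field_def by (rule distr_PiM_component) (auto simp: \<nu>)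
  moreover have "integrable (distr H \<nu> (\<lambda>\<sigma>. \<sigma> 0)) (\<lambda>\<rho>. hH \<rho> ^ CARD('d))"
    by (subst integrable_distr_eq) (use integrable_holding_cost_power m in \<open>auto simp: eq iid_field_def\<close>)
  ultimately show "integrable \<nu> (\<lambda>\<rho>. hH \<rho> ^ CARD('d))" by simp
  show "prob_space \<nu>" by (rule \<nu>(1))
  show "0 \<le> hH \<rho>" for \<rho> by (simp add: hH_def)
qed

definition regular :: "'d jump_env \<Rightarrow> 'd holding_env \<Rightarrow> bool" where
  "regular \<omega> \<sigma> \<longleftrightarrow> (\<omega>, \<sigma>) \<in> good \<and> (\<forall>\<eta>>0. \<exists>\<epsilon>>0. cJ.short_segments \<omega> \<epsilon> \<eta>) \<and> (\<forall>\<eta>>0. \<exists>\<epsilon>>0. cH.short_segments \<sigma> \<epsilon> \<eta>)"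

lemma AE_regular: "AE \<xi> in M. regular (fst \<xi>) (snd \<xi>)"
proof -
  have "AE \<omega> in distr M J fst. \<forall>\<eta>>0. \<exists>\<epsilon>>0. cJ.short_segments \<omega> \<epsilon> \<eta>"
    unfolding distr_fst_M by (rule cJ.AE_short_segments)
  note 1 = AE_distrD[OF fst_measurable this]
  have "AE \<sigma> in distr M H snd. \<forall>\<eta>>0. \<exists>\<epsilon>>0. cH.short_segments \<sigma> \<epsilon> \<eta>"
    unfolding distr_snd_M by (rule cH.AE_short_segments)
  note 2 = AE_distrD[OF snd_measurable this]
  show ?thesis using AE_good 1 2 by eventually_elim (simp add: regular_def)
qed

text \<open>The site cost splits into its jump part and \<lambda> times its holding part, and the
  segment bounds for both are used at scale \<open>2 * n\<close>.\<close>

lemma regular_near: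
  fixes lam \<eta> :: real
  assumes reg: "regular \<omega> \<sigma>" and lam: "0 \<le> lam" and \<eta>: "0 < \<eta>"
  shows "\<exists>\<epsilon>>0::real. \<forall>\<^sub>F n in sequentially. \<forall>y\<in>site_box n. \<forall>z\<in>site_box n.
    (\<forall>i. \<bar>real_of_int (z $ i - y $ i)\<bar> \<le> \<epsilon> * n) \<longrightarrow> a_fun lam y z \<omega> \<sigma> \<le> \<eta> * n"
proof -
  have good: "(\<omega>, \<sigma>) \<in> good" using reg by (simp add: regular_def)
  \<comment> \<open>The denominators account for the scale \<open>2 * n\<close>, for the two parts
    of the cost, and for the number of coordinates to be corrected.\<close>
  define \<eta>' where "\<eta>' = \<eta> / (2 * (1 + lam) * CARD('d))"
  have \<eta>': "0 < \<eta>'" using \<eta> lam by (simp add: \<eta>'_def)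
  obtain \<epsilon>1 \<epsilon>2 where \<epsilon>: "0 < \<epsilon>1" "0 < \<epsilon>2" and s: "cJ.short_segments \<omega> \<epsilon>1 \<eta>'" "cH.short_segments \<sigma> \<epsilon>2 \<eta>'"
    using reg \<eta>' unfolding regular_def by blast
  obtain N where N: "\<And>n z i k. N \<le> n \<Longrightarrow> z \<in> site_box n \<Longrightarrow> real k \<le> \<epsilon>1 * n \<Longrightarrow> (\<Sum>j<k. hJ (\<omega> (z + of_nat j *s axis i 1))) \<le> \<eta>' * n"
      "\<And>n z i k. N \<le> n \<Longrightarrow> z \<in> site_box n \<Longrightarrow> real k \<le> \<epsilon>2 * n \<Longrightarrow> (\<Sum>j<k. hH (\<sigma> (z + of_nat j *s axis i 1))) \<le> \<eta>' * n"
  proof -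
    have "\<forall>\<^sub>F n in sequentially. (\<forall>z\<in>site_box n. \<forall>i. \<forall>k. real k \<le> \<epsilon>1 * n \<longrightarrow> (\<Sum>j<k. hJ (\<omega> (z + of_nat j *s axis i 1))) \<le> \<eta>' * n) \<and>
      (\<forall>z\<in>site_box n. \<forall>i. \<forall>k. real k \<le> \<epsilon>2 * n \<longrightarrow> (\<Sum>j<k. hH (\<sigma> (z + of_nat j *s axis i 1))) \<le> \<eta>' * n)"
      using s unfolding cJ.short_segments_def cH.short_segments_def cJ.segment_def cH.segment_def by (rule eventually_conj)
    then show ?thesis using that unfolding eventually_sequentially by blast
  qed
  define \<epsilon> where "\<epsilon> = min 1 (min \<epsilon>1 \<epsilon>2)"
  have "\<forall>\<^sub>F n in sequentially. \<forall>y\<in>site_box n. \<forall>z\<in>site_box n.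
    (\<forall>i. \<bar>real_of_int (z $ i - y $ i)\<bar> \<le> \<epsilon> * n) \<longrightarrow> a_fun lam y z \<omega> \<sigma> \<le> \<eta> * n"
    unfolding eventually_sequentially
  proof (intro exI[of _ N] allI impI ballI)
    fix n and y z :: "'d site" assume n: "N \<le> n" and yz: "y \<in> site_box n" "z \<in> site_box n"
      and d: "\<forall>i. \<bar>real_of_int (z $ i - y $ i)\<bar> \<le> \<epsilon> * n"
    define m where "m = nat \<lfloor>\<epsilon> * n\<rfloor>"
    have \<epsilon>0: "0 \<le> \<epsilon> * n" using \<epsilon> by (simp add: \<epsilon>_def)
    have m: "real m \<le> \<epsilon> * n" unfolding m_def by (rule of_nat_floor[OF \<epsilon>0])
    have le: "\<epsilon> \<le> 1" "\<epsilon> \<le> \<epsilon>1" "\<epsilon> \<le> \<epsilon>2" by (auto simp: \<epsilon>_def)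
    have "real m \<le> 1 * real n" by (rule order_trans[OF m mult_right_mono[OF le(1)]]) simp
    then have mn: "m \<le> n" by simp
    have segs: "(\<Sum>j<k. site_cost lam \<omega> \<sigma> (x + of_nat j *s axis i 1)) \<le> (1 + lam) * (\<eta>' * (2 * n))"
      if x: "x \<in> site_box (2 * n)" and k: "k \<le> m" for x i k
    proof -
      have "real k \<le> \<epsilon> * n" using k m by linarith
      moreover have "\<epsilon> * n \<le> \<epsilon>1 * (2 * n)" "\<epsilon> * n \<le> \<epsilon>2 * (2 * n)"
        using le \<epsilon> by (auto intro!: mult_mono)
      ultimately have k12: "real k \<le> \<epsilon>1 * real (2 * n)" "real k \<le> \<epsilon>2 * real (2 * n)" by simp_all
      have "(\<Sum>j<k. site_cost lam \<omega> \<sigma> (x + of_nat j *s axis i 1)) = (\<Sum>j<k. hJ (\<omega> (x + of_nat j *s axis i 1))) + lam * (\<Sum>j<k. hH (\<sigma> (x + of_nat j *s axis i 1)))"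
        by (simp add: site_cost_h sum.distrib sum_distrib_left)
      also have "\<dots> \<le> \<eta>' * real (2 * n) + lam * (\<eta>' * real (2 * n))"
        using n by (intro add_mono mult_left_mono N x k12 lam) auto
      finally show ?thesis by (simp add: algebra_simps)
    qed
    have "\<bar>z $ i - y $ i\<bar> \<le> int m" for i
    proof -
      have "real_of_int \<bar>z $ i - y $ i\<bar> \<le> \<epsilon> * n" using d by simp
      then show ?thesis using \<epsilon>0 unfolding m_def by (simp add: le_floor_iff)
    qed
    from a_fun_near_le[OF good lam mn segs yz this]
    have "a_fun lam y z \<omega> \<sigma> \<le> CARD('d) * ((1 + lam) * (\<eta>' * (2 * n)))" by simp
    also have "\<dots> = \<eta>' * (2 * (1 + lam) * CARD('d)) * n" by (simp add: mult_ac)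
    also have "\<eta>' * (2 * (1 + lam) * CARD('d)) = \<eta>"
    proof -
      have "0 < 2 * (1 + lam) * CARD('d)" using lam by simp
      then show ?thesis unfolding \<eta>'_def by (metis less_irrefl nonzero_eq_divide_eq)
    qed
    finally show "a_fun lam y z \<omega> \<sigma> \<le> \<eta> * n" .
  qed
  then show ?thesis using \<epsilon> by (intro exI[of _ \<epsilon>]) (simp add: \<epsilon>_def)
qed

text \<open>The assertion at lattice points, uniform in the direction and free of sequences.\<close>

definition shape :: "real \<Rightarrow> 'd jump_env \<Rightarrow> 'd holding_env \<Rightarrow> bool" where
  "shape lam \<omega> \<sigma> \<longleftrightarrow> (\<forall>\<eta>>0::real. \<exists>N. \<forall>z. N \<le> site_norm z \<longrightarrow> \<bar>a_fun lam 0 z \<omega> \<sigma> - \<alpha>0 lam z\<bar> \<le> \<eta> * site_norm z)"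

text \<open>At scale \<open>s = site_norm z\<close> the point is replaced by \<open>m * v\<close>,
  with \<open>m\<close> about \<open>s / Q\<close> and \<open>v\<close> from a fixed finite box.
  Three errors of size \<open>\<eta> / 4 * s\<close> arise: moving from \<open>z\<close> to
  \<open>m * v\<close> in the cost, convergence along multiples of \<open>v\<close>, and moving back
  in the exponent.\<close>

lemma regular_shape:
  assumes reg: "regular \<omega> \<sigma>" and lam: "0 \<le> lam"
    and conv: "\<And>v. (\<lambda>n. a_fun lam 0 (of_nat n *s v) \<omega> \<sigma> / n) \<longlonglongrightarrow> \<alpha>0 lam v"
  shows "shape lam \<omega> \<sigma>"
  unfolding shape_def
proof (intro allI impI)
  fix \<eta> :: real assume \<eta>: "0 < \<eta>"
  have good: "(\<omega>, \<sigma>) \<in> good" using reg by (simp add: regular_def)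
  have "0 < \<eta> / 8" using \<eta> by simp
  from regular_near[OF reg lam this] obtain \<epsilon> :: real where \<epsilon>: "0 < \<epsilon>"
    and ev: "\<forall>\<^sub>F n in sequentially. \<forall>y\<in>site_box n. \<forall>z\<in>site_box n.
      (\<forall>i. \<bar>real_of_int (z $ i - y $ i)\<bar> \<le> \<epsilon> * n) \<longrightarrow> a_fun lam y z \<omega> \<sigma> \<le> \<eta> / 8 * n"
    by blast
  from ev obtain N1 where "\<forall>n\<ge>N1. \<forall>y\<in>site_box n. \<forall>z\<in>site_box n.
      (\<forall>i. \<bar>real_of_int (z $ i - y $ i)\<bar> \<le> \<epsilon> * n) \<longrightarrow> a_fun lam y z \<omega> \<sigma> \<le> \<eta> / 8 * n"
    unfolding eventually_sequentially by blast
  note N1 = this[rule_format]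
  define C where "C = mean_cost lam * CARD('d)"
  have C: "0 \<le> C" using mean_cost_nonneg[OF lam] by (simp add: C_def)
  \<comment> \<open>\<open>1 / \<epsilon>\<close> makes the rounding error \<open>m\<close> at most
    \<open>\<epsilon> * s\<close>, so that \<open>regular_near\<close> applies;
    \<open>4 * C / \<eta>\<close> makes the Lipschitz error \<open>C * m\<close> of the exponent at
    most \<open>\<eta> / 4 * s\<close>.\<close>
  define Q where "Q = nat \<lceil>max (1 / \<epsilon>) (4 * C / \<eta>)\<rceil> + 1"
  have Q: "1 \<le> Q" "1 / \<epsilon> \<le> Q" "4 * C / \<eta> \<le> Q"
  proof -
    have "max (1 / \<epsilon>) (4 * C / \<eta>) \<le> nat \<lceil>max (1 / \<epsilon>) (4 * C / \<eta>)\<rceil>" by (rule real_nat_ceiling_ge)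
    then show "1 / \<epsilon> \<le> Q" "4 * C / \<eta> \<le> Q" by (simp_all add: Q_def)
  qed (simp add: Q_def)
  have Q\<epsilon>: "1 \<le> \<epsilon> * Q" and QC: "4 * C \<le> \<eta> * Q"
    using Q(2,3) \<epsilon> \<eta> by (simp_all add: pos_divide_le_eq mult.commute)
  have "\<forall>\<^sub>F m in sequentially. \<forall>v\<in>site_box (4 * Q). \<bar>a_fun lam 0 (of_nat m *s v) \<omega> \<sigma> / m - \<alpha>0 lam v\<bar> < \<eta> / 4"
  proof (rule eventually_ball_finite[OF finite_site_box], rule ballI)
    fix v :: "'d site"
    show "\<forall>\<^sub>F m in sequentially. \<bar>a_fun lam 0 (of_nat m *s v) \<omega> \<sigma> / m - \<alpha>0 lam v\<bar> < \<eta> / 4"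
      using tendstoD[OF conv[of v], of "\<eta> / 4"] \<eta> by (simp add: dist_real_def)
  qed
  then obtain m0 where m0: "\<And>m v. m0 \<le> m \<Longrightarrow> v \<in> site_box (4 * Q) \<Longrightarrow> \<bar>a_fun lam 0 (of_nat m *s v) \<omega> \<sigma> / m - \<alpha>0 lam v\<bar> < \<eta> / 4"
    unfolding eventually_sequentially by blast
  show "\<exists>N. \<forall>z. N \<le> site_norm z \<longrightarrow> \<bar>a_fun lam 0 z \<omega> \<sigma> - \<alpha>0 lam z\<bar> \<le> \<eta> * site_norm z"
  proof (intro exI[of _ "Q * (m0 + 1) + N1"] allI impI)
    fix z :: "'d site" assume zN: "Q * (m0 + 1) + N1 \<le> site_norm z"
    define s where "s = site_norm z"
    define m where "m = s div Q"
    have "Q * (m0 + 1) \<le> s" using zN by (simp add: s_def)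
    then have m: "m0 + 1 \<le> m" unfolding m_def using Q div_le_mono[of "Q * (m0 + 1)" s Q] by simp
    have mQ: "m * Q \<le> s" "s < m * Q + Q"
      unfolding m_def using Q by (auto simp: div_times_less_eq_dividend dividend_less_div_times add.commute)
    have "m \<le> m * Q" "Q \<le> m * Q" using Q(1) m by simp_all
    then have ms: "m \<le> s" and s2: "s \<le> 2 * (m * Q)" using mQ by linarith+
    \<comment> \<open>Coordinatewise integer division leaves remainders in the range from
      \<open>0\<close> to \<open>m - 1\<close>. As \<open>s\<close> is at most
      \<open>2 * m * Q\<close>, \<open>v\<close> lies in the box of radius \<open>4 * Q\<close>,
      which does not depend on \<open>z\<close>.\<close>
    define v where "v = (\<chi> i. z $ i div int m)"
    have zi: "\<bar>z $ i\<bar> \<le> int s" for i using site_norm_le_box[of z] by (simp add: site_box_def s_def)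
    have diff: "0 \<le> z $ i - int m * v $ i" "z $ i - int m * v $ i < int m" for i
      using m by (simp_all add: v_def minus_mult_div_eq_mod)
    define w where "w = of_nat m *s v"
    have wi: "w $ i = int m * v $ i" for i by (simp add: w_def)
    have wb: "w \<in> site_box (2 * s)" "z \<in> site_box (2 * s)"
    proof -
      have "\<bar>w $ i\<bar> \<le> int (2 * s)" for i using diff[of i] zi[of i] ms unfolding wi by linarith
      then show "w \<in> site_box (2 * s)" by (simp add: site_box_def)
      have "\<bar>z $ i\<bar> \<le> int (2 * s)" for i using zi[of i] by linarith
      then show "z \<in> site_box (2 * s)" by (simp add: site_box_def)
    qed
    have vb: "v \<in> site_box (4 * Q)"
      unfolding site_box_def
    proof safe
      fix i
      have "int m * \<bar>v $ i\<bar> = \<bar>w $ i\<bar>" by (simp add: wi abs_mult)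
      also have "\<dots> \<le> int (2 * s)" using wb by (simp add: site_box_def)
      also have "\<dots> \<le> int m * int (4 * Q)" using s2 by (simp add: mult_ac flip: of_nat_mult)
      finally show "\<bar>v $ i\<bar> \<le> int (4 * Q)" using m by simp
    qed
    have close: "\<bar>real_of_int (z $ i - w $ i)\<bar> \<le> \<epsilon> * real (2 * s)" for i
    proof -
      have "\<bar>real_of_int (z $ i - w $ i)\<bar> \<le> m" using diff[of i] unfolding wi by linarith
      also have "real m \<le> \<epsilon> * Q * m" using mult_right_mono[OF Q\<epsilon>, of "real m"] by simp
      also have "\<dots> \<le> \<epsilon> * s" using \<epsilon> mQ(1) by (simp add: mult_ac flip: of_nat_mult)
      also have "\<dots> \<le> \<epsilon> * real (2 * s)" using \<epsilon> by simp
      finally show ?thesis .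
    qed
    have n1: "N1 \<le> 2 * s" using zN by (simp add: s_def)
    have wz: "a_fun lam w z \<omega> \<sigma> \<le> \<eta> / 8 * real (2 * s)"
      by (rule N1[OF n1 wb close])
    have zw: "a_fun lam z w \<omega> \<sigma> \<le> \<eta> / 8 * real (2 * s)"
      by (rule N1[OF n1 wb(2,1)]) (use close in \<open>simp add: abs_minus_commute\<close>)
    have A: "\<bar>a_fun lam 0 z \<omega> \<sigma> - a_fun lam 0 w \<omega> \<sigma>\<bar> \<le> \<eta> / 4 * s"
    proof -
      have "\<eta> / 8 * real (2 * s) = \<eta> / 4 * s" by simp
      with wz zw show ?thesis
        using a_fun_triangle[OF good lam, of 0 z w] a_fun_triangle[OF good lam, of 0 w z] by linarith
    qed
    have "\<bar>a_fun lam 0 w \<omega> \<sigma> / m - \<alpha>0 lam v\<bar> < \<eta> / 4" unfolding w_def using m by (intro m0 vb) simp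
    then have "m * \<bar>a_fun lam 0 w \<omega> \<sigma> / m - \<alpha>0 lam v\<bar> \<le> m * (\<eta> / 4)" by (intro mult_left_mono) auto
    moreover have "m * \<bar>a_fun lam 0 w \<omega> \<sigma> / m - \<alpha>0 lam v\<bar> = \<bar>a_fun lam 0 w \<omega> \<sigma> - \<alpha>0 lam w\<bar>"
    proof -
      have "\<alpha>0 lam w = m * \<alpha>0 lam v" unfolding w_def by (rule lyapunov_site_smult[OF lam])
      then have "a_fun lam 0 w \<omega> \<sigma> - \<alpha>0 lam w = m * (a_fun lam 0 w \<omega> \<sigma> / m - \<alpha>0 lam v)"
        using m by (simp add: field_simps)
      then show ?thesis by (simp add: abs_mult)
    qed
    moreover have "m * (\<eta> / 4) \<le> s * (\<eta> / 4)" using ms \<eta> by (intro mult_right_mono) auto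
    ultimately have B: "\<bar>a_fun lam 0 w \<omega> \<sigma> - \<alpha>0 lam w\<bar> \<le> \<eta> / 4 * s" by (simp add: mult.commute)
    have "\<bar>\<alpha>0 lam z - \<alpha>0 lam w\<bar> \<le> mean_cost lam * site_norm (z - w)" by (rule lyapunov_site_Lipschitz[OF lam])
    also have "\<dots> \<le> mean_cost lam * (CARD('d) * m)"
    proof (intro mult_left_mono mean_cost_nonneg lam)
      have "site_norm (z - w) \<le> CARD('d) * m"
        by (rule site_norm_bounded) (use diff in \<open>auto simp: wi less_imp_le\<close>)
      then show "real (site_norm (z - w)) \<le> real (CARD('d) * m)" by (rule of_nat_mono)
    qed
    also have "\<dots> = C * m" by (simp add: C_def)
    also have "\<dots> \<le> \<eta> / 4 * Q * m" using QC by (intro mult_right_mono) auto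
    also have "\<dots> \<le> \<eta> / 4 * s" using mQ(1) \<eta> by (simp add: mult_ac flip: of_nat_mult)
    finally have D: "\<bar>\<alpha>0 lam z - \<alpha>0 lam w\<bar> \<le> \<eta> / 4 * s" .
    have "\<bar>a_fun lam 0 z \<omega> \<sigma> - \<alpha>0 lam z\<bar> \<le> \<eta> / 4 * s + \<eta> / 4 * s + \<eta> / 4 * s"
      using A B D by linarith
    also have "\<dots> \<le> \<eta> * s" using \<eta> by (simp add: field_simps)
    finally show "\<bar>a_fun lam 0 z \<omega> \<sigma> - \<alpha>0 lam z\<bar> \<le> \<eta> * site_norm z" by (simp add: s_def)
  qed
qed

end

text \<open>The closest site is no farther than the coordinatewise floor, which is within
  \<open>1\<close> in each coordinate.\<close>

lemma nearest_site_dist: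
  fixes br :: "real ^ 'd \<Rightarrow> ('d::finite) site"
  assumes "nearest_site_rule br"
  shows "l1norm (x - of_site (br x)) \<le> CARD('d)"
proof -
  have "l1norm (x - of_site (br x)) \<le> l1norm (x - of_site (\<chi> i. \<lfloor>x $ i\<rfloor>))"
    using assms by (simp add: nearest_site_rule_def)
  also have "\<dots> = (\<Sum>i\<in>UNIV. \<bar>x $ i - of_int \<lfloor>x $ i\<rfloor>\<bar>)" by (simp add: l1norm_def of_site_def)
  also have "\<dots> \<le> (\<Sum>i\<in>(UNIV::'d set). 1)" by (intro sum_mono) linarith
  finally show ?thesis by simp
qed

context rwre
begin

section \<open>From rational to all values of \<lambda>\<close>

lemma lyapunov_site_mono:
  assumes "0 \<le> lam" "lam \<le> lam'"
  shows "\<alpha>0 lam z \<le> \<alpha>0 lam' z"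
proof -
  have lam': "0 \<le> lam'" using assms by simp
  have "(\<integral>\<xi>. a0 lam w \<xi> \<partial>M) \<le> (\<integral>\<xi>. a0 lam' w \<xi> \<partial>M)" for w
    by (intro integral_mono integrable_a0 assms lam') (auto simp: a0_def intro!: a_fun_mono assms)
  then show ?thesis
    by (intro LIMSEQ_le[OF lyapunov_site_expectation[OF assms(1)] lyapunov_site_expectation[OF lam']])
      (auto intro!: divide_right_mono)
qed

lemma lyapunov_site_scale:
  assumes lam: "0 \<le> lam" and r: "1 \<le> r"
  shows "\<alpha>0 (r * lam) z \<le> r * \<alpha>0 lam z"
proof -
  have lam': "0 \<le> r * lam" using assms by simp
  have le: "(\<integral>\<xi>. a0 (r * lam) w \<xi> \<partial>M) \<le> r * (\<integral>\<xi>. a0 lam w \<xi> \<partial>M)" for w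
  proof -
    have "(\<integral>\<xi>. a0 (r * lam) w \<xi> \<partial>M) \<le> (\<integral>\<xi>. r * a0 lam w \<xi> \<partial>M)"
    proof (intro integral_mono integrable_a0 lam' integrable_mult_right[OF integrable_a0[OF lam]])
      show "a0 (r * lam) w \<xi> \<le> r * a0 lam w \<xi>" for \<xi> by (auto simp: a0_def intro!: a_fun_scale assms)
    qed
    then show ?thesis by simp
  qed
  have "(\<lambda>n. r * ((\<integral>\<xi>. a0 lam (of_nat n *s z) \<xi> \<partial>M) / n)) \<longlonglongrightarrow> r * \<alpha>0 lam z"
    by (intro tendsto_mult tendsto_const lyapunov_site_expectation[OF lam])
  then show ?thesis
    by (rule LIMSEQ_le[OF lyapunov_site_expectation[OF lam']])
      (use divide_right_mono[OF le] in auto)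
qed

lemma AE_shape_rational: "AE \<xi> in M. (fst \<xi>, snd \<xi>) \<in> good \<and> (\<forall>lam\<in>{0..} \<inter> \<rat>. shape lam (fst \<xi>) (snd \<xi>))"
proof -
  have "countable ({0..} \<inter> \<rat> :: real set)" by (intro countable_Int2 countable_rat)
  then have "AE \<xi> in M. \<forall>lam\<in>{0..} \<inter> \<rat>. \<forall>v. (\<lambda>n. a0 lam (of_nat n *s v) \<xi> / n) \<longlonglongrightarrow> \<alpha>0 lam v"
    by (subst AE_ball_countable) (auto simp: AE_all_countable intro!: lyapunov_site_AE_L1(1))
  with AE_regular show ?thesis
  proof eventually_elim
    case (elim \<xi>)
    have good: "(fst \<xi>, snd \<xi>) \<in> good" using elim(1) by (simp add: regular_def)
    moreover have "shape lam (fst \<xi>) (snd \<xi>)" if "lam \<in> {0..} \<inter> \<rat>" for lam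
      using elim(2) that good by (intro regular_shape[OF elim(1)]) (auto simp: a0_def)
    ultimately show ?case by blast
  qed
qed

text \<open>A positive \<lambda> is enclosed between rationals \<open>q1\<close> and
  \<open>q2\<close> with ratio near \<open>1\<close>. Monotonicity encloses cost and exponent, and
  scaling bounds the gap between the two exponents by a small multiple of the norm. The value
  \<open>0\<close>, which has no smaller admissible neighbour, is itself rational.\<close>

lemma shape_all:
  assumes good: "(\<omega>, \<sigma>) \<in> good" and rat: "\<forall>lam\<in>{0..} \<inter> \<rat>. shape lam \<omega> \<sigma>" and lam: "0 \<le> lam"
  shows "shape lam \<omega> \<sigma>"
proof (cases "lam = 0")
  case True
  then show ?thesis using rat by simp
next
  case False
  show ?thesis
    unfolding shape_def
  proof (intro allI impI)
    fix \<eta> :: real assume \<eta>: "0 < \<eta>"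
    define C where "C = mean_cost lam"
    have C: "0 \<le> C" unfolding C_def by (rule mean_cost_nonneg[OF lam])
    \<comment> \<open>\<open>t \<le> 1 / 2\<close> keeps \<open>q1\<close> above half of \<lambda>,
      so that \<open>q2 / q1\<close> is at most \<open>1 + 4 * t\<close>; the other bound makes the
      resulting gap \<open>4 * t * C\<close> at most \<open>\<eta> / 2\<close>.\<close>
    define t where "t = min (1 / 2) (\<eta> / (8 * (C + 1)))"
    have t: "0 < t" "t \<le> 1 / 2" "4 * t * C \<le> \<eta> / 2"
    proof -
      show "t \<le> 1 / 2" unfolding t_def by (rule min.cobounded1)
      show "0 < t" using \<eta> C by (simp add: t_def)
      have "t \<le> \<eta> / (8 * (C + 1))" by (simp add: t_def)
      then have "t * (8 * (C + 1)) \<le> \<eta>" using C by (simp add: pos_le_divide_eq)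
      then show "4 * t * C \<le> \<eta> / 2" using \<open>0 < t\<close> by (simp add: algebra_simps)
    qed
    have lp: "0 < lam" using False lam by simp
    have "lam * (1 - t) < lam" using lp t by (simp add: algebra_simps)
    then obtain q1 where q1: "q1 \<in> \<rat>" "lam * (1 - t) < q1" "q1 < lam" using Rats_dense_in_real by blast
    have "lam < lam * (1 + t)" using lp t by (simp add: algebra_simps)
    then obtain q2 where q2: "q2 \<in> \<rat>" "lam < q2" "q2 < lam * (1 + t)" using Rats_dense_in_real by blast
    have "0 < lam * (1 - t)" using lp t by simp
    then have q1p: "0 < q1" using q1 by simp
    define r where "r = q2 / q1"
    have r: "1 \<le> r" "r - 1 \<le> 4 * t" "q2 = r * q1"
    proof -
      show "1 \<le> r" using q1 q2 q1p by (simp add: r_def)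
      show "q2 = r * q1" using q1p by (simp add: r_def)
      have "lam * (1 / 2) \<le> lam * (1 - t)" using lp t by (intro mult_left_mono) auto
      then have "2 * t * lam \<le> 4 * t * q1" using q1 t mult_left_mono[of "lam * (1 / 2)" q1 "4 * t"] by simp
      moreover have "q2 - q1 \<le> 2 * t * lam" using q1 q2 by (simp add: algebra_simps)
      ultimately have "q2 - q1 \<le> 4 * t * q1" by linarith
      then show "r - 1 \<le> 4 * t" using q1p by (simp add: r_def field_simps)
    qed
    have sh: "shape q1 \<omega> \<sigma>" "shape q2 \<omega> \<sigma>" using rat q1 q2 q1p lp by auto
    have \<eta>2: "0 < \<eta> / 2" using \<eta> by simp
    obtain N1 where "\<forall>z. N1 \<le> site_norm z \<longrightarrow> \<bar>a_fun q1 0 z \<omega> \<sigma> - \<alpha>0 q1 z\<bar> \<le> \<eta> / 2 * site_norm z"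
      using sh(1)[unfolded shape_def, rule_format, OF \<eta>2] by blast
    note N1 = this[rule_format]
    obtain N2 where "\<forall>z. N2 \<le> site_norm z \<longrightarrow> \<bar>a_fun q2 0 z \<omega> \<sigma> - \<alpha>0 q2 z\<bar> \<le> \<eta> / 2 * site_norm z"
      using sh(2)[unfolded shape_def, rule_format, OF \<eta>2] by blast
    note N2 = this[rule_format]
    show "\<exists>N. \<forall>z. N \<le> site_norm z \<longrightarrow> \<bar>a_fun lam 0 z \<omega> \<sigma> - \<alpha>0 lam z\<bar> \<le> \<eta> * site_norm z"
    proof (intro exI[of _ "max N1 N2"] allI impI)
      fix z :: "'d site" assume z: "max N1 N2 \<le> site_norm z"
      have a: "a_fun q1 0 z \<omega> \<sigma> \<le> a_fun lam 0 z \<omega> \<sigma>" "a_fun lam 0 z \<omega> \<sigma> \<le> a_fun q2 0 z \<omega> \<sigma>"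
        using q1 q2 q1p lam by (auto intro!: a_fun_mono[OF good])
      have al: "\<alpha>0 q1 z \<le> \<alpha>0 lam z" "\<alpha>0 lam z \<le> \<alpha>0 q2 z"
        using q1 q2 q1p lam by (auto intro!: lyapunov_site_mono)
      have "\<alpha>0 q2 z \<le> r * \<alpha>0 q1 z" unfolding r(3) using q1p r by (intro lyapunov_site_scale) auto
      then have "\<alpha>0 q2 z - \<alpha>0 q1 z \<le> (r - 1) * \<alpha>0 q1 z" by (simp add: algebra_simps)
      also have "\<dots> \<le> 4 * t * \<alpha>0 lam z"
        using r t al lyapunov_site_nonneg[of q1 z] q1p by (intro mult_mono) auto
      also have "\<dots> \<le> 4 * t * (site_norm z * C)"
        using t lyapunov_site_le[OF lam, of z] by (intro mult_left_mono) (auto simp: C_def)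
      also have "\<dots> = (4 * t * C) * site_norm z" by simp
      also have "\<dots> \<le> \<eta> / 2 * site_norm z" using t by (intro mult_right_mono) auto
      finally have "\<alpha>0 q2 z - \<alpha>0 q1 z \<le> \<eta> / 2 * site_norm z" .
      moreover have "\<eta> * site_norm z = \<eta> / 2 * site_norm z + \<eta> / 2 * site_norm z" by simp
      ultimately show "\<bar>a_fun lam 0 z \<omega> \<sigma> - \<alpha>0 lam z\<bar> \<le> \<eta> * site_norm z"
        using N1[of z] N2[of z] z a al unfolding abs_le_iff by linarith
    qed
  qed
qed

section \<open>From lattice points to sequences of real vectors\<close>

context
  fixes br :: "real ^ 'd \<Rightarrow> 'd site" and lam :: real and x :: "nat \<Rightarrow> real ^ 'd"
  assumes br: "nearest_site_rule br" and lam: "0 \<le> lam"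
    and x: "filterlim (\<lambda>n. l1norm (x n)) at_top sequentially"
begin

lemma site_norm_br_le: "site_norm (br y) \<le> l1norm y + CARD('d)"
  using l1norm_triangle[of y "of_site (br y) - y"] nearest_site_dist[OF br, of y]
  by (simp add: l1norm_of_site l1norm_minus[of "of_site (br y)"])

lemma site_norm_br_ge: "l1norm y - CARD('d) \<le> site_norm (br y)"
  using l1norm_triangle[of "y - of_site (br y)" "of_site (br y)"] nearest_site_dist[OF br, of y]
  by (simp add: l1norm_of_site)

text \<open>Replacing \<open>x n\<close> by its lattice point changes the norm and the exponent by
  bounded amounts only, which vanish after division by the norm.\<close>

lemma shape_limit:
  assumes shape: "shape lam \<omega> \<sigma>"
  shows "(\<lambda>n. (a_fun lam 0 (br (x n)) \<omega> \<sigma> - lyapunov \<mu> \<nu> lam (x n)) / l1norm (x n)) \<longlonglongrightarrow> 0"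
proof (rule LIMSEQ_I)
  fix \<eta>' :: real assume "0 < \<eta>'"
  define \<eta> where "\<eta> = \<eta>' / 3"
  have \<eta>: "0 < \<eta>" using \<open>0 < \<eta>'\<close> by (simp add: \<eta>_def)
  obtain N where "\<forall>z. N \<le> site_norm z \<longrightarrow> \<bar>a_fun lam 0 z \<omega> \<sigma> - \<alpha>0 lam z\<bar> \<le> \<eta> * site_norm z"
    using shape[unfolded shape_def, rule_format, OF \<eta>] by blast
  note N = this[rule_format]
  \<comment> \<open>The bounded errors: \<open>\<eta>\<close> times the change of the norm, and the
    Lipschitz bound for the change of the exponent.\<close>
  define D where "D = \<eta> * CARD('d) + mean_cost lam * CARD('d)"
  have "\<forall>\<^sub>F n in sequentially. max (max 1 (N + real CARD('d))) (D / \<eta>) \<le> l1norm (x n)"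
    using x unfolding filterlim_at_top by blast
  then have "\<forall>\<^sub>F n in sequentially. norm ((a_fun lam 0 (br (x n)) \<omega> \<sigma> - lyapunov \<mu> \<nu> lam (x n)) / l1norm (x n) - 0) < \<eta>'"
  proof eventually_elim
    case (elim n)
    define l where "l = l1norm (x n)"
    have l: "1 \<le> l" "N + real CARD('d) \<le> l" "D \<le> \<eta> * l"
      using elim \<eta> by (simp_all add: l_def pos_divide_le_eq mult.commute)
    have "N \<le> site_norm (br (x n))" using site_norm_br_ge[of "x n"] l(2) unfolding l_def by linarith
    then have "\<bar>a_fun lam 0 (br (x n)) \<omega> \<sigma> - \<alpha>0 lam (br (x n))\<bar> \<le> \<eta> * site_norm (br (x n))" by (rule N)
    also have "\<dots> \<le> \<eta> * (l + CARD('d))" using \<eta> site_norm_br_le[of "x n"] unfolding l_def by (intro mult_left_mono) auto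
    finally have 1: "\<bar>a_fun lam 0 (br (x n)) \<omega> \<sigma> - \<alpha>0 lam (br (x n))\<bar> \<le> \<eta> * l + \<eta> * CARD('d)" by (simp add: algebra_simps)
    have "\<bar>lyapunov \<mu> \<nu> lam (of_site (br (x n))) - lyapunov \<mu> \<nu> lam (x n)\<bar> \<le> mean_cost lam * l1norm (x n - of_site (br (x n)))"
      using lyapunov_Lipschitz[OF lam, of "x n" "of_site (br (x n))"] by (simp add: abs_minus_commute)
    also have "\<dots> \<le> mean_cost lam * CARD('d)"
      by (intro mult_left_mono nearest_site_dist[OF br] mean_cost_nonneg[OF lam])
    finally have 2: "\<bar>\<alpha>0 lam (br (x n)) - lyapunov \<mu> \<nu> lam (x n)\<bar> \<le> mean_cost lam * CARD('d)"
      by (simp add: lyapunov_of_site[OF lam])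
    have "\<bar>a_fun lam 0 (br (x n)) \<omega> \<sigma> - lyapunov \<mu> \<nu> lam (x n)\<bar> \<le> \<eta> * l + D"
      using 1 2 unfolding D_def by linarith
    also have "\<dots> \<le> 2 * \<eta> * l" using l by simp
    also have "\<dots> < \<eta>' * l" using \<eta> l by (simp add: \<eta>_def)
    finally show ?case using l by (simp add: l_def[symmetric] abs_divide pos_divide_less_eq)
  qed
  then show "\<exists>no. \<forall>n\<ge>no. norm ((a_fun lam 0 (br (x n)) \<omega> \<sigma> - lyapunov \<mu> \<nu> lam (x n)) / l1norm (x n) - 0) < \<eta>'"
    by (simp add: eventually_sequentially)
qed

text \<open>The almost sure limit for this sequence is upgraded by \<open>a0_L1_of_AE\<close>. The
  moving centres \<open>c n\<close> are bounded by the Lipschitz constant, since the exponent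
  vanishes at the origin.\<close>

lemma shape_L1:
  "L1_limit M (\<lambda>n (\<omega>, \<sigma>). (a_fun lam 0 (br (x n)) \<omega> \<sigma> - lyapunov \<mu> \<nu> lam (x n)) / l1norm (x n)) 0"
proof -
  define c where "c n = lyapunov \<mu> \<nu> lam (x n) / l1norm (x n)" for n
  have cb: "\<bar>c n\<bar> \<le> mean_cost lam" for n
  proof -
    have "lyapunov \<mu> \<nu> lam 0 = 0"
      using lyapunov_of_site[OF lam, of 0] lyapunov_site_le[OF lam, of 0] lyapunov_site_nonneg[OF lam, of 0]
      by (simp add: of_site_def site_norm_def zero_vec_def)
    then have "\<bar>lyapunov \<mu> \<nu> lam (x n)\<bar> \<le> mean_cost lam * l1norm (x n)"
      using lyapunov_Lipschitz[OF lam, of "x n" 0] by simp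
    then show ?thesis
      using l1norm_nonneg[of "x n"] mean_cost_nonneg[OF lam]
      by (cases "l1norm (x n) = 0") (auto simp: c_def abs_divide pos_divide_le_eq less_le)
  qed
  have ae: "AE \<xi> in M. (\<lambda>n. a0 lam (br (x n)) \<xi> / l1norm (x n) - c n) \<longlonglongrightarrow> 0"
    using AE_shape_rational
  proof eventually_elim
    case (elim \<xi>)
    then have "shape lam (fst \<xi>) (snd \<xi>)" by (intro shape_all lam) auto
    from shape_limit[OF this] show ?case using elim by (simp add: a0_def c_def diff_divide_distrib)
  qed
  have L1: "(\<lambda>n. \<integral>\<xi>. \<bar>a0 lam (br (x n)) \<xi> / l1norm (x n) - c n\<bar> \<partial>M) \<longlonglongrightarrow> 0"
  proof (rule a0_L1_of_AE[OF lam ae _ cb])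
    have "\<forall>\<^sub>F n in sequentially. 1 \<le> l1norm (x n)" using x unfolding filterlim_at_top by blast
    then show "\<forall>\<^sub>F n in sequentially. 0 < l1norm (x n) \<and> real (site_norm (br (x n))) \<le> (1 + real CARD('d)) * l1norm (x n)"
    proof eventually_elim
      case (elim n)
      have "real CARD('d) * 1 \<le> real CARD('d) * l1norm (x n)" using elim by (intro mult_left_mono) auto
      then show ?case using site_norm_br_le[of "x n"] elim unfolding distrib_right by linarith
    qed
  qed
  have m: "(\<lambda>\<xi>. a_fun lam 0 z (fst \<xi>) (snd \<xi>)) \<in> borel_measurable M" for z
    using a_fun_measurable[OF lam] by (simp add: case_prod_unfold)
  have i: "integrable M (\<lambda>\<xi>. a_fun lam 0 z (fst \<xi>) (snd \<xi>))" for z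
    by (rule integrable_cong_AE_imp[OF integrable_a0[OF lam] m AE_a0])
  have "(\<integral>\<xi>. \<bar>(a_fun lam 0 (br (x n)) (fst \<xi>) (snd \<xi>) - lyapunov \<mu> \<nu> lam (x n)) / l1norm (x n) - 0\<bar> \<partial>M) =
      (\<integral>\<xi>. \<bar>a0 lam (br (x n)) \<xi> / l1norm (x n) - c n\<bar> \<partial>M)" for n
  proof (rule integral_cong_AE)
    show "AE \<xi> in M. \<bar>(a_fun lam 0 (br (x n)) (fst \<xi>) (snd \<xi>) - lyapunov \<mu> \<nu> lam (x n)) / l1norm (x n) - 0\<bar> =
        \<bar>a0 lam (br (x n)) \<xi> / l1norm (x n) - c n\<bar>"
      using AE_a0[of lam "br (x n)"] by eventually_elim (simp add: c_def diff_divide_distrib)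
  qed (use m a0_measurable[OF lam] in auto)
  then show ?thesis using L1 i by (simp add: L1_limit_def case_prod_unfold)
qed

end

end

theorem mainTheorem2:
  fixes \<mu> :: "('d::finite) site measure measure"
    and \<nu> :: "real measure measure"
    and br :: "real ^ 'd \<Rightarrow> 'd site"
  assumes "prob_space \<mu>" and "sets \<mu> = sets jump_laws"
    and "prob_space \<nu>" and "sets \<nu> = sets holding_laws"
    and "nearest_site_rule br"
    and "AE \<omega> in iid_field \<mu>. 0 < min_jump (\<omega> :: 'd jump_env)"
    and "integrable (iid_field \<mu>) (\<lambda>\<omega> :: 'd jump_env. \<bar>ln (min_jump \<omega>)\<bar> ^ CARD('d))"
    and "(\<integral>\<^sup>+ \<sigma>. mean_holding (\<sigma> :: 'd holding_env) ^ CARD('d) \<partial>iid_field \<nu>) < \<infinity>"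
    and "0 \<in> convex hull measure_support (distr (iid_field \<mu>) borel (drift :: 'd jump_env \<Rightarrow> real ^ 'd))"
  shows "(AE (\<omega>, \<sigma>) in env_law \<mu> \<nu>.
            \<forall>lam\<ge>0. \<forall>x :: nat \<Rightarrow> real ^ 'd.
              filterlim (\<lambda>n. l1norm (x n)) at_top sequentially \<longrightarrow>
              (\<lambda>n. (a_fun lam 0 (br (x n)) \<omega> \<sigma> - lyapunov \<mu> \<nu> lam (x n)) / l1norm (x n)) \<longlonglongrightarrow> 0)
       \<and> (\<forall>lam\<ge>0. \<forall>x :: nat \<Rightarrow> real ^ 'd.
              filterlim (\<lambda>n. l1norm (x n)) at_top sequentially \<longrightarrow>
              L1_limit (env_law \<mu> \<nu>)
                (\<lambda>n (\<omega>, \<sigma>). (a_fun lam 0 (br (x n)) \<omega> \<sigma> - lyapunov \<mu> \<nu> lam (x n)) / l1norm (x n)) 0)"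
proof -
  interpret rwre \<mu> \<nu> by (rule rwre.intro; fact assms)
  have "AE (\<omega>, \<sigma>) in env_law \<mu> \<nu>. \<forall>lam\<ge>0. \<forall>x :: nat \<Rightarrow> real ^ 'd.
      filterlim (\<lambda>n. l1norm (x n)) at_top sequentially \<longrightarrow>
      (\<lambda>n. (a_fun lam 0 (br (x n)) \<omega> \<sigma> - lyapunov \<mu> \<nu> lam (x n)) / l1norm (x n)) \<longlonglongrightarrow> 0"
    using AE_shape_rational
  proof eventually_elim
    case (elim \<xi>)
    \<comment> \<open>A single null set, found for rational \<lambda>, serves all \<lambda> and all
      sequences: from here on the argument is deterministic.\<close>
    then have "shape lam (fst \<xi>) (snd \<xi>)" if "0 \<le> lam" for lam using that by (intro shape_all) auto
    then show ?case using shape_limit[OF assms(5)] by (simp add: case_prod_unfold)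
  qed
  then show ?thesis using shape_L1[OF assms(5)] by blast
qed

end
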